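(* Let $X$ be a compact connected Riemann surface. Let $d$ be the gonality of $X$. Take any integer $n \geq d$. Then the symmetric product $S^n(X)$ does not admit any Kähler form of nonpositive holomorphic sectional curvature.
   Context: For a compact connected Riemann surface $X$ and a positive integer $n$, the symmetric product $S^n(X)$ is the quotient of the Cartesian product $X^n$ by the natural action of the group of permutations of the index set $\{1,\dots,n\}$; it is a smooth complex projective variety (compact complex manifold) of dimension $n$. The gonality of $X$ is the smallest integer $d$ such that there is a nonconstant holomorphic map $X \longrightarrow \mathbb{C}\mathbb{P}^1$ of degree $d$. A Kähler form has nonpositive holomorphic sectional curvature if all holomorphic sectional curvatures of the corresponding Kähler metric are nonpositive. *)

theory Defs
  imports "HOL-Complex_Analysis.Complex_Analysis"
begin

section \<open>Charts and Riemann surfaces\<close>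

text \<open>A chart is a domain together with a coordinate map; only the values of the map on the
  domain matter.\<close>

type_synonym ('p, 'e) chart = "'p set \<times> ('p \<Rightarrow> 'e)"

abbreviation chart_inv :: "('p, 'e) chart \<Rightarrow> 'e \<Rightarrow> 'p" where
  "chart_inv c \<equiv> inv_into (fst c) (snd c)"

abbreviation chart_image :: "('p, 'e) chart \<Rightarrow> 'e set" where
  "chart_image c \<equiv> snd c ` fst c"

definition is_chart :: "'p topology \<Rightarrow> ('p, 'e::topological_space) chart \<Rightarrow> bool" where
  "is_chart T c \<longleftrightarrow> openin T (fst c) \<and> open (chart_image c) \<and>
     homeomorphic_map (subtopology T (fst c)) (top_of_set (chart_image c)) (snd c)"

definition transition :: "('p, 'e) chart \<Rightarrow> ('p, 'e) chart \<Rightarrow> 'e \<Rightarrow> 'e" where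
  "transition c c' = snd c' \<circ> chart_inv c"

definition riemann_surface :: "'a topology \<Rightarrow> ('a, complex) chart set \<Rightarrow> bool" where
  "riemann_surface X A \<longleftrightarrow> Hausdorff_space X \<and> (\<forall>c\<in>A. is_chart X c) \<and>
     (\<Union>c\<in>A. fst c) = topspace X \<and>
     (\<forall>c\<in>A. \<forall>c'\<in>A. transition c c' holomorphic_on snd c ` (fst c \<inter> fst c'))"

definition holomorphic_map :: "'a topology \<Rightarrow> ('a, complex) chart set \<Rightarrow>
    'b topology \<Rightarrow> ('b, complex) chart set \<Rightarrow> ('a \<Rightarrow> 'b) \<Rightarrow> bool" where
  "holomorphic_map X A Y B f \<longleftrightarrow> continuous_map X Y f \<and>
     (\<forall>c\<in>A. \<forall>c'\<in>B. (snd c' \<circ> f \<circ> chart_inv c) holomorphic_on snd c ` {x\<in>fst c. f x \<in> fst c'})"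

definition nonconstant_map :: "'a topology \<Rightarrow> ('a \<Rightarrow> 'b) \<Rightarrow> bool" where
  "nonconstant_map X f \<longleftrightarrow> \<not> (\<exists>y. \<forall>x\<in>topspace X. f x = y)"

text \<open>The multiplicity (ramification index) of \<open>f\<close> at \<open>x\<close>: the order of vanishing of
  \<open>f - f x\<close> in local coordinates, which does not depend on the coordinates.\<close>

definition map_mult :: "('a, complex) chart set \<Rightarrow> ('b, complex) chart set \<Rightarrow>
    ('a \<Rightarrow> 'b) \<Rightarrow> 'a \<Rightarrow> nat" where
  "map_mult A B f x = (THE k. \<forall>c\<in>A. \<forall>c'\<in>B. x \<in> fst c \<longrightarrow> f x \<in> fst c' \<longrightarrow>
     zorder (\<lambda>z. snd c' (f (chart_inv c z)) - snd c' (f x)) (snd c x) = int k)"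

text \<open>The degree is the number of points, counted with multiplicity, in any fibre.  The fibres
  of a nonconstant holomorphic map on a compact connected Riemann surface are finite.\<close>

definition has_degree :: "'a topology \<Rightarrow> ('a, complex) chart set \<Rightarrow>
    'b topology \<Rightarrow> ('b, complex) chart set \<Rightarrow> ('a \<Rightarrow> 'b) \<Rightarrow> nat \<Rightarrow> bool" where
  "has_degree X A Y B f d \<longleftrightarrow>
     (\<forall>y\<in>topspace Y. (\<Sum>x\<in>{x\<in>topspace X. f x = y}. map_mult A B f x) = d)"

text \<open>The complex projective line as the Riemann sphere: \<open>Some z\<close> is the point
  \<open>[1 : z]\<close> and \<open>None\<close> is the point \<open>[0 : 1]\<close> at infinity.\<close>

definition CP1 :: "complex option topology" where
  "CP1 = Alexandroff_compactification euclidean"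

definition CP1_atlas :: "(complex option, complex) chart set" where
  "CP1_atlas = {(range Some, the),
     (- {Some 0}, \<lambda>p. case p of None \<Rightarrow> 0 | Some z \<Rightarrow> inverse z)}"

definition is_gonality :: "'a topology \<Rightarrow> ('a, complex) chart set \<Rightarrow> nat \<Rightarrow> bool" where
  "is_gonality X A d \<longleftrightarrow>
     (\<exists>f. holomorphic_map X A CP1 CP1_atlas f \<and> nonconstant_map X f \<and>
        has_degree X A CP1 CP1_atlas f d) \<and>
     (\<forall>f e. holomorphic_map X A CP1 CP1_atlas f \<longrightarrow> nonconstant_map X f \<longrightarrow>
        has_degree X A CP1 CP1_atlas f e \<longrightarrow> d \<le> e)"


section \<open>Symmetric products\<close>

text \<open>Points of \<open>X^n\<close> are functions on an index type with \<open>n\<close> elements, and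
  points of \<open>S^n(X)\<close> are orbits of such functions under permutation of the indices.\<close>

definition sym_orbit :: "('n \<Rightarrow> 'a) \<Rightarrow> ('n \<Rightarrow> 'a) set" where
  "sym_orbit p = {p \<circ> \<sigma> |\<sigma>. \<sigma> permutes UNIV}"

abbreviation power_space :: "'a topology \<Rightarrow> ('n \<Rightarrow> 'a) topology" where
  "power_space X \<equiv> product_topology (\<lambda>_. X) UNIV"

definition sym_product :: "'a topology \<Rightarrow> ('n \<Rightarrow> 'a) set topology" where
  "sym_product X = topology (\<lambda>W. W \<subseteq> sym_orbit ` topspace (power_space X) \<and>
     openin (power_space X) {p \<in> topspace (power_space X). sym_orbit p \<in> W})"

lemma openin_sym_product:
  fixes W :: "('n \<Rightarrow> 'a) set set"
  shows "openin (sym_product X) W \<longleftrightarrow> W \<subseteq> sym_orbit ` topspace (power_space X) \<and>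
     openin (power_space X) {p \<in> topspace (power_space X). sym_orbit p \<in> W}"
proof -
  let ?T = "power_space X :: ('n \<Rightarrow> 'a) topology"
  let ?q = "\<lambda>W :: ('n \<Rightarrow> 'a) set set. {p \<in> topspace ?T. sym_orbit p \<in> W}"
  have "istopology (\<lambda>W. W \<subseteq> sym_orbit ` topspace ?T \<and> openin ?T (?q W))"
    unfolding istopology_def
  proof (intro conjI allI impI)
    fix S W :: "('n \<Rightarrow> 'a) set set"
    assume S: "S \<subseteq> sym_orbit ` topspace ?T \<and> openin ?T (?q S)"
      and W: "W \<subseteq> sym_orbit ` topspace ?T \<and> openin ?T (?q W)"
    then show "S \<inter> W \<subseteq> sym_orbit ` topspace ?T" by blast
    have "?q (S \<inter> W) = ?q S \<inter> ?q W" by auto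
    then show "openin ?T (?q (S \<inter> W))" using openin_Int[of ?T "?q S" "?q W"] S W by simp
  next
    fix K :: "('n \<Rightarrow> 'a) set set set"
    assume K: "\<forall>W\<in>K. W \<subseteq> sym_orbit ` topspace ?T \<and> openin ?T (?q W)"
    then show "\<Union>K \<subseteq> sym_orbit ` topspace ?T" by blast
    have "?q (\<Union>K) = \<Union>(?q ` K)" by auto
    moreover have "openin ?T (\<Union>(?q ` K))" using K by (intro openin_Union) auto
    ultimately show "openin ?T (?q (\<Union>K))" by simp
  qed
  then show ?thesis unfolding sym_product_def by simp
qed

lemma topspace_sym_product:
  "topspace (sym_product X :: ('n \<Rightarrow> 'a) set topology) = sym_orbit ` topspace (power_space X)"
proof (rule antisym)
  let ?T = "power_space X :: ('n \<Rightarrow> 'a) topology"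
  show "topspace (sym_product X) \<subseteq> sym_orbit ` topspace ?T"
    using openin_sym_product[of X "topspace (sym_product X)"] by blast
  have "{p \<in> topspace ?T. sym_orbit p \<in> sym_orbit ` topspace ?T} = topspace ?T" by auto
  then have "openin (sym_product X) (sym_orbit ` topspace ?T)"
    unfolding openin_sym_product using openin_topspace[of ?T] by (simp only: subset_refl simp_thms)
  then show "sym_orbit ` topspace ?T \<subseteq> topspace (sym_product X)"
    by (rule openin_subset)
qed

lemma quotient_map_sym_orbit: "quotient_map (power_space X) (sym_product X) sym_orbit"
  unfolding quotient_map_def topspace_sym_product openin_sym_product by blast

text \<open>Holomorphic functions of several complex variables, on open sets.\<close>

definition holomorphic_fun_on :: "(complex ^ 'n \<Rightarrow> complex) \<Rightarrow> (complex ^ 'n::finite) set \<Rightarrow> bool" where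
  "holomorphic_fun_on h S \<longleftrightarrow>
     (\<forall>z\<in>S. \<exists>D. (h has_derivative D) (at z) \<and> (\<forall>a v. D (a *s v) = a * D v))"

text \<open>Holomorphic functions on an open subset \<open>S\<close> of \<open>X^n\<close>, in terms of
  the product charts obtained by choosing one chart of \<open>X\<close> for each index.\<close>

definition holomorphic_power_on ::
    "('a, complex) chart set \<Rightarrow> (('n::finite \<Rightarrow> 'a) \<Rightarrow> complex) \<Rightarrow> ('n \<Rightarrow> 'a) set \<Rightarrow> bool" where
  "holomorphic_power_on A h S \<longleftrightarrow> (\<forall>c. (\<forall>i. c i \<in> A) \<longrightarrow>
     holomorphic_fun_on (\<lambda>z. h (\<lambda>i. chart_inv (c i) (z $ i)))
       {z. (\<forall>i. z $ i \<in> chart_image (c i)) \<and> (\<lambda>i. chart_inv (c i) (z $ i)) \<in> S})"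

text \<open>The complex structure of \<open>S^n(X)\<close> is that of the quotient of the complex manifold
  \<open>X^n\<close>: a function on an open subset of \<open>S^n(X)\<close> is holomorphic iff its
  pullback to \<open>X^n\<close> is.  The charts are the homeomorphisms onto open subsets of
  \<open>\<complex>^n\<close> that identify these functions with the holomorphic functions on the image.
  Transition maps between two such charts are therefore biholomorphic; that the charts cover
  \<open>S^n(X)\<close> is the theorem on elementary symmetric functions.\<close>

definition sym_atlas :: "'a topology \<Rightarrow> ('a, complex) chart set \<Rightarrow>
    (('n::finite \<Rightarrow> 'a) set, complex ^ 'n) chart set" where
  "sym_atlas X A = {c. is_chart (sym_product X) c \<and>
     (\<forall>E h. open E \<longrightarrow> E \<subseteq> chart_image c \<longrightarrow>
        (holomorphic_fun_on h E \<longleftrightarrow>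
         holomorphic_power_on A (\<lambda>p. h (snd c (sym_orbit p)))
           {p \<in> topspace (power_space X). sym_orbit p \<in> fst c \<and> snd c (sym_orbit p) \<in> E}))}"


section \<open>Riemannian metrics in a coordinate domain\<close>

text \<open>\<open>dirD f x v\<close> is the derivative of \<open>f\<close> at \<open>x\<close> in the
  direction \<open>v\<close>.\<close>

abbreviation dirD :: "('e::euclidean_space \<Rightarrow> 'f::euclidean_space) \<Rightarrow> 'e \<Rightarrow> 'e \<Rightarrow> 'f" where
  "dirD f x v \<equiv> frechet_derivative f (at x) v"

primrec Ck_on :: "nat \<Rightarrow> 'e::euclidean_space set \<Rightarrow> ('e \<Rightarrow> real) \<Rightarrow> bool" where
  "Ck_on 0 S f \<longleftrightarrow> continuous_on S f"
| "Ck_on (Suc k) S f \<longleftrightarrow> (\<forall>x\<in>S. f differentiable (at x)) \<and> (\<forall>v. Ck_on k S (\<lambda>x. dirD f x v))"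

definition smooth_on :: "'e::euclidean_space set \<Rightarrow> ('e \<Rightarrow> real) \<Rightarrow> bool" where
  "smooth_on S f \<longleftrightarrow> (\<forall>k. Ck_on k S f)"

text \<open>The Levi-Civita connection of the metric \<open>g\<close>: for vector fields
  \<open>u\<close>, \<open>v\<close> with constant coefficients, \<open>christoffel g x u v\<close> is the
  covariant derivative of \<open>v\<close> along \<open>u\<close> at \<open>x\<close>, given by the Koszul formula.\<close>

definition christoffel :: "('e::euclidean_space \<Rightarrow> 'e \<Rightarrow> 'e \<Rightarrow> real) \<Rightarrow> 'e \<Rightarrow> 'e \<Rightarrow> 'e \<Rightarrow> 'e" where
  "christoffel g x u v = (THE a. \<forall>w. 2 * g x a w =
     dirD (\<lambda>y. g y v w) x u + dirD (\<lambda>y. g y u w) x v - dirD (\<lambda>y. g y u v) x w)"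

text \<open>The curvature tensor \<open>R(u,v)w = D_u D_v w - D_v D_u w\<close>, for fields with constant
  coefficients (which commute).\<close>

definition riemann_curvature ::
    "('e::euclidean_space \<Rightarrow> 'e \<Rightarrow> 'e \<Rightarrow> real) \<Rightarrow> 'e \<Rightarrow> 'e \<Rightarrow> 'e \<Rightarrow> 'e \<Rightarrow> 'e" where
  "riemann_curvature g x u v w =
     dirD (\<lambda>y. christoffel g y v w) x u + christoffel g x u (christoffel g x v w)
     - (dirD (\<lambda>y. christoffel g y u w) x v + christoffel g x v (christoffel g x u w))"

definition sectional_curvature ::
    "('e::euclidean_space \<Rightarrow> 'e \<Rightarrow> 'e \<Rightarrow> real) \<Rightarrow> 'e \<Rightarrow> 'e \<Rightarrow> 'e \<Rightarrow> real" where
  "sectional_curvature g x u v =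
     g x (riemann_curvature g x u v v) u / (g x u u * g x v v - (g x u v)\<^sup>2)"


section \<open>Kaehler forms and holomorphic sectional curvature\<close>

text \<open>A 2-form on a complex manifold is represented by its coordinate expressions
  \<open>\<omega> c x v w\<close>: the value at the point with coordinates \<open>x\<close> in the chart
  \<open>c\<close>, on the tangent vectors with coordinates \<open>v\<close> and \<open>w\<close>.\<close>

type_synonym ('p, 'n) two_form = "('p, complex ^ 'n) chart \<Rightarrow>
    complex ^ 'n \<Rightarrow> complex ^ 'n \<Rightarrow> complex ^ 'n \<Rightarrow> real"

definition smooth_two_form ::
    "('p, complex ^ 'n::finite) chart set \<Rightarrow> ('p, 'n) two_form \<Rightarrow> bool" where
  "smooth_two_form A \<omega> \<longleftrightarrow>
     (\<forall>c\<in>A. \<forall>x\<in>chart_image c. bilinear (\<omega> c x) \<and> (\<forall>v. \<omega> c x v v = 0)) \<and>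
     (\<forall>c\<in>A. \<forall>v w. smooth_on (chart_image c) (\<lambda>x. \<omega> c x v w)) \<and>
     (\<forall>c\<in>A. \<forall>c'\<in>A. \<forall>x\<in>snd c ` (fst c \<inter> fst c'). \<forall>v w.
        \<omega> c x v w =
          \<omega> c' (transition c c' x) (dirD (transition c c') x v) (dirD (transition c c') x w))"

definition closed_two_form ::
    "('p, complex ^ 'n::finite) chart set \<Rightarrow> ('p, 'n) two_form \<Rightarrow> bool" where
  "closed_two_form A \<omega> \<longleftrightarrow> (\<forall>c\<in>A. \<forall>x\<in>chart_image c. \<forall>u v w.
     dirD (\<lambda>y. \<omega> c y v w) x u + dirD (\<lambda>y. \<omega> c y w u) x v + dirD (\<lambda>y. \<omega> c y u v) x w = 0)"

abbreviation J :: "complex ^ 'n \<Rightarrow> complex ^ 'n" where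
  "J v \<equiv> \<i> *s v"

definition kaehler_form ::
    "('p, complex ^ 'n::finite) chart set \<Rightarrow> ('p, 'n) two_form \<Rightarrow> bool" where
  "kaehler_form A \<omega> \<longleftrightarrow> smooth_two_form A \<omega> \<and> closed_two_form A \<omega> \<and>
     (\<forall>c\<in>A. \<forall>x\<in>chart_image c.
        (\<forall>v w. \<omega> c x (J v) (J w) = \<omega> c x v w) \<and>
        (\<forall>v. v \<noteq> 0 \<longrightarrow> \<omega> c x v (J v) > 0))"

definition kaehler_metric :: "('p, 'n::finite) two_form \<Rightarrow> ('p, 'n) two_form" where
  "kaehler_metric \<omega> c x v w = \<omega> c x v (J w)"

text \<open>The holomorphic sectional curvature in the direction \<open>v\<close> is the sectional curvature
  of the complex line spanned by \<open>v\<close>.\<close>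

definition holomorphic_sectional_curvature :: "('p, 'n::finite) two_form \<Rightarrow>
    ('p, complex ^ 'n) chart \<Rightarrow> complex ^ 'n \<Rightarrow> complex ^ 'n \<Rightarrow> real" where
  "holomorphic_sectional_curvature \<omega> c x v = sectional_curvature (kaehler_metric \<omega> c) x v (J v)"

definition nonpositive_hsc ::
    "('p, complex ^ 'n::finite) chart set \<Rightarrow> ('p, 'n) two_form \<Rightarrow> bool" where
  "nonpositive_hsc A \<omega> \<longleftrightarrow> (\<forall>c\<in>A. \<forall>x\<in>chart_image c. \<forall>v. v \<noteq> 0 \<longrightarrow>
     holomorphic_sectional_curvature \<omega> c x v \<le> 0)"

end

theory Submission
  imports Defs "HOL-Computational_Algebra.Fundamental_Theorem_Algebra"
begin

text \<open>Let \<open>f\<close> be a meromorphic function whose degree is the gonality \<open>d\<close> of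
  \<open>X\<close>. Its fibres, completed to divisors of degree \<open>n\<close> by
  \<open>n - d\<close> copies of a fixed point \<open>x0\<close>, are points of
  \<open>S^n(X)\<close>, and they form a nonconstant holomorphic map \<open>\<phi>\<close> from
  the projective line to \<open>S^n(X)\<close>. A Kaehler metric \<open>g\<close> of nonpositive
  holomorphic sectional curvature excludes such a map. Indeed, let
  \<open>E z = g (\<phi>' z) (\<phi>' z)\<close> be its squared speed on the affine part
  \<open>\<complex>\<close>. The curvature of the complex curve \<open>\<phi>\<close> does not
  exceed that of \<open>g\<close>, so
  \<open>E \<cdot> \<Delta>E \<ge> |\<nabla>E|\<^sup>2\<close>, that is, \<open>log E\<close>
  is subharmonic. Then \<open>log E + log (1 + |z|\<^sup>2)\<close> is strictly subharmonic
  where \<open>E > 0\<close>, and \<open>E z \<cdot> (1 + |z|\<^sup>2)\<close> has no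
  positive local maximum (\<open>no_local_maximum\<close>). But \<open>\<phi>\<close> is
  holomorphic at infinity too, hence \<open>E z = O(|z|^(-4))\<close>, so the product would
  tend to \<open>0\<close> at infinity and attain a positive maximum
  (\<open>no_holomorphic_sphere\<close>).

  The remaining work makes \<open>\<phi>\<close> holomorphic in charts of \<open>S^n(X)\<close>.
  Around finitely many points of \<open>X\<close> choose disjoint coordinate discs with disjoint
  images; they form one open set \<open>U\<close> with one injective holomorphic function
  \<open>\<zeta>\<close> (\<open>exists_local_coordinate\<close>). The chart of
  \<open>S^n(U)\<close> sends the orbit of \<open>p\<close> to
  \<open>\<sigma> (\<zeta> (p 1), \<dots>, \<zeta> (p n))\<close>, where
  \<open>\<sigma>\<close> takes the roots of a monic polynomial to the coordinates of that
  polynomial. That these are charts means that \<open>\<sigma>\<close> is open with the orbits as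
  its fibres (\<open>open_\<sigma>_image\<close>, \<open>\<sigma>_eqD\<close>) and that a function
  is holomorphic as soon as its pullback under \<open>\<sigma>\<close> is
  (\<open>holomorphic_of_pullback\<close>).

  Over the regular values of \<open>f\<close> the points of the fibre are locally \<open>d\<close>
  holomorphic functions of the value, so \<open>\<phi>\<close> is holomorphic there. Near one of
  the finitely many critical values the coordinates of \<open>\<phi>\<close> are bounded, so they
  extend holomorphically, and the limit stays in the chart because \<open>\<sigma>\<close> is a
  closed map (\<open>local_holomorphic_curve\<close>).\<close>

section \<open>The curvature of a Kaehler metric along a holomorphic curve\<close>

lemma bilinear_expand:
  fixes B :: "'e::euclidean_space \<Rightarrow> 'e \<Rightarrow> 'f::real_vector"
  assumes "bilinear B"
  shows "B p q = (\<Sum>b\<in>Basis. \<Sum>b'\<in>Basis. ((p \<bullet> b) * (q \<bullet> b')) *\<^sub>R B b b')"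
proof -
  have "B p q = B (\<Sum>b\<in>Basis. (p \<bullet> b) *\<^sub>R b) (\<Sum>b'\<in>Basis. (q \<bullet> b') *\<^sub>R b')"
    by (simp add: euclidean_representation)
  also have "\<dots> = (\<Sum>b\<in>Basis. \<Sum>b'\<in>Basis. ((p \<bullet> b) * (q \<bullet> b')) *\<^sub>R B b b')"
    by (simp add: bilinear_sum[OF assms] sum.cartesian_product bilinear_lmul[OF assms]
        bilinear_rmul[OF assms] mult.commute)
  finally show ?thesis .
qed

text \<open>The product rule for a bilinear map whose coefficients depend on the point: it serves both the
  metric and the Christoffel symbols, evaluated on vector fields along a curve.\<close>

lemma has_vector_derivative_bilinear_field:
  fixes B :: "'e::euclidean_space \<Rightarrow> 'e \<Rightarrow> 'e \<Rightarrow> 'f::euclidean_space"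
    and \<gamma> :: "real \<Rightarrow> 'e"
  assumes S: "open S" "\<gamma> t0 \<in> S"
    and bil: "\<And>y. y \<in> S \<Longrightarrow> bilinear (B y)"
    and diff: "\<And>a b. (\<lambda>y. B y a b) differentiable at (\<gamma> t0)"
    and \<gamma>: "(\<gamma> has_vector_derivative \<gamma>') (at t0)"
    and p: "(p has_vector_derivative p') (at t0)"
    and q: "(q has_vector_derivative q') (at t0)"
  shows "((\<lambda>t. B (\<gamma> t) (p t) (q t)) has_vector_derivative
     (dirD (\<lambda>y. B y (p t0) (q t0)) (\<gamma> t0) \<gamma>' + B (\<gamma> t0) p' (q t0) + B (\<gamma> t0) (p t0) q')) (at t0)"
proof -
  let ?D = "\<lambda>a b. frechet_derivative (\<lambda>y. B y a b) (at (\<gamma> t0))"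
  have hd: "((\<lambda>y. B y a b) has_derivative ?D a b) (at (\<gamma> t0))" for a b
    using diff frechet_derivative_works by blast
  have cont: "isCont \<gamma> t0" using \<gamma> has_vector_derivative_continuous by blast
  have ev: "eventually (\<lambda>t. \<gamma> t \<in> S) (nhds t0)"
    using topological_tendstoD[OF cont[unfolded isCont_def] S] S(2) by (simp add: eventually_nhds_conv_at)
  have Bg: "((\<lambda>t. B (\<gamma> t) b b') has_vector_derivative ?D b b' \<gamma>') (at t0)" for b b'
    using vector_derivative_diff_chain_within[OF \<gamma>, of "\<lambda>y. B y b b'" "?D b b'"] hd
    by (auto simp: o_def intro: has_derivative_at_withinI)
  have pb: "((\<lambda>t. p t \<bullet> b) has_vector_derivative p' \<bullet> b) (at t0)" for b
    using bounded_linear.has_vector_derivative[OF bounded_linear_inner_left p] .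
  have qb: "((\<lambda>t. q t \<bullet> b) has_vector_derivative q' \<bullet> b) (at t0)" for b
    using bounded_linear.has_vector_derivative[OF bounded_linear_inner_left q] .
  let ?E = "\<lambda>t. \<Sum>b\<in>Basis. \<Sum>b'\<in>Basis. ((p t \<bullet> b) * (q t \<bullet> b')) *\<^sub>R B (\<gamma> t) b b'"
  let ?E' = "\<Sum>b\<in>Basis. \<Sum>b'\<in>Basis. ((p t0 \<bullet> b) * (q t0 \<bullet> b')) *\<^sub>R ?D b b' \<gamma>'
      + ((p t0 \<bullet> b) * (q' \<bullet> b') + (p' \<bullet> b) * (q t0 \<bullet> b')) *\<^sub>R B (\<gamma> t0) b b'"
  have pq: "((\<lambda>t. (p t \<bullet> b) * (q t \<bullet> b')) has_field_derivative
       ((p t0 \<bullet> b) * (q' \<bullet> b') + (p' \<bullet> b) * (q t0 \<bullet> b'))) (at t0)" for b b'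
    using pb[of b] qb[of b'] unfolding has_real_derivative_iff_has_vector_derivative[symmetric]
    by (auto intro!: derivative_eq_intros)
  have E: "(?E has_vector_derivative ?E') (at t0)"
    by (intro has_vector_derivative_sum has_vector_derivative_scaleR pq Bg)
  have eq: "?E t = B (\<gamma> t) (p t) (q t)" if "\<gamma> t \<in> S" for t
    by (rule bilinear_expand[OF bil[OF that], symmetric])
  have D: "?D (p t0) (q t0) \<gamma>' = (\<Sum>b\<in>Basis. \<Sum>b'\<in>Basis. ((p t0 \<bullet> b) * (q t0 \<bullet> b')) *\<^sub>R ?D b b' \<gamma>')"
  proof -
    let ?F = "\<lambda>y. \<Sum>b\<in>Basis. \<Sum>b'\<in>Basis. ((p t0 \<bullet> b) * (q t0 \<bullet> b')) *\<^sub>R B y b b'"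
    have "(?F has_derivative (\<lambda>h. \<Sum>b\<in>Basis. \<Sum>b'\<in>Basis. ((p t0 \<bullet> b) * (q t0 \<bullet> b')) *\<^sub>R ?D b b' h)) (at (\<gamma> t0))"
      by (intro has_derivative_sum has_derivative_scaleR_right hd)
    then have "((\<lambda>y. B y (p t0) (q t0)) has_derivative (\<lambda>h. \<Sum>b\<in>Basis. \<Sum>b'\<in>Basis. ((p t0 \<bullet> b) * (q t0 \<bullet> b')) *\<^sub>R ?D b b' h)) (at (\<gamma> t0))"
      by (rule has_derivative_transform_within_open[OF _ S]) (rule bilinear_expand[OF bil, symmetric])
    from fun_cong[OF has_derivative_unique[OF this hd], of \<gamma>'] show ?thesis by (rule sym)
  qed
  have "?E' = dirD (\<lambda>y. B y (p t0) (q t0)) (\<gamma> t0) \<gamma>' + B (\<gamma> t0) p' (q t0) + B (\<gamma> t0) (p t0) q'"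
    unfolding D bilinear_expand[OF bil[OF S(2)], of p'] bilinear_expand[OF bil[OF S(2)], of "p t0" q']
    by (simp add: sum.distrib scaleR_add_left algebra_simps)
  moreover have "((\<lambda>t. B (\<gamma> t) (p t) (q t)) has_vector_derivative ?E') (at t0)"
    using E unfolding has_vector_derivative_def
  proof (rule has_derivative_transform_eventually)
    show "\<forall>\<^sub>F t in at t0 within UNIV. ?E t = B (\<gamma> t) (p t) (q t)"
      using ev by (auto simp: eventually_at_filter eq elim!: eventually_mono)
  qed (use eq S in auto)
  ultimately show ?thesis by (simp only:)
qed

lemma ex1_riesz:
  fixes B :: "'e::euclidean_space \<Rightarrow> 'e \<Rightarrow> real"
  assumes B: "bilinear B" and pos: "\<And>v. v \<noteq> 0 \<Longrightarrow> B v v > 0" and \<phi>: "linear \<phi>"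
  shows "\<exists>!a. \<forall>w. B a w = \<phi> w"
proof -
  define L where "L a = (\<Sum>b\<in>Basis. B a b *\<^sub>R b)" for a
  have [simp]: "B (x + y) z = B x z + B y z" "B (c *\<^sub>R x) z = c * B x z" for x y z c
    using bilinear_ladd[OF B] bilinear_lmul[OF B] by auto
  have lB: "linear (B a)" for a using B unfolding bilinear_def by blast
  have linL: "linear L" unfolding L_def
    by (rule linearI) (simp_all add: scaleR_add_left sum.distrib scaleR_sum_right)
  have L_inner: "L a \<bullet> b = B a b" if "b \<in> Basis" for a b
    using that unfolding L_def by (simp add: inner_sum_left inner_Basis if_distrib cong: if_cong)
  have ext: "B a = \<psi>" if "linear \<psi>" "\<And>b. b \<in> Basis \<Longrightarrow> B a b = \<psi> b" for a \<psi>
    using linear_eq_stdbasis[OF lB that(1)] that(2) by blast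
  have inj: "inj L"
  proof (subst linear_inj_iff_eq_0[OF linL], intro allI impI)
    fix a assume "L a = 0"
    then have "B a b = 0" if "b \<in> Basis" for b using L_inner[OF that, of a] by simp
    then have "B a = (\<lambda>_. 0)" by (intro ext) (auto simp: module_hom_zero)
    then show "a = 0" using pos[of a] by fastforce
  qed
  obtain a where "L a = (\<Sum>b\<in>Basis. \<phi> b *\<^sub>R b)"
    using linear_injective_imp_surjective[OF linL inj] by (metis surjD)
  then have "B a b = \<phi> b" if "b \<in> Basis" for b
    using L_inner[OF that, of a] that by (simp add: inner_sum_left inner_Basis if_distrib cong: if_cong)
  then have 1: "B a = \<phi>" using ext[OF \<phi>] by blast
  have "a' = a" if "\<forall>w. B a' w = \<phi> w" for a'
  proof -
    have "B (a' - a) (a' - a) = 0"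
      using that 1 bilinear_lsub[OF B] by simp
    then show ?thesis using pos[of "a' - a"] by force
  qed
  with 1 show ?thesis by metis
qed

text \<open>The representing vector of a functional depends differentiably on the form and the functional.
  With \<open>L y\<close> the operator of the form \<open>B y\<close>, with \<open>M\<close> the
  inverse of \<open>L x\<close> and \<open>k y\<close> the vector of the functional,
  \<open>A y - A x = M (k y - L y (A x)) - M ((L y - L x) (A y - A x))\<close>.
  The first term is differentiable and the second one is of second order.\<close>

lemma differentiable_riesz:
  fixes B :: "'e::euclidean_space \<Rightarrow> 'e \<Rightarrow> 'e \<Rightarrow> real"
  assumes S: "open S" "x \<in> S"
    and bil: "\<And>y. y \<in> S \<Longrightarrow> bilinear (B y)"
    and pos: "\<And>v. v \<noteq> 0 \<Longrightarrow> B x v v > 0"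
    and dB: "\<And>a b. (\<lambda>y. B y a b) differentiable (at x)"
    and d\<phi>: "\<And>b. (\<lambda>y. \<phi> y b) differentiable (at x)"
    and A: "\<And>y w. y \<in> S \<Longrightarrow> B y (A y) w = \<phi> y w"
  shows "A differentiable (at x)"
proof -
  define L where "L y a = (\<Sum>b\<in>Basis. B y a b *\<^sub>R b)" for y a
  have linL: "linear (L y)" if "y \<in> S" for y unfolding L_def
    by (rule linearI) (simp_all add: scaleR_add_left sum.distrib scaleR_sum_right
        bilinear_ladd[OF bil[OF that]] bilinear_lmul[OF bil[OF that]])
  have Bexp: "B y a a' = (\<Sum>b\<in>Basis. (a' \<bullet> b) * B y a b)" if "y \<in> S" for y a a'
  proof -
    have "linear (B y a)" using bil[OF that] unfolding bilinear_def by blast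
    then show ?thesis using Linear_Algebra.linear_componentwise[of "B y a" a' 1] by simp
  qed
  have inj: "inj (L x)"
  proof (subst linear_inj_iff_eq_0[OF linL[OF S(2)]], intro allI impI)
    fix a assume a: "L x a = 0"
    have "L x a \<bullet> b = B x a b" if "b \<in> Basis" for b
      using that unfolding L_def by (simp add: inner_sum_left inner_Basis if_distrib cong: if_cong)
    then have "B x a b = 0" if "b \<in> Basis" for b using that a by simp
    then have "B x a a = 0" using Bexp[OF S(2), of a a] by simp
    then show "a = 0" using pos[of a] by fastforce
  qed
  then obtain M where M: "linear M" "\<And>a. M (L x a) = a"
    using linear_injective_left_inverse[OF linL[OF S(2)]] by (metis comp_apply id_apply)
  have blM: "bounded_linear M" using M(1) linear_conv_bounded_linear by blast
  then obtain K where K: "K > 0" "\<And>v. norm (M v) \<le> norm v * K"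
    using bounded_linear.pos_bounded by blast
  define D where "D y = A x + M (\<Sum>b\<in>Basis. (\<phi> y b - B y (A x) b) *\<^sub>R b)" for y
  have d1: "((\<lambda>y. \<phi> y b) has_derivative frechet_derivative (\<lambda>y. \<phi> y b) (at x)) (at x)" for b
    using d\<phi> frechet_derivative_works by blast
  have d2: "((\<lambda>y. B y (A x) b) has_derivative frechet_derivative (\<lambda>y. B y (A x) b) (at x)) (at x)" for b
    using dB frechet_derivative_works by blast
  obtain D0 where D0: "((\<lambda>y. \<Sum>b\<in>Basis. (\<phi> y b - B y (A x) b) *\<^sub>R b) has_derivative D0) (at x)"
    by (rule that, rule has_derivative_sum, rule has_derivative_scaleR_left[OF has_derivative_diff[OF d1 d2]])
  define D' where "D' = (\<lambda>h. M (D0 h))"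
  have D': "(D has_derivative D') (at x)"
    unfolding D_def D'_def
    by (rule has_derivative_eq_rhs, rule has_derivative_add[OF has_derivative_const
        bounded_linear.has_derivative[OF blM D0]]) simp
  have Dx: "D x = A x" unfolding D_def using A[OF S(2)] linear_0[OF M(1)] by simp
  define e where "e y = (\<Sum>b\<in>Basis. \<Sum>b'\<in>Basis. \<bar>B y b' b - B x b' b\<bar>)" for y
  have e0: "e y \<ge> 0" for y unfolding e_def by (intro sum_nonneg) auto
  have "isCont (\<lambda>y. B y b b') x" for b b' using differentiable_imp_continuous_within[OF dB] by blast
  then have "isCont e x" unfolding e_def by (intro continuous_intros)
  then have e_lim: "(e \<longlongrightarrow> 0) (at x)" unfolding isCont_def by (simp add: e_def)
  have e_bd: "norm (L y a - L x a) \<le> e y * norm a" if "y \<in> S" for y a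
  proof -
    have lin: "linear (\<lambda>a. B z a b)" if "z \<in> S" for z b
      using bil[OF that] unfolding bilinear_def by blast
    have "norm (L y a - L x a) = norm (\<Sum>b\<in>Basis. (B y a b - B x a b) *\<^sub>R b)"
      unfolding L_def by (simp add: sum_subtractf algebra_simps)
    also have "\<dots> \<le> (\<Sum>b\<in>(Basis::'e set). \<bar>B y a b - B x a b\<bar>)"
      by (rule order_trans[OF norm_sum]) (auto intro: sum_mono)
    also have "\<dots> \<le> (\<Sum>b\<in>Basis. \<Sum>b'\<in>Basis. \<bar>B y b' b - B x b' b\<bar> * norm a)"
    proof (rule sum_mono)
      fix b :: 'e assume "b \<in> Basis"
      have "B z a b = (\<Sum>b'\<in>Basis. (a \<bullet> b') * B z b' b)" if "z \<in> S" for z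
        using Linear_Algebra.linear_componentwise[OF lin[OF that], where x = a and j = 1] by simp
      then have "\<bar>B y a b - B x a b\<bar> = \<bar>\<Sum>b'\<in>Basis. (a \<bullet> b') * (B y b' b - B x b' b)\<bar>"
        using that S(2) by (simp add: sum_subtractf algebra_simps)
      also have "\<dots> \<le> (\<Sum>b'\<in>Basis. \<bar>B y b' b - B x b' b\<bar> * norm a)"
        by (rule order_trans[OF sum_abs], rule sum_mono)
          (auto simp: abs_mult mult.commute intro!: mult_right_mono Basis_le_norm)
      finally show "\<bar>B y a b - B x a b\<bar> \<le> (\<Sum>b'\<in>Basis. \<bar>B y b' b - B x b' b\<bar> * norm a)" .
    qed
    also have "\<dots> = e y * norm a" unfolding e_def by (simp add: sum_distrib_right)
    finally show ?thesis .
  qed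
  define R where "R y = A y - D y" for y
  have R: "R y = - M (L y (A y - A x) - L x (A y - A x))" if "y \<in> S" for y
  proof -
    have "(\<Sum>b\<in>Basis. (\<phi> y b - B y (A x) b) *\<^sub>R b) = L y (A y) - L y (A x)"
      unfolding L_def using A[OF that] by (simp add: sum_subtractf algebra_simps)
    then have *: "D y = A x + M (L y (A y) - L y (A x))" unfolding D_def by simp
    show ?thesis unfolding R_def *
      using M(2)[of "A y"] M(2)[of "A x"]
      by (simp add: linear_diff[OF M(1)] linear_diff[OF linL[OF that]] linear_diff[OF linL[OF S(2)]])
  qed
  have R_bd: "norm (R y) \<le> e y * norm (A y - A x) * K" if "y \<in> S" for y
  proof -
    have "norm (R y) \<le> norm (L y (A y - A x) - L x (A y - A x)) * K"
      unfolding R[OF that] using K(2) by simp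
    also have "\<dots> \<le> e y * norm (A y - A x) * K"
      using e_bd[OF that] K(1) by (intro mult_right_mono) auto
    finally show ?thesis .
  qed
  have evS: "eventually (\<lambda>y. y \<in> S) (at x)" using S by (simp add: eventually_at_in_open')
  have "eventually (\<lambda>y. e y < 1 / (2 * K)) (at x)"
    using e_lim K(1) by (intro order_tendstoD(2)) auto
  \<comment> \<open>Where \<open>e y \<cdot> K \<le> 1/2\<close>, the remainder is absorbed into the left-hand side.\<close>
  then have ev: "eventually (\<lambda>y. norm (R y) \<le> 2 * K * e y * norm (D y - D x)) (at x)"
    using evS
  proof eventually_elim
    case (elim y)
    have "A y - A x = (D y - D x) + R y" unfolding R_def Dx by simp
    then have "norm (A y - A x) \<le> norm (D y - D x) + norm (R y)" by (metis norm_triangle_ineq)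
    moreover have "e y * norm (A y - A x) * K \<le> norm (A y - A x) / 2"
    proof -
      have "e y * K \<le> 1/2" using elim(1) K(1) by (simp add: field_simps)
      from mult_right_mono[OF this norm_ge_zero[of "A y - A x"]] show ?thesis by (simp add: mult_ac)
    qed
    ultimately have "norm (A y - A x) \<le> 2 * norm (D y - D x)" using R_bd[OF elim(2)] by linarith
    then have "e y * norm (A y - A x) * K \<le> e y * (2 * norm (D y - D x)) * K"
      using e0 K(1) by (intro mult_right_mono mult_left_mono) auto
    then show ?case using R_bd[OF elim(2)] by (simp add: mult_ac)
  qed
  obtain N where N: "\<And>h. norm (D' h) \<le> norm h * N"
    using D' bounded_linear.pos_bounded has_derivative_bounded_linear by blast
  let ?q = "\<lambda>y. norm (D y - D x - D' (y - x)) / norm (y - x)"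
  have q: "(?q \<longlongrightarrow> 0) (at x)" using D' unfolding has_derivative_iff_norm by blast
  have "(R has_derivative (\<lambda>_. 0)) (at x)"
    unfolding has_derivative_iff_norm
  proof (intro conjI bounded_linear_zero)
    have "((\<lambda>y. 2 * K * e y * (?q y + N)) \<longlongrightarrow> 2 * K * 0 * (0 + N)) (at x)"
      by (intro tendsto_intros e_lim q)
    then have lim: "((\<lambda>y. 2 * K * e y * (?q y + N)) \<longlongrightarrow> 0) (at x)" by simp
    have Rx: "R x = 0" unfolding R_def Dx by simp
    show "((\<lambda>y. norm (R y - R x - 0) / norm (y - x)) \<longlongrightarrow> 0) (at x)"
    proof (rule Lim_null_comparison[OF _ lim])
      show "\<forall>\<^sub>F y in at x. norm (norm (R y - R x - 0) / norm (y - x)) \<le> 2 * K * e y * (?q y + N)"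
        using ev eventually_neq_at_within[of x x UNIV]
      proof eventually_elim
        case (elim y)
        then have ne: "norm (y - x) > 0" by simp
        have "norm (D y - D x) \<le> norm (D y - D x - D' (y - x)) + norm (D' (y - x))"
          by (metis diff_add_cancel norm_triangle_ineq)
        also have "\<dots> \<le> norm (D y - D x - D' (y - x)) + norm (y - x) * N" using N by simp
        finally have "norm (D y - D x) / norm (y - x) \<le> ?q y + N" using ne by (simp add: field_simps)
        then have "2 * K * e y * (norm (D y - D x) / norm (y - x)) \<le> 2 * K * e y * (?q y + N)"
          using K(1) e0[of y] by (intro mult_left_mono) auto
        moreover have "norm (R y) / norm (y - x) \<le> 2 * K * e y * norm (D y - D x) / norm (y - x)"
          using elim(1) ne by (intro divide_right_mono) auto
        ultimately show ?case by (simp add: Rx)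
      qed
    qed
  qed
  from has_derivative_add[OF D' this] have "((\<lambda>y. D y + R y) has_derivative (\<lambda>h. D' h + 0)) (at x)" .
  then show ?thesis unfolding R_def differentiable_def by auto
qed

lemma bilinear_dirD:
  fixes B :: "'e::euclidean_space \<Rightarrow> 'e \<Rightarrow> 'e \<Rightarrow> 'f::euclidean_space"
  assumes S: "open S" "x \<in> S"
    and bil: "\<And>y. y \<in> S \<Longrightarrow> bilinear (B y)"
    and diff: "\<And>a b. (\<lambda>y. B y a b) differentiable at x"
  shows "bilinear (\<lambda>v w. dirD (\<lambda>y. B y v w) x u)"
proof -
  let ?D = "\<lambda>a b. frechet_derivative (\<lambda>y. B y a b) (at x)"
  have hd: "((\<lambda>y. B y a b) has_derivative ?D a b) (at x)" for a b
    using diff frechet_derivative_works by blast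
  have eqI: "?D v w = D'"
    if "(f has_derivative D') (at x)" "\<And>y. y \<in> S \<Longrightarrow> f y = B y v w" for f v w D'
  proof -
    have "((\<lambda>y. B y v w) has_derivative D') (at x)"
      using has_derivative_transform_within_open[OF that(1) S that(2)] .
    from has_derivative_unique[OF hd this] show ?thesis .
  qed
  have "?D (v + v') w = (\<lambda>h. ?D v w h + ?D v' w h)" for v v' w
    by (rule eqI[OF has_derivative_add[OF hd hd]]) (simp add: bilinear_ladd[OF bil])
  moreover have "?D v (w + w') = (\<lambda>h. ?D v w h + ?D v w' h)" for v w w'
    by (rule eqI[OF has_derivative_add[OF hd hd]]) (simp add: bilinear_radd[OF bil])
  moreover have "?D (c *\<^sub>R v) w = (\<lambda>h. c *\<^sub>R ?D v w h)" for v w c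
    by (rule eqI[OF has_derivative_scaleR_right[OF hd]]) (simp add: bilinear_lmul[OF bil])
  moreover have "?D v (c *\<^sub>R w) = (\<lambda>h. c *\<^sub>R ?D v w h)" for v w c
    by (rule eqI[OF has_derivative_scaleR_right[OF hd]]) (simp add: bilinear_rmul[OF bil])
  ultimately show ?thesis
    unfolding bilinear_def by (auto intro!: linearI)
qed

lemma J_simps [simp]:
  fixes v w :: "complex ^ 'n"
  shows "J (v + w) = J v + J w" "J (v - w) = J v - J w" "J (- v) = - J v" "J (r *\<^sub>R v) = r *\<^sub>R J v"
    "J (J v) = - v"
  by (auto simp: vec_eq_iff algebra_simps)

lemma scalar_mult_Re_Im: "(\<theta>::complex) *s (v::complex ^ 'n) = Re \<theta> *\<^sub>R v + Im \<theta> *\<^sub>R J v"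
  by (auto simp: vec_eq_iff complex_eq_iff)

text \<open>The data of a Kaehler form in one chart with image \<open>S\<close>.\<close>

locale kaehler_domain =
  fixes S :: "(complex ^ 'n::finite) set"
    and \<omega> :: "complex ^ 'n \<Rightarrow> complex ^ 'n \<Rightarrow> complex ^ 'n \<Rightarrow> real"
  assumes open_S: "open S"
    and bil\<omega>: "x \<in> S \<Longrightarrow> bilinear (\<omega> x)"
    and alt\<omega>: "x \<in> S \<Longrightarrow> \<omega> x v v = 0"
    and smooth\<omega>: "smooth_on S (\<lambda>x. \<omega> x v w)"
    and closed\<omega>: "x \<in> S \<Longrightarrow> dirD (\<lambda>y. \<omega> y v w) x u + dirD (\<lambda>y. \<omega> y w u) x v + dirD (\<lambda>y. \<omega> y u v) x w = 0"
    and Jinv: "x \<in> S \<Longrightarrow> \<omega> x (J v) (J w) = \<omega> x v w"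
    and pos: "x \<in> S \<Longrightarrow> v \<noteq> 0 \<Longrightarrow> \<omega> x v (J v) > 0"
begin

definition g :: "complex ^ 'n \<Rightarrow> complex ^ 'n \<Rightarrow> complex ^ 'n \<Rightarrow> real" where
  "g x v w = \<omega> x v (J w)"

definition d :: "complex ^ 'n \<Rightarrow> complex ^ 'n \<Rightarrow> complex ^ 'n \<Rightarrow> complex ^ 'n \<Rightarrow> real" where
  "d x u v w = dirD (\<lambda>y. g y v w) x u"

abbreviation \<Gamma> where "\<Gamma> \<equiv> christoffel g"

lemma bil_g: "x \<in> S \<Longrightarrow> bilinear (g x)"
  unfolding g_def bilinear_def
  by (auto intro!: linearI simp: bilinear_ladd[OF bil\<omega>] bilinear_lmul[OF bil\<omega>]
      bilinear_radd[OF bil\<omega>] bilinear_rmul[OF bil\<omega>])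

lemma \<omega>_anti: "x \<in> S \<Longrightarrow> \<omega> x v w = - \<omega> x w v"
  using alt\<omega>[of x "v + w"] alt\<omega>[of x v] alt\<omega>[of x w]
  by (simp add: bilinear_ladd[OF bil\<omega>] bilinear_radd[OF bil\<omega>])

lemma g_sym: "x \<in> S \<Longrightarrow> g x v w = g x w v"
  using Jinv[of x v "J w"] \<omega>_anti[of x w "J v"] unfolding g_def
  by (simp add: bilinear_rneg[OF bil\<omega>])

lemma g_J: "x \<in> S \<Longrightarrow> g x (J v) (J w) = g x v w"
  unfolding g_def by (rule Jinv)

lemma g_J1: "x \<in> S \<Longrightarrow> g x (J v) w = - g x v (J w)"
  using g_J[of x v "J w"] by (simp add: bilinear_rneg[OF bil_g])

lemma g_pos: "x \<in> S \<Longrightarrow> v \<noteq> 0 \<Longrightarrow> g x v v > 0"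
  unfolding g_def by (rule pos)

lemma g_nonneg: "x \<in> S \<Longrightarrow> g x v v \<ge> 0"
  using g_pos[of x v] by (cases "v = 0") (simp_all add: bilinear_lzero[OF bil_g] less_imp_le)

lemma g_eqI: "a = b" if "x \<in> S" "\<And>w. g x a w = g x b w"
proof -
  have "g x (a - b) (a - b) = 0"
    using that(2) bilinear_lsub[OF bil_g[OF that(1)], of a b "a - b"] by simp
  then show ?thesis using g_pos[OF that(1), of "a - b"] by (cases "a - b = 0") simp_all
qed

lemma diff_\<omega>: "x \<in> S \<Longrightarrow> (\<lambda>y. \<omega> y v w) differentiable (at x)"
  using smooth\<omega>[of v w, unfolded smooth_on_def, rule_format, of 1] by simp

lemma diff_dirD_\<omega>: "x \<in> S \<Longrightarrow> (\<lambda>y. dirD (\<lambda>z. \<omega> z v w) y u) differentiable (at x)"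
  using smooth\<omega>[of v w, unfolded smooth_on_def, rule_format, of "Suc (Suc 0)"] by simp

lemma diff_g: "x \<in> S \<Longrightarrow> (\<lambda>y. g y v w) differentiable (at x)"
  unfolding g_def by (rule diff_\<omega>)

lemma diff_d: "x \<in> S \<Longrightarrow> (\<lambda>y. d y u v w) differentiable (at x)"
  unfolding d_def g_def by (rule diff_dirD_\<omega>)

lemma bil_d: "x \<in> S \<Longrightarrow> bilinear (d x u)"
  unfolding d_def by (rule bilinear_dirD[OF open_S _ bil_g]) (auto intro: diff_g)

lemma lin_d: "x \<in> S \<Longrightarrow> linear (\<lambda>u. d x u v w)"
  unfolding d_def by (rule linear_frechet_derivative[OF diff_g])

lemma dirD_cong: "x \<in> S \<Longrightarrow> (\<And>y. y \<in> S \<Longrightarrow> f y = h y) \<Longrightarrow> f differentiable (at x) \<Longrightarrow> dirD f x u = dirD h x u"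
  using frechet_derivative_transform_within_open[OF _ open_S] by metis

lemma d_sym: "x \<in> S \<Longrightarrow> d x u v w = d x u w v"
  unfolding d_def by (rule dirD_cong[OF _ g_sym diff_g])

text \<open>The Koszul formula has a unique solution because the metric is positive definite, so the definite
  description in the definition of the connection denotes it.\<close>

lemma koszul: 
  assumes x: "x \<in> S"
  shows "2 * g x (\<Gamma> x u v) w = d x u v w + d x v u w - d x w u v"
proof -
  have "linear (\<lambda>w. d x u v w + d x v u w - d x w u v)"
    using bil_d[OF x] lin_d[OF x] unfolding bilinear_def
    by (intro linear_compose_add linear_compose_sub) auto
  moreover have "bilinear (\<lambda>a w. 2 * g x a w)"
    unfolding bilinear_def
    by (auto intro!: linearI simp: bilinear_ladd[OF bil_g[OF x]] bilinear_lmul[OF bil_g[OF x]]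
        bilinear_radd[OF bil_g[OF x]] bilinear_rmul[OF bil_g[OF x]] algebra_simps)
  ultimately have "\<exists>!a. \<forall>w. 2 * g x a w = d x u v w + d x v u w - d x w u v"
    using g_pos[OF x] by (intro ex1_riesz) auto
  from theI'[OF this] show ?thesis unfolding christoffel_def d_def by blast
qed

lemma \<Gamma>_eqI: "x \<in> S \<Longrightarrow> (\<And>w. 2 * g x a w = d x u v w + d x v u w - d x w u v) \<Longrightarrow> \<Gamma> x u v = a"
  by (rule g_eqI[of x], assumption) (metis koszul mult_cancel_left zero_neq_numeral)

lemma \<Gamma>_sym: "x \<in> S \<Longrightarrow> \<Gamma> x u v = \<Gamma> x v u"
  by (rule \<Gamma>_eqI) (auto simp: koszul d_sym[of x _ u v])

lemma bil_\<Gamma>: assumes x: "x \<in> S" shows "bilinear (\<Gamma> x)"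
proof -
  note [simp] = bilinear_ladd[OF bil_g[OF x]] bilinear_lmul[OF bil_g[OF x]]
    bilinear_ladd[OF bil_d[OF x]] bilinear_lmul[OF bil_d[OF x]] linear_add[OF lin_d[OF x]] linear_cmul[OF lin_d[OF x]]
    bilinear_radd[OF bil_d[OF x]] bilinear_rmul[OF bil_d[OF x]]
  have kz: "g x (\<Gamma> x u v) w = (d x u v w + d x v u w - d x w u v) / 2" for u v w
    using koszul[OF x, of u v w] by simp
  have "\<Gamma> x u (v + v') = \<Gamma> x u v + \<Gamma> x u v'" for u v v'
    by (rule \<Gamma>_eqI[OF x]) (simp add: kz field_simps)
  moreover have "\<Gamma> x u (c *\<^sub>R v) = c *\<^sub>R \<Gamma> x u v" for u v c
    by (rule \<Gamma>_eqI[OF x]) (simp add: kz field_simps)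
  ultimately show ?thesis
    unfolding bilinear_def using \<Gamma>_sym[OF x] by (auto intro!: linearI)
qed

lemma diff_\<Gamma>: assumes x: "x \<in> S" shows "(\<lambda>y. \<Gamma> y u v) differentiable (at x)"
proof (rule differentiable_riesz[OF open_S x])
  show "bilinear (\<lambda>a w. 2 * g y a w)" if "y \<in> S" for y
    unfolding bilinear_def
    by (auto intro!: linearI simp: bilinear_ladd[OF bil_g[OF that]] bilinear_lmul[OF bil_g[OF that]]
        bilinear_radd[OF bil_g[OF that]] bilinear_rmul[OF bil_g[OF that]] algebra_simps)
  show "2 * g y (\<Gamma> y u v) w = d y u v w + d y v u w - d y w u v" if "y \<in> S" for y w
    by (rule koszul[OF that])
  show "(\<lambda>y. d y u v w + d y v u w - d y w u v) differentiable (at x)" for w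
    by (intro differentiable_add differentiable_diff diff_d x)
qed (use g_pos[OF x] diff_g[OF x] in \<open>auto intro: differentiable_mult\<close>)

text \<open>The complex structure is parallel: by the Koszul formula, twice the difference of the two sides
  has inner product \<open>d\<omega> u v w - d\<omega> u (J v) (J w)\<close> with
  \<open>w\<close>, and the form is closed.\<close>

lemma \<Gamma>_J: assumes x: "x \<in> S" shows "\<Gamma> x u (J v) = J (\<Gamma> x u v)"
proof (rule \<Gamma>_eqI[OF x])
  fix w
  let ?e = "\<lambda>u v w. dirD (\<lambda>y. \<omega> y v w) x u"
  have neg: "dirD (\<lambda>y. \<omega> y v w) x u = - dirD (\<lambda>y. \<omega> y w v) x u" for u v w
  proof -
    have "dirD (\<lambda>y. \<omega> y v w) x u = dirD (\<lambda>y. - \<omega> y w v) x u"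
      by (rule dirD_cong[OF x \<omega>_anti diff_\<omega>[OF x]])
    also have "\<dots> = - dirD (\<lambda>y. \<omega> y w v) x u"
      using fun_cong[OF frechet_derivative_at[OF has_derivative_minus[OF diff_\<omega>[OF x, of w v,
        unfolded frechet_derivative_works]]], of u] by simp
    finally show ?thesis .
  qed
  have Je: "?e u (J v) (J w) = ?e u v w" for u v w
    by (rule dirD_cong[OF x Jinv diff_\<omega>[OF x]])
  have eJ: "?e u v (- w) = - ?e u v w" for u v w
    using bilinear_rneg[OF bilinear_dirD[OF open_S x bil\<omega> diff_\<omega>[OF x]]] .
  have de: "d x u v w = ?e u v (J w)" for u v w unfolding d_def g_def ..
  have "2 * g x (J (\<Gamma> x u v)) w = - (2 * g x (\<Gamma> x u v) (J w))" using g_J1[OF x] by simp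
  also have "\<dots> = - d x u v (J w) - d x v u (J w) + d x (J w) u v" using koszul[OF x, of u v "J w"] by simp
  also have "\<dots> = d x u (J v) w + d x (J v) u w - d x w u (J v)"
  proof -
    have 1: "?e u (J v) (J w) + ?e (J v) (J w) u + ?e (J w) u (J v) = 0" by (rule closed\<omega>[OF x])
    have 2: "?e u v w + ?e v w u + ?e w u v = 0" by (rule closed\<omega>[OF x])
    show ?thesis
      using 1 2 Je[where u = u and v = v and w = w] neg[where u = "J v" and v = "J w" and w = u]
        neg[where u = v and v = w and w = u] unfolding de J_simps eJ by linarith
  qed
  finally show "2 * g x (J (\<Gamma> x u v)) w = d x u (J v) w + d x (J v) u w - d x w u (J v)" .
qed

text \<open>The Koszul formula for \<open>(u, v, w)\<close> and for \<open>(u, w, v)\<close> add up to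
  this identity, since the terms that differentiate along \<open>v\<close> and \<open>w\<close>
  cancel.\<close>

lemma metric_compatible:
  assumes x: "x \<in> S"
  shows "d x u v w = g x (\<Gamma> x u v) w + g x v (\<Gamma> x u w)"
proof -
  have "2 * g x v (\<Gamma> x u w) = d x u w v + d x w u v - d x v u w"
    using koszul[OF x, of u w v] g_sym[OF x, of v "\<Gamma> x u w"] by simp
  then show ?thesis using koszul[OF x, of u v w] d_sym[OF x, of u v w] by linarith
qed

end

lemma second_derivative_test:
  fixes f :: "real \<Rightarrow> real"
  assumes e: "e > 0"
    and f: "\<And>t. \<bar>t\<bar> < e \<Longrightarrow> (f has_real_derivative f' t) (at t)"
    and f': "(f' has_real_derivative l) (at 0)"
    and max: "\<And>t. \<bar>t\<bar> < e \<Longrightarrow> f t \<le> f 0"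
  shows "f' 0 = 0" "l \<le> 0"
proof -
  show 0: "f' 0 = 0"
    by (rule DERIV_local_max[OF f e]) (use e max in auto)
  show "l \<le> 0"
  proof (rule ccontr)
    assume "\<not> l \<le> 0"
    then obtain d where d: "d > 0" "\<And>h. 0 < h \<Longrightarrow> h < d \<Longrightarrow> f' 0 < f' (0 + h)"
      using DERIV_pos_inc_right[OF f'] by auto
    define t where "t = min d e / 2"
    have t: "0 < t" "t < d" "t < e" using d(1) e by (auto simp: t_def)
    have der: "(f has_real_derivative f' x) (at x)" if "0 \<le> x" "x \<le> t" for x
      by (rule f) (use that t(3) in linarith)
    have pos: "f' x > 0" if "0 < x" "x < t" for x
      using d(2)[of x] that t(2) unfolding 0 by simp
    have "f 0 < f t"
    proof (rule DERIV_pos_imp_increasing_open[OF t(1)])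
      show "\<exists>y. (f has_real_derivative y) (at x) \<and> y > 0" if "0 < x" "x < t" for x
        using der[of x] pos[of x] that by fastforce
      show "continuous_on {0..t} f"
        by (rule continuous_at_imp_continuous_on) (meson DERIV_isCont atLeastAtMost_iff der)
    qed
    then show False using max[of t] t(1,3) by linarith
  qed
qed

lemma has_vector_derivative_along_line:
  assumes "(f has_derivative (\<lambda>h. h *s f')) (at z)"
  shows "((\<lambda>t. f (z + of_real t * \<theta>)) has_vector_derivative \<theta> *s f') (at 0)"
proof -
  have "((\<lambda>t. z + of_real t * \<theta>) has_vector_derivative \<theta>) (at 0)"
    unfolding has_vector_derivative_def scaleR_conv_of_real[symmetric]
    by (auto intro!: derivative_eq_intros)
  moreover have "(f has_derivative (\<lambda>h. h *s f')) (at (z + of_real 0 * \<theta>) within range (\<lambda>t. z + of_real t * \<theta>))"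
    using assms by (auto intro: has_derivative_at_withinI)
  ultimately show ?thesis
    using vector_derivative_diff_chain_within[of "\<lambda>t. z + of_real t * \<theta>" \<theta> 0 UNIV f "\<lambda>h. h *s f'"]
    by (simp add: o_def)
qed

context kaehler_domain
begin

lemma g_theta: "x \<in> S \<Longrightarrow> g x (\<theta> *s v) (\<theta> *s w) = (cmod \<theta>)\<^sup>2 * g x v w"
  unfolding scalar_mult_Re_Im[of \<theta>]
  using g_J1[of x v w] cmod_power2[of \<theta>]
  by (simp add: bilinear_ladd[OF bil_g] bilinear_radd[OF bil_g] bilinear_lmul[OF bil_g]
      bilinear_rmul[OF bil_g] g_J algebra_simps power2_eq_square)

lemma \<Gamma>_theta: "x \<in> S \<Longrightarrow> \<Gamma> x u (\<theta> *s v) = \<theta> *s \<Gamma> x u v"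
  unfolding scalar_mult_Re_Im[of \<theta>] by (simp add: bilinear_radd[OF bil_\<Gamma>] bilinear_rmul[OF bil_\<Gamma>] \<Gamma>_J)

lemma \<Gamma>_theta': "x \<in> S \<Longrightarrow> \<Gamma> x (\<theta> *s u) v = \<theta> *s \<Gamma> x u v"
  using \<Gamma>_theta[of x v \<theta> u] \<Gamma>_sym[of x] by metis

text \<open>The quadratic Christoffel terms cancel since \<open>\<Gamma>\<close> is complex bilinear, and only
  first derivatives of \<open>\<Gamma>\<close> remain in the holomorphic sectional curvature.\<close>

lemma curvature_J:
  assumes x: "x \<in> S"
  shows "riemann_curvature g x v (J v) (J v) =
     - (dirD (\<lambda>y. \<Gamma> y v v) x v + J (dirD (\<lambda>y. \<Gamma> y v v) x (J v)))"
proof -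
  have hd: "((\<lambda>y. \<Gamma> y v v) has_derivative frechet_derivative (\<lambda>y. \<Gamma> y v v) (at x)) (at x)"
    using diff_\<Gamma>[OF x] frechet_derivative_works by blast
  have "bounded_linear (\<lambda>v::complex^'n. J v)"
    by (intro linear_conv_bounded_linear[THEN iffD1] linearI) auto
  then have "((\<lambda>y. J (\<Gamma> y v v)) has_derivative (\<lambda>h. J (dirD (\<lambda>y. \<Gamma> y v v) x h))) (at x)"
    using bounded_linear.has_derivative[OF _ hd] by blast
  then have "((\<lambda>y. \<Gamma> y v (J v)) has_derivative (\<lambda>h. J (dirD (\<lambda>y. \<Gamma> y v v) x h))) (at x)"
    by (rule has_derivative_transform_within_open[OF _ open_S x]) (simp add: \<Gamma>_J)
  note 1 = frechet_derivative_at[OF this, symmetric]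
  have "((\<lambda>y. \<Gamma> y (J v) (J v)) has_derivative (\<lambda>h. - dirD (\<lambda>y. \<Gamma> y v v) x h)) (at x)"
    using has_derivative_minus[OF hd]
    by (rule has_derivative_transform_within_open[OF _ open_S x]) (simp add: \<Gamma>_J \<Gamma>_theta')
  note 2 = frechet_derivative_at[OF this, symmetric]
  show ?thesis unfolding riemann_curvature_def 1 2 using x
    by (simp add: \<Gamma>_J \<Gamma>_theta' bilinear_rneg[OF bil_\<Gamma>])
qed

lemma curvature_nonpos:
  assumes x: "x \<in> S" and v: "v \<noteq> 0" and hsc: "sectional_curvature g x v (J v) \<le> 0"
  shows "g x (dirD (\<lambda>y. \<Gamma> y v v) x v + J (dirD (\<lambda>y. \<Gamma> y v v) x (J v))) v \<ge> 0"
proof -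
  have "g x v (J v) = 0" using g_J1[OF x, of v v] g_sym[OF x, of v "J v"] by simp
  then have "g x v v * g x (J v) (J v) - (g x v (J v))\<^sup>2 > 0"
    using g_pos[OF x v] by (simp add: g_J[OF x])
  then have "g x (riemann_curvature g x v (J v) (J v)) v \<le> 0"
    using hsc unfolding sectional_curvature_def by (simp add: divide_le_0_iff)
  then show ?thesis unfolding curvature_J[OF x] bilinear_lneg[OF bil_g[OF x]] by simp
qed

text \<open>The vectors \<open>v\<close> and \<open>J v\<close> are orthogonal of equal length, so this is
  Bessel's inequality for the projection of \<open>a\<close> to the complex line of
  \<open>v\<close>.\<close>

lemma cauchy_schwarz_J:
  assumes x: "x \<in> S"
  shows "(g x a v)\<^sup>2 + (g x (J a) v)\<^sup>2 \<le> g x a a * g x v v"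
proof (cases "v = 0")
  case True
  then show ?thesis by (simp add: bilinear_rzero[OF bil_g[OF x]])
next
  case False
  define E where "E = g x v v"
  have E: "E > 0" using g_pos[OF x False] by (simp add: E_def)
  define p q where "p = g x a v" and "q = g x (J a) v"
  have vJ: "g x v (J v) = 0" "g x (J v) v = 0" using g_J1[OF x, of v v] g_sym[OF x, of v "J v"] by simp_all
  have aJ: "g x a (J v) = - q" "g x (J v) a = - q" "g x v a = p"
    using g_J1[OF x, of a v] g_sym[OF x] by (simp_all add: q_def p_def)
  define b where "b = E *\<^sub>R a - p *\<^sub>R v + q *\<^sub>R J v"
  have "g x b b = E * (E * g x a a - (p\<^sup>2 + q\<^sup>2))"
    unfolding b_def using vJ aJ
    by (simp add: bilinear_ladd[OF bil_g[OF x]] bilinear_radd[OF bil_g[OF x]] bilinear_lmul[OF bil_g[OF x]]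
      bilinear_rmul[OF bil_g[OF x]] bilinear_lsub[OF bil_g[OF x]] bilinear_rsub[OF bil_g[OF x]] g_J[OF x]
      E_def[symmetric] p_def[symmetric] power2_eq_square algebra_simps)
  then have "E * (E * g x a a - (p\<^sup>2 + q\<^sup>2)) \<ge> 0" using g_nonneg[OF x, of b] by simp
  then show ?thesis using E unfolding E_def[symmetric] p_def[symmetric] q_def[symmetric]
    by (simp add: zero_le_mult_iff mult.commute)
qed

text \<open>The covariant product rule along a curve: \<open>p' + \<Gamma> \<gamma>' p\<close> is the
  covariant derivative of the field \<open>p\<close>.\<close>

lemma metric_derivative_along:
  assumes O: "\<gamma> t0 \<in> S"
    and \<gamma>: "(\<gamma> has_vector_derivative \<gamma>') (at t0)"
    and p: "(p has_vector_derivative p') (at t0)"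
    and q: "(q has_vector_derivative q') (at t0)"
  shows "((\<lambda>t. g (\<gamma> t) (p t) (q t)) has_real_derivative
     g (\<gamma> t0) (p' + \<Gamma> (\<gamma> t0) \<gamma>' (p t0)) (q t0) + g (\<gamma> t0) (p t0) (q' + \<Gamma> (\<gamma> t0) \<gamma>' (q t0))) (at t0)"
proof -
  have "((\<lambda>t. g (\<gamma> t) (p t) (q t)) has_vector_derivative
     d (\<gamma> t0) \<gamma>' (p t0) (q t0) + g (\<gamma> t0) p' (q t0) + g (\<gamma> t0) (p t0) q') (at t0)"
    unfolding d_def
    by (rule has_vector_derivative_bilinear_field[OF open_S O bil_g diff_g \<gamma> p q]) (use O in auto)
  then show ?thesis
    unfolding metric_compatible[OF O] has_real_derivative_iff_has_vector_derivative
    by (simp add: bilinear_ladd[OF bil_g[OF O]] bilinear_radd[OF bil_g[OF O]] algebra_simps)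
qed

text \<open>Here \<open>s\<close> is a holomorphic curve with velocity \<open>v\<close>, and
  \<open>a = v' + \<Gamma> v v\<close> is its covariant acceleration. For
  \<open>E = g v v\<close> and a unit number \<open>\<theta>\<close>, the derivative of
  \<open>E\<close> in the direction \<open>\<theta>\<close> is
  \<open>2 g (\<theta> a) v\<close>. In the sum of the second derivatives in the directions
  \<open>1\<close> and \<open>\<i>\<close> the terms with \<open>v''\<close> and
  \<open>\<Gamma> v a\<close> cancel, because \<open>1 + \<i>\<^sup>2 = 0\<close>; there
  remain \<open>4 g a a\<close> and minus twice the unnormalized holomorphic sectional
  curvature. Together with \<open>cauchy_schwarz_J\<close> this gives
  \<open>E \<cdot> \<Delta>E \<ge> |\<nabla>E|\<^sup>2\<close>. At a local maximum of
  \<open>E \<cdot> (1 + |z|\<^sup>2)\<close> the gradient of \<open>E\<close> is known, and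
  the second derivative test leaves \<open>4 E / (1 + |z|\<^sup>2) \<le> 0\<close>.\<close>

lemma no_local_maximum:
  fixes s v v' :: "complex \<Rightarrow> complex ^ 'n"
  assumes U: "open U" "z0 \<in> U" and sS: "\<And>z. z \<in> U \<Longrightarrow> s z \<in> S"
    and s: "\<And>z. z \<in> U \<Longrightarrow> (s has_derivative (\<lambda>h. h *s v z)) (at z)"
    and v: "\<And>z. z \<in> U \<Longrightarrow> (v has_derivative (\<lambda>h. h *s v' z)) (at z)"
    and v': "(v' has_derivative (\<lambda>h. h *s v'')) (at z0)"
    and v0: "v z0 \<noteq> 0" and hsc: "sectional_curvature g (s z0) (v z0) (J (v z0)) \<le> 0"
    and max: "\<And>z. z \<in> U \<Longrightarrow> g (s z) (v z) (v z) * (1 + (cmod z)\<^sup>2) \<le> g (s z0) (v z0) (v z0) * (1 + (cmod z0)\<^sup>2)"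
  shows False
proof -
  define E where "E z = g (s z) (v z) (v z)" for z
  define a where "a z = v' z + \<Gamma> (s z) (v z) (v z)" for z
  define G where "G = (\<lambda>u. dirD (\<lambda>y. \<Gamma> y (v z0) (v z0)) (s z0) u)"
  define x where "x = s z0"
  define V where "V = v z0"
  have x: "x \<in> S" using sS U by (simp add: x_def)
  have dE: "((\<lambda>t. E (z + of_real t * \<theta>)) has_real_derivative 2 * g (s z) (\<theta> *s a z) (v z)) (at 0)"
    if z: "z \<in> U" for z \<theta>
  proof -
    have gs: "g (s z) (v z) (\<theta> *s a z) = g (s z) (\<theta> *s a z) (v z)" by (rule g_sym[OF sS[OF z]])
    have eq: "\<theta> *s v' z + \<Gamma> (s z) (\<theta> *s v z) (v z) = \<theta> *s a z"
      unfolding a_def \<Gamma>_theta'[OF sS[OF z]] by (simp add: vector_add_ldistrib)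
    show ?thesis
      using metric_derivative_along[of "\<lambda>t. s (z + of_real t * \<theta>)" 0 "\<theta> *s v z"
        "\<lambda>t. v (z + of_real t * \<theta>)" "\<theta> *s v' z" "\<lambda>t. v (z + of_real t * \<theta>)" "\<theta> *s v' z"]
        has_vector_derivative_along_line[OF s[OF z], of \<theta>] has_vector_derivative_along_line[OF v[OF z], of \<theta>] sS[OF z]
      by (simp add: eq gs E_def)
  qed
  \<comment> \<open>Half of the second derivative of \<open>E\<close> in the direction \<open>\<theta>\<close>.\<close>
  define T where "T \<theta> = g x (\<theta> *s (\<theta> *s v'' + G (\<theta> *s V) + (2 * \<theta>) *s \<Gamma> x (v' z0) V)
      + (\<theta> * \<theta>) *s \<Gamma> x V (a z0)) V + g x (a z0) (a z0)" for \<theta>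
  have ddE: "((\<lambda>t. g (s (z0 + of_real t * \<theta>)) (\<theta> *s a (z0 + of_real t * \<theta>)) (v (z0 + of_real t * \<theta>)))
      has_real_derivative T \<theta>) (at 0)" if \<theta>: "cmod \<theta> = 1" for \<theta>
  proof -
    have s1: "((\<lambda>t. s (z0 + of_real t * \<theta>)) has_vector_derivative \<theta> *s V) (at 0)"
      and v1: "((\<lambda>t. v (z0 + of_real t * \<theta>)) has_vector_derivative \<theta> *s v' z0) (at 0)"
      and w1: "((\<lambda>t. v' (z0 + of_real t * \<theta>)) has_vector_derivative \<theta> *s v'') (at 0)"
      unfolding V_def using has_vector_derivative_along_line s v v' U(2) by blast+
    have "((\<lambda>t. \<Gamma> (s (z0 + of_real t * \<theta>)) (v (z0 + of_real t * \<theta>)) (v (z0 + of_real t * \<theta>)))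
       has_vector_derivative G (\<theta> *s V) + \<Gamma> x (\<theta> *s v' z0) V + \<Gamma> x V (\<theta> *s v' z0)) (at 0)"
      using has_vector_derivative_bilinear_field[OF open_S _ bil_\<Gamma> diff_\<Gamma> s1 v1 v1] x
      by (simp add: x_def V_def G_def)
    from has_vector_derivative_add[OF w1 this]
    have a1: "((\<lambda>t. a (z0 + of_real t * \<theta>)) has_vector_derivative
        \<theta> *s v'' + (G (\<theta> *s V) + \<Gamma> x (\<theta> *s v' z0) V + \<Gamma> x V (\<theta> *s v' z0))) (at 0)"
      unfolding a_def .
    have eq: "\<Gamma> x (\<theta> *s v' z0) V + \<Gamma> x V (\<theta> *s v' z0) = (2 * \<theta>) *s \<Gamma> x (v' z0) V"
      unfolding \<Gamma>_sym[OF x, of V] \<Gamma>_theta'[OF x] by (simp add: vec_eq_iff)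
    have bl: "bounded_linear (\<lambda>v::complex^'n. \<theta> *s v)"
      by (intro linear_conv_bounded_linear[THEN iffD1] linearI) (auto simp: vec_eq_iff algebra_simps)
    have a2: "((\<lambda>t. \<theta> *s a (z0 + of_real t * \<theta>)) has_vector_derivative
        \<theta> *s (\<theta> *s v'' + G (\<theta> *s V) + (2 * \<theta>) *s \<Gamma> x (v' z0) V)) (at 0)"
      using bounded_linear.has_vector_derivative[OF bl a1] by (simp add: eq add.assoc)
    have e1: "\<Gamma> x (\<theta> *s V) (\<theta> *s a z0) = (\<theta> * \<theta>) *s \<Gamma> x V (a z0)"
      unfolding \<Gamma>_theta'[OF x] \<Gamma>_theta[OF x] by (simp add: vector_smult_assoc)
    have e2: "\<theta> *s v' z0 + \<Gamma> x (\<theta> *s V) V = \<theta> *s a z0"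
      unfolding a_def \<Gamma>_theta'[OF x] by (simp add: vector_add_ldistrib x_def V_def)
    show ?thesis
      using metric_derivative_along[OF _ s1 a2 v1] x \<theta>
      by (simp add: x_def[symmetric] V_def[symmetric] e1 e2 g_theta[OF x] T_def)
  qed
  have GJ: "T 1 + T \<i> = g x (G V + J (G (J V))) V + 2 * g x (a z0) (a z0)"
  proof -
    note [simp] = bilinear_ladd[OF bil_g[OF x]]
    have "T 1 + T \<i> = g x ((1 *s (1 *s v'' + G (1 *s V) + (2 * 1) *s \<Gamma> x (v' z0) V)
      + (1 * 1) *s \<Gamma> x V (a z0)) + (\<i> *s (\<i> *s v'' + G (\<i> *s V) + (2 * \<i>) *s \<Gamma> x (v' z0) V)
      + (\<i> * \<i>) *s \<Gamma> x V (a z0))) V + 2 * g x (a z0) (a z0)"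
      unfolding T_def bilinear_ladd[OF bil_g[OF x]] by simp
    also have "(1 *s (1 *s v'' + G (1 *s V) + (2 * 1) *s \<Gamma> x (v' z0) V)
      + (1 * 1) *s \<Gamma> x V (a z0)) + (\<i> *s (\<i> *s v'' + G (\<i> *s V) + (2 * \<i>) *s \<Gamma> x (v' z0) V)
      + (\<i> * \<i>) *s \<Gamma> x V (a z0)) = G V + J (G (J V))"
      by (simp add: vec_eq_iff algebra_simps)
    finally show ?thesis .
  qed
  have curv: "g x (G V + J (G (J V))) V \<ge> 0"
    using curvature_nonpos[OF x, of V] v0 hsc unfolding G_def x_def V_def by blast
  define \<rho> where "\<rho> = 1 + (cmod z0)\<^sup>2"
  have \<rho>: "\<rho> > 0" unfolding \<rho>_def by (simp add: add_pos_nonneg)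
  define E0 where "E0 = E z0"
  have E0: "E0 > 0" using g_pos[OF x, of V] v0 by (simp add: E0_def E_def x_def V_def)
  have test: "g x (\<theta> *s a z0) V * \<rho> + c * E0 = 0 \<and> 2 * T \<theta> * \<rho> + 8 * g x (\<theta> *s a z0) V * c + 2 * E0 \<le> 0"
    if \<theta>: "cmod \<theta> = 1" and c: "c = Re (cnj \<theta> * z0)" for \<theta> c
  proof -
    obtain e where e: "e > 0" "ball z0 e \<subseteq> U" using U openE by blast
    have inU: "z0 + of_real t * \<theta> \<in> U" if "\<bar>t\<bar> < e" for t
    proof -
      have "dist z0 (z0 + of_real t * \<theta>) < e" using that \<theta> by (simp add: dist_norm norm_mult)
      then show ?thesis using e by auto
    qed
    let ?N = "\<lambda>t. \<rho> + 2 * t * c + t\<^sup>2"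
    have N: "1 + (cmod (z0 + of_real t * \<theta>))\<^sup>2 = ?N t" for t
    proof -
      have th: "Re \<theta> * Re \<theta> + Im \<theta> * Im \<theta> = 1"
        using \<theta> cmod_power2[of \<theta>] by (simp add: power2_eq_square)
      have "(cmod (z0 + of_real t * \<theta>))\<^sup>2 = (cmod z0)\<^sup>2 + 2 * t * c + t\<^sup>2 * (Re \<theta> * Re \<theta> + Im \<theta> * Im \<theta>)"
        unfolding c cmod_power2 by (simp add: power2_eq_square algebra_simps)
      then show ?thesis unfolding th \<rho>_def by simp
    qed
    define P where "P t = g (s (z0 + of_real t * \<theta>)) (\<theta> *s a (z0 + of_real t * \<theta>)) (v (z0 + of_real t * \<theta>))" for t
    have dEt: "((\<lambda>t. E (z0 + of_real t * \<theta>)) has_real_derivative 2 * P t) (at t)" if "\<bar>t\<bar> < e" for t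
    proof -
      have "((\<lambda>\<tau>. E ((z0 + of_real t * \<theta>) + of_real \<tau> * \<theta>)) has_real_derivative 2 * P t) (at 0)"
        unfolding P_def by (rule dE[OF inU[OF that]])
      then have "((\<lambda>\<tau>. E (z0 + of_real (\<tau> + t) * \<theta>)) has_real_derivative 2 * P t) (at 0)"
        by (simp add: algebra_simps)
      then show ?thesis
        using DERIV_shift[of "\<lambda>t. E (z0 + of_real t * \<theta>)" "2 * P t" 0 t] by simp
    qed
    have dP: "(P has_real_derivative T \<theta>) (at 0)" unfolding P_def by (rule ddE[OF \<theta>])
    have P0: "P 0 = g x (\<theta> *s a z0) V" by (simp add: P_def x_def V_def)
    let ?f = "\<lambda>t. E (z0 + of_real t * \<theta>) * ?N t"
    let ?f' = "\<lambda>t. 2 * P t * ?N t + E (z0 + of_real t * \<theta>) * (2 * c + 2 * t)"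
    have 1: "(?f has_real_derivative ?f' t) (at t)" if "\<bar>t\<bar> < e" for t
      by (rule derivative_eq_intros dEt[OF that] refl)+ (simp add: algebra_simps)
    have dE0: "((\<lambda>t. E (z0 + of_real t * \<theta>)) has_real_derivative 2 * P 0) (at 0)" using dEt[of 0] e by simp
    have 2: "(?f' has_real_derivative 2 * T \<theta> * \<rho> + 8 * P 0 * c + 2 * E0) (at 0)"
      by (rule derivative_eq_intros dP dE0 refl)+ (simp add: E0_def algebra_simps)
    have 3: "?f t \<le> ?f 0" if "\<bar>t\<bar> < e" for t
      using max[OF inU[OF that]] unfolding N by (simp add: E_def \<rho>_def)
    from second_derivative_test[OF e(1) 1 2 3] show ?thesis
      by (simp add: P0 E0_def[symmetric] algebra_simps)
  qed
  define p q where "p = g x (a z0) V" and "q = g x (J (a z0)) V"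
  define A where "A = g x (a z0) (a z0)"
  have t1: "p * \<rho> + Re z0 * E0 = 0" "2 * T 1 * \<rho> + 8 * p * Re z0 + 2 * E0 \<le> 0"
    using test[of 1 "Re z0"] by (simp_all add: p_def)
  have t2: "q * \<rho> + Im z0 * E0 = 0" "2 * T \<i> * \<rho> + 8 * q * Im z0 + 2 * E0 \<le> 0"
    using test[of \<i> "Im z0"] by (simp_all add: q_def)
  have CS: "p\<^sup>2 + q\<^sup>2 \<le> A * E0"
    using cauchy_schwarz_J[OF x, of "a z0" V] by (simp add: p_def q_def A_def E0_def E_def x_def V_def)
  have TT: "T 1 + T \<i> \<ge> 2 * A" using GJ curv by (simp add: A_def)
  have "4 * A * \<rho> + 8 * (p * Re z0 + q * Im z0) + 4 * E0 \<le> 0"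
  proof -
    have "2 * A * \<rho> \<le> (T 1 + T \<i>) * \<rho>" using TT \<rho> by (intro mult_right_mono) auto
    then show ?thesis using t1(2) t2(2) by (simp add: algebra_simps)
  qed
  then have K0: "E0 * \<rho> * (4 * A * \<rho> + 8 * (p * Re z0 + q * Im z0) + 4 * E0) \<le> 0" (is "?K \<le> 0")
    using E0 \<rho> by (simp add: mult_le_0_iff)
  have z0: "E0 * Re z0 = - p * \<rho>" "E0 * Im z0 = - q * \<rho>" using t1(1) t2(1) by (simp_all add: algebra_simps)
  define M N where "M = \<rho>\<^sup>2 * (A * E0)" and "N = \<rho>\<^sup>2 * (p\<^sup>2 + q\<^sup>2)"
  have "?K = 4 * \<rho>\<^sup>2 * (A * E0) + 8 * \<rho> * (p * (E0 * Re z0) + q * (E0 * Im z0)) + 4 * (\<rho> * E0\<^sup>2)"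
    by (simp add: algebra_simps power2_eq_square)
  also have "\<dots> = 4 * M - 8 * N + 4 * (\<rho> * E0\<^sup>2)"
    unfolding z0 M_def N_def by (simp add: algebra_simps power2_eq_square)
  finally have K: "?K = 4 * M - 8 * N + 4 * (\<rho> * E0\<^sup>2)" .
  have "E0\<^sup>2 * (cmod z0)\<^sup>2 = (E0 * Re z0)\<^sup>2 + (E0 * Im z0)\<^sup>2"
    by (simp only: cmod_power2 power_mult_distrib distrib_left)
  also have "\<dots> = N"
    unfolding z0 N_def by (simp only: power_mult_distrib power2_minus distrib_left mult.commute)
  finally have "\<rho> * E0\<^sup>2 = E0\<^sup>2 + N" unfolding \<rho>_def by (simp add: algebra_simps)
  moreover have "N \<le> M" unfolding M_def N_def using CS by (intro mult_left_mono) auto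
  moreover have "E0\<^sup>2 > 0" using E0 by simp
  ultimately show False using K0 unfolding K by linarith
qed

end

section \<open>Holomorphic functions of several variables\<close>

text \<open>Holomorphy at one point, which makes the calculus rules below pointwise.\<close>

definition complex_differentiable_at :: "(complex ^ 'n::finite \<Rightarrow> complex) \<Rightarrow> complex ^ 'n \<Rightarrow> bool" where
  "complex_differentiable_at h z \<longleftrightarrow> (\<exists>D. (h has_derivative D) (at z) \<and> (\<forall>a v. D (a *s v) = a * D v))"

lemma holomorphic_fun_on_iff: "holomorphic_fun_on h S \<longleftrightarrow> (\<forall>z\<in>S. complex_differentiable_at h z)"
  unfolding holomorphic_fun_on_def complex_differentiable_at_def ..

lemma cdiff_const [intro]: "complex_differentiable_at (\<lambda>_. c) z"
  unfolding complex_differentiable_at_def by (rule exI[of _ "\<lambda>_. 0"]) simp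

lemma cdiff_nth [intro]: "complex_differentiable_at (\<lambda>z. z $ i) z"
  unfolding complex_differentiable_at_def
  by (rule exI[of _ "\<lambda>z. z $ i"]) (auto intro: bounded_linear_imp_has_derivative)

lemma cdiff_diff:
  assumes "complex_differentiable_at f z" "complex_differentiable_at g z"
  shows "complex_differentiable_at (\<lambda>z. f z - g z) z"
proof -
  obtain D D' where "(f has_derivative D) (at z)" "(g has_derivative D') (at z)"
    and "\<forall>a v. D (a *s v) = a * D v" "\<forall>a v. D' (a *s v) = a * D' v"
    using assms unfolding complex_differentiable_at_def by blast
  then show ?thesis unfolding complex_differentiable_at_def
    by (intro exI[of _ "\<lambda>h. D h - D' h"] conjI has_derivative_diff) (auto simp: algebra_simps)
qed

lemma cdiff_mult:
  assumes "complex_differentiable_at f z" "complex_differentiable_at g z"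
  shows "complex_differentiable_at (\<lambda>z. f z * g z) z"
proof -
  obtain D D' where "(f has_derivative D) (at z)" "(g has_derivative D') (at z)"
    and "\<forall>a v. D (a *s v) = a * D v" "\<forall>a v. D' (a *s v) = a * D' v"
    using assms unfolding complex_differentiable_at_def by blast
  then show ?thesis unfolding complex_differentiable_at_def
    by (intro exI[of _ "\<lambda>h. f z * D' h + D h * g z"] conjI has_derivative_mult) (auto simp: algebra_simps)
qed

lemma cdiff_prod:
  "finite F \<Longrightarrow> (\<And>i. i \<in> F \<Longrightarrow> complex_differentiable_at (f i) z) \<Longrightarrow> complex_differentiable_at (\<lambda>z. \<Prod>i\<in>F. f i z) z"
  by (induction F rule: finite_induct) (auto intro: cdiff_mult)

lemma cdiff_isCont: "complex_differentiable_at f z \<Longrightarrow> isCont f z"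
  unfolding complex_differentiable_at_def using has_derivative_continuous by blast

lemma cdiff_transform:
  "complex_differentiable_at f z \<Longrightarrow> open S \<Longrightarrow> z \<in> S \<Longrightarrow> (\<And>y. y \<in> S \<Longrightarrow> f y = g y) \<Longrightarrow> complex_differentiable_at g z"
  unfolding complex_differentiable_at_def using has_derivative_transform_within_open[of f _ z UNIV S g] by blast

lemma has_derivative_vecI:
  fixes f :: "'a::real_normed_vector \<Rightarrow> complex ^ 'n::finite"
  assumes "\<And>i. ((\<lambda>x. f x $ i) has_derivative (\<lambda>h. D h $ i)) (at x)"
  shows "(f has_derivative D) (at x)"
proof -
  have ax: "bounded_linear (axis i :: complex \<Rightarrow> complex ^ 'n)" for i
    unfolding linear_conv_bounded_linear[symmetric] by (rule linearI) (auto simp: vec_eq_iff axis_def)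
  have eq: "v = (\<Sum>i\<in>UNIV. axis i (v $ i))" for v :: "complex ^ 'n"
    by (simp add: vec_eq_iff axis_def if_distrib cong: if_cong)
  have "((\<lambda>x. \<Sum>i\<in>UNIV. axis i (f x $ i)) has_derivative (\<lambda>h. \<Sum>i\<in>UNIV. axis i (D h $ i))) (at x)"
    by (intro has_derivative_sum bounded_linear.has_derivative[OF ax] assms)
  then show ?thesis unfolding eq[symmetric] .
qed

lemma has_derivative_of_cdiff_components:
  fixes \<Phi> :: "complex ^ 'm::finite \<Rightarrow> complex ^ 'n::finite"
  assumes "\<And>i. complex_differentiable_at (\<lambda>z. \<Phi> z $ i) z"
  obtains D where "(\<Phi> has_derivative D) (at z)" "\<And>a v. D (a *s v) = a *s D v"
proof -
  obtain D where D: "\<And>i. ((\<lambda>z. \<Phi> z $ i) has_derivative D i) (at z)" "\<And>i a v. D i (a *s v) = a * D i v"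
    using assms unfolding complex_differentiable_at_def by metis
  have "(\<Phi> has_derivative (\<lambda>h. \<chi> i. D i h)) (at z)"
    by (rule has_derivative_vecI) (simp add: D)
  then show ?thesis using that D(2) by (simp add: vec_eq_iff)
qed

lemma cdiff_compose:
  fixes \<Phi> :: "complex ^ 'm::finite \<Rightarrow> complex ^ 'n::finite"
  assumes "\<And>i. complex_differentiable_at (\<lambda>z. \<Phi> z $ i) z" and h: "complex_differentiable_at h (\<Phi> z)"
  shows "complex_differentiable_at (\<lambda>z. h (\<Phi> z)) z"
proof -
  obtain D where D: "(\<Phi> has_derivative D) (at z)" "\<And>a v. D (a *s v) = a *s D v"
    using has_derivative_of_cdiff_components[OF assms(1)] by blast
  obtain D' where D': "(h has_derivative D') (at (\<Phi> z))" "\<And>a v. D' (a *s v) = a * D' v"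
    using h unfolding complex_differentiable_at_def by blast
  show ?thesis unfolding complex_differentiable_at_def
    using has_derivative_compose[OF D(1) D'(1)] D(2) D'(2) by (intro exI[of _ "\<lambda>x. D' (D x)"]) auto
qed

lemma cdiff_compose_nth:
  fixes z :: "complex ^ 'n::finite"
  assumes "(f has_field_derivative f') (at (z $ i))"
  shows "complex_differentiable_at (\<lambda>z. f (z $ i)) z"
  unfolding complex_differentiable_at_def
  using has_derivative_compose[OF bounded_linear_imp_has_derivative[OF bounded_linear_vec_nth]
      assms[unfolded has_field_derivative_def]]
  by (intro exI[of _ "\<lambda>h. f' * (h $ i)"]) (auto simp: algebra_simps)

lemma has_field_derivative_along_curve:
  fixes s :: "complex \<Rightarrow> complex ^ 'n::finite"
  assumes s: "\<And>i. ((\<lambda>t. s t $ i) has_field_derivative v $ i) (at t)"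
    and h: "complex_differentiable_at h (s t)"
  shows "\<exists>D. ((\<lambda>t. h (s t)) has_field_derivative D) (at t)"
proof -
  have "(s has_derivative (\<lambda>h. h *s v)) (at t)"
  proof (rule has_derivative_vecI)
    fix i
    have "(*) (v $ i) = (\<lambda>h. (h *s v) $ i)" by (simp add: fun_eq_iff)
    then show "((\<lambda>t. s t $ i) has_derivative (\<lambda>h. (h *s v) $ i)) (at t)"
      using s[of i] unfolding has_field_derivative_def by simp
  qed
  moreover obtain D where D: "(h has_derivative D) (at (s t))" "\<And>a v. D (a *s v) = a * D v"
    using h unfolding complex_differentiable_at_def by blast
  ultimately have "((\<lambda>t. h (s t)) has_derivative (\<lambda>h. D (h *s v))) (at t)"
    using has_derivative_compose by blast
  moreover have "(\<lambda>h. D (h *s v)) = (*) (D v)" by (simp add: fun_eq_iff D(2))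
  ultimately show ?thesis unfolding has_field_derivative_def by (intro exI[of _ "D v"]) simp
qed

lemma norm_axis [simp]: "norm (axis k (c::complex) :: complex ^ 'n::finite) = cmod c"
proof -
  have "(\<lambda>i. (cmod ((axis k c :: complex ^ 'n) $ i))\<^sup>2) = (\<lambda>i. if i = k then (cmod c)\<^sup>2 else 0)"
    by (auto simp: axis_def)
  then have "(\<Sum>i\<in>UNIV. (cmod ((axis k c :: complex ^ 'n) $ i))\<^sup>2) = (cmod c)\<^sup>2"
    by (simp only: sum.delta finite UNIV_I if_True)
  then show ?thesis unfolding norm_vec_def L2_set_def by simp
qed

text \<open>Osgood's lemma. By the Cauchy inequality for the difference of two slices, uniform continuity of
  \<open>h\<close> makes the partial derivatives continuous; changing one coordinate after the
  other then shows that the partial derivatives assemble to a total derivative.\<close>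

lemma osgood:
  fixes h :: "complex ^ 'n::finite \<Rightarrow> complex"
  assumes E: "open E" and cont: "continuous_on E h"
    and sep: "\<And>z k. z \<in> E \<Longrightarrow> (\<lambda>t. h (z + axis k t)) field_differentiable (at 0)"
  shows "holomorphic_fun_on h E"
proof -
  define D where "D k z = deriv (\<lambda>t. h (z + axis k t)) 0" for k z
  have axis_add: "axis k (s + t) = (axis k s + axis k t :: complex ^ 'n)" for k s t
    by (auto simp: vec_eq_iff axis_def)
  have der: "((\<lambda>t. h (z + axis k t)) has_field_derivative D k (z + axis k t0)) (at t0)"
    if "z + axis k t0 \<in> E" for z k t0
  proof -
    have "((\<lambda>t. h ((z + axis k t0) + axis k t)) has_field_derivative D k (z + axis k t0)) (at 0)"
      unfolding D_def using sep[OF that] by (rule field_differentiable_derivI)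
    then have "((\<lambda>t. h (z + axis k (t + t0))) has_field_derivative D k (z + axis k t0)) (at 0)"
      by (simp add: axis_add add_ac)
    then show ?thesis using DERIV_shift[of "\<lambda>t. h (z + axis k t)" _ 0 t0] by simp
  qed
  have Dcont: "\<exists>d>0. ball z d \<subseteq> E \<and> (\<forall>y\<in>ball z d. \<forall>k. norm (D k y - D k z) \<le> e)"
    if z: "z \<in> E" and e: "e > 0" for z e
  proof -
    obtain r where r: "r > 0" "cball z (2 * r) \<subseteq> E"
      using E z by (metis open_contains_cball half_gt_zero mult.commute nonzero_mult_div_cancel_left field_sum_of_halves mult_2)
    have uc: "uniformly_continuous_on (cball z (2 * r)) h"
      using cont r(2) by (intro compact_uniformly_continuous) (auto intro: continuous_on_subset)
    obtain d where d: "d > 0" "\<And>x y. x \<in> cball z (2 * r) \<Longrightarrow> y \<in> cball z (2 * r) \<Longrightarrow> dist y x < d \<Longrightarrow> dist (h y) (h x) < e * r"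
      using uc e r(1) unfolding uniformly_continuous_on_def by (metis mult_pos_pos)
    show ?thesis
    proof (intro exI[of _ "min d r"] conjI ballI allI)
      show "min d r > 0" using d(1) r(1) by simp
      show "ball z (min d r) \<subseteq> E" using r by (auto simp: subset_iff)
      fix y k assume y: "y \<in> ball z (min d r)"
      have in2: "y + axis k t \<in> cball z (2 * r)" "z + axis k t \<in> cball z (2 * r)" if "cmod t \<le> r" for t
      proof -
        have "norm (z - (y + axis k t)) \<le> norm (z - y) + norm (axis k t :: complex ^ 'n)"
          using norm_triangle_ineq4[of "z - y" "axis k t"] by (simp add: algebra_simps)
        then show "y + axis k t \<in> cball z (2 * r)" using y that by (simp add: dist_norm)
        show "z + axis k t \<in> cball z (2 * r)" using that r(1) by (simp add: dist_norm)
      qed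
      let ?f = "\<lambda>t. h (y + axis k t) - h (z + axis k t)"
      have fd: "(?f has_field_derivative (D k (y + axis k t) - D k (z + axis k t))) (at t)" if "cmod t \<le> r" for t
        using in2[OF that] r(2) by (intro DERIV_diff der) auto
      have "norm ((deriv ^^ 1) ?f 0) \<le> fact 1 * (e * r) / r ^ 1"
      proof (rule Cauchy_inequality)
        show "?f holomorphic_on ball 0 r" unfolding holomorphic_on_def
          using fd unfolding field_differentiable_def
          by (meson has_field_derivative_at_within mem_ball_0 less_imp_le)
        show "continuous_on (cball 0 r) ?f"
          by (intro continuous_at_imp_continuous_on ballI DERIV_isCont[OF fd]) simp
        show "cmod (?f t) \<le> e * r" if "cmod (0 - t) = r" for t
        proof -
          have "dist (y + axis k t) (z + axis k t) < d" using y by (simp add: dist_commute)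
          from d(2)[OF in2(2) in2(1) this] show ?thesis using that by (simp add: dist_norm less_imp_le)
        qed
      qed (use r in auto)
      moreover have "deriv ?f 0 = D k y - D k z"
        using DERIV_imp_deriv[OF fd[of 0]] r(1) by (simp add: axis_def zero_vec_def[symmetric])
      ultimately show "norm (D k y - D k z) \<le> e" using r(1) by simp
    qed
  qed
  show ?thesis unfolding holomorphic_fun_on_iff
  proof
    fix z assume z: "z \<in> E"
    define L where "L v = (\<Sum>k\<in>UNIV. v $ k * D k z)" for v
    have "(h has_derivative L) (at z)" unfolding has_derivative_at_alt
    proof (intro conjI allI impI)
      show "bounded_linear L" unfolding L_def linear_conv_bounded_linear[symmetric]
        by (rule linearI) (simp_all add: algebra_simps sum.distrib scaleR_sum_right)
      fix e :: real assume e: "e > 0"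
      define e' where "e' = e / CARD('n)"
      have e': "e' > 0" using e by (simp add: e'_def)
      obtain d where d: "d > 0" "ball z d \<subseteq> E" "\<And>y k. y \<in> ball z d \<Longrightarrow> norm (D k y - D k z) \<le> e'"
        using Dcont[OF z e'] by blast
      have "norm (h y - h z - L (y - z)) \<le> e * norm (y - z)" if y: "norm (y - z) < d" for y
      proof -
        define v where "v = y - z"
        define vF where "vF F = (\<chi> i. if i \<in> F then v $ i else 0)" for F
        have "norm (h (z + vF F) - h z - (\<Sum>k\<in>F. v $ k * D k z)) \<le> card F * e' * norm v" if "finite F" for F
          using that
        proof (induction F rule: finite_induct)
          case empty
          then show ?case by (simp add: vF_def zero_vec_def[symmetric])
        next
          case (insert k F)
          have vins: "vF (insert k F) = vF F + axis k (v $ k)"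
            using insert.hyps by (auto simp: vF_def vec_eq_iff axis_def)
          have inb: "z + vF F + axis k t \<in> ball z d" if "t \<in> cball 0 (cmod (v $ k))" for t
          proof -
            have "norm (vF F + axis k t) \<le> norm v"
              by (rule norm_le_componentwise_cart) (use that insert.hyps in \<open>auto simp: vF_def axis_def\<close>)
            moreover have "dist z (z + vF F + axis k t) = norm (vF F + axis k t)"
            proof -
              have "z - (z + vF F + axis k t) = - (vF F + axis k t)" by simp
              then show ?thesis by (simp only: dist_norm norm_minus_cancel)
            qed
            ultimately show ?thesis using y by (simp add: v_def)
          qed
          let ?u = "\<lambda>t. h (z + vF F + axis k t) - t * D k z"
          have "norm (?u (v $ k) - ?u 0) \<le> e' * norm (v $ k - 0)"
          proof (rule field_differentiable_bound[OF convex_cball[of 0 "cmod (v $ k)"]])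
            fix t :: complex assume t: "t \<in> cball 0 (cmod (v $ k))"
            have lin: "((\<lambda>t. t * D k z) has_field_derivative D k z) (at (t :: complex))"
              by (auto intro!: derivative_eq_intros)
            have inE: "z + vF F + axis k t \<in> E" using inb[OF t] d(2) by blast
            show "(?u has_field_derivative (D k (z + vF F + axis k t) - D k z)) (at t within cball 0 (cmod (v $ k)))"
              by (rule has_field_derivative_at_within[OF DERIV_diff[OF der[OF inE] lin]])
            show "norm (D k (z + vF F + axis k t) - D k z) \<le> e'" by (rule d(3)[OF inb[OF t]])
          qed auto
          also have "\<dots> \<le> e' * norm v" using e' by (simp add: Finite_Cartesian_Product.norm_nth_le)
          finally have 1: "norm (h (z + vF (insert k F)) - h (z + vF F) - v $ k * D k z) \<le> e' * norm v"
            by (simp add: vins add.assoc axis_def zero_vec_def[symmetric] algebra_simps)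
          have "norm (h (z + vF (insert k F)) - h z - (\<Sum>k\<in>insert k F. v $ k * D k z))
            = norm ((h (z + vF (insert k F)) - h (z + vF F) - v $ k * D k z) +
                (h (z + vF F) - h z - (\<Sum>k\<in>F. v $ k * D k z)))"
            using insert.hyps by (simp add: algebra_simps)
          also have "\<dots> \<le> e' * norm v + card F * e' * norm v"
            using 1 insert.IH by (rule norm_triangle_mono)
          finally show ?case using insert.hyps by (simp add: algebra_simps)
        qed
        from this[of UNIV] have "norm (h (z + vF UNIV) - h z - L v) \<le> CARD('n) * e' * norm v"
          unfolding L_def by simp
        moreover have "vF UNIV = v" by (simp add: vF_def)
        ultimately show ?thesis by (simp add: v_def e'_def)
      qed
      then show "\<exists>d>0. \<forall>y. norm (y - z) < d \<longrightarrow> norm (h y - h z - L (y - z)) \<le> e * norm (y - z)"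
        using d(1) by blast
    qed
    moreover have "L (a *s v) = a * L v" for a v unfolding L_def by (simp add: sum_distrib_left mult.assoc)
    ultimately show "complex_differentiable_at h z" unfolding complex_differentiable_at_def by blast
  qed
qed

section \<open>Elementary symmetric functions\<close>

text \<open>The roots are indexed by an arbitrary finite set of the right size, which will be the index type
  of the coordinates.\<close>

lemma monic_splits:
  fixes p :: "complex poly"
  assumes "finite F" "lead_coeff p = 1" "degree p = card F"
  shows "\<exists>w. p = (\<Prod>i\<in>F. [:- w i, 1:])"
  using assms
proof (induction F arbitrary: p rule: finite_induct)
  case empty
  then obtain a where "p = [:a:]" using degree_eq_zeroE[of p] by auto
  then show ?case using empty by (simp add: one_pCons)
next
  case (insert x F)
  have "degree p > 0" using insert by simp
  then have "\<not> (\<exists>a l. a \<noteq> 0 \<and> l = 0 \<and> p = pCons a l)" by auto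
  then obtain z where "poly p z = 0" using fundamental_theorem_of_algebra_alt by blast
  then obtain q where q: "p = [:- z, 1:] * q" by (auto simp: poly_eq_0_iff_dvd)
  have q0: "q \<noteq> 0" using insert.prems q by auto
  have "degree p = 1 + degree q" unfolding q using q0 by (subst degree_mult_eq) auto
  then have "degree q = card F" using insert by simp
  moreover have "lead_coeff q = 1" using insert.prems(1) unfolding q lead_coeff_mult by simp
  ultimately obtain w where w: "q = (\<Prod>i\<in>F. [:- w i, 1:])" using insert.IH by blast
  have "(\<Prod>i\<in>F. [:- (w(x := z)) i, 1:]) = (\<Prod>i\<in>F. [:- w i, 1:])"
    using insert.hyps by (intro prod.cong) auto
  then show ?case using q w insert.hyps
    by (intro exI[of _ "w(x := z)"]) simp
qed

text \<open>Unique factorization, as a matching of the roots: a root of one product is a root of the other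
  one, and the common factor cancels.\<close>

lemma equal_root_products_bij:
  fixes w w' :: "'i \<Rightarrow> complex"
  assumes "finite F" "finite F'" "(\<Prod>i\<in>F. [:- w i, 1:]) = (\<Prod>i\<in>F'. [:- w' i, 1:])"
  shows "\<exists>\<pi>. bij_betw \<pi> F F' \<and> (\<forall>i\<in>F. w i = w' (\<pi> i))"
  using assms
proof (induction F arbitrary: F' rule: finite_induct)
  case empty
  have "F' = {}"
  proof (rule ccontr)
    assume "F' \<noteq> {}"
    then obtain j where "j \<in> F'" by blast
    then have "poly (\<Prod>i\<in>F'. [:- w' i, 1:]) (w' j) = 0" using empty(1) by (auto simp: poly_prod)
    then show False using empty(2) by (metis poly_1 prod.empty zero_neq_one)
  qed
  then show ?case by (simp add: bij_betw_def)
next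
  case (insert x F)
  have "poly (\<Prod>i\<in>insert x F. [:- w i, 1:]) (w x) = 0" using insert.hyps by (simp add: poly_prod)
  then have "poly (\<Prod>i\<in>F'. [:- w' i, 1:]) (w x) = 0" using insert.prems by simp
  then obtain j where j: "j \<in> F'" "w x = w' j" using insert.prems(1) by (auto simp: poly_prod)
  have "[:- w x, 1:] * (\<Prod>i\<in>F. [:- w i, 1:]) = [:- w x, 1:] * (\<Prod>i\<in>F' - {j}. [:- w' i, 1:])"
    using insert j by (simp add: prod.remove[of F' j])
  then have "(\<Prod>i\<in>F. [:- w i, 1:]) = (\<Prod>i\<in>F' - {j}. [:- w' i, 1:])"
    by (subst (asm) mult_cancel_left) simp
  then obtain \<pi> where \<pi>: "bij_betw \<pi> F (F' - {j})" "\<forall>i\<in>F. w i = w' (\<pi> i)"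
    using insert.IH[of "F' - {j}"] insert.prems by blast
  have "bij_betw (\<pi>(x := j)) F (F' - {j})"
    using \<pi>(1) insert.hyps by (subst bij_betw_cong[of F _ \<pi>]) auto
  then have "bij_betw (\<pi>(x := j)) (insert x F) (insert j (F' - {j}))"
    using insert.hyps notIn_Un_bij_betw[of x F "\<pi>(x := j)" "F' - {j}"] by (simp add: insert_commute)
  moreover have "insert j (F' - {j}) = F'" using j by blast
  moreover have "\<forall>i\<in>insert x F. w i = w' ((\<pi>(x := j)) i)" using \<pi>(2) j insert.hyps by auto
  ultimately show ?case by metis
qed

definition root_poly :: "complex ^ 'n::finite \<Rightarrow> complex poly" where
  "root_poly w = (\<Prod>i\<in>UNIV. [:- w $ i, 1:])"

lemma poly_root_poly: "poly (root_poly w) a = (\<Prod>i\<in>UNIV. a - w $ i)"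
  unfolding root_poly_def by (simp add: poly_prod)

lemma degree_root_poly: "degree (root_poly (w :: complex ^ 'n::finite)) = CARD('n)"
  unfolding root_poly_def by (subst degree_prod_eq_sum_degree) auto

lemma lead_coeff_root_poly: "lead_coeff (root_poly w) = 1"
  unfolding root_poly_def lead_coeff_prod by simp

lemma root_poly_eqD:
  fixes w w' :: "complex ^ 'n::finite"
  assumes "root_poly w = root_poly w'"
  obtains \<pi> where "\<pi> permutes UNIV" "w = (\<chi> i. w' $ (\<pi> i))"
proof -
  obtain \<pi> where "bij_betw \<pi> UNIV UNIV" "\<forall>i. w $ i = w' $ (\<pi> i)"
    using equal_root_products_bij[of UNIV UNIV "($) w" "($) w'"] assms unfolding root_poly_def by auto
  moreover from this(1) have "\<pi> permutes UNIV" by (rule bij_imp_permutes) simp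
  ultimately show ?thesis using that[of \<pi>] by (simp add: vec_eq_iff)
qed

text \<open>As coordinates of a monic polynomial of degree \<open>n\<close>, its values at \<open>n\<close>
  fixed nodes replace the coefficients. Both are related by an affine isomorphism, so the map
  \<open>\<sigma>\<close> below is the map of elementary symmetric functions in other coordinates;
  it is a plain product in each component, and moving one coordinate adds a multiple of one
  Lagrange polynomial (\<open>monic_of_line\<close>).\<close>

locale interpolation_nodes =
  fixes \<tau> :: "'n::finite \<Rightarrow> complex"
  assumes inj: "inj \<tau>"
begin

definition \<sigma> :: "complex ^ 'n \<Rightarrow> complex ^ 'n" where
  "\<sigma> w = (\<chi> k. \<Prod>i\<in>UNIV. \<tau> k - w $ i)"

lemma poly_eqI_nodes:
  assumes "degree p < CARD('n)" "\<And>k. poly p (\<tau> k) = 0"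
  shows "p = 0"
proof (rule ccontr)
  assume p: "p \<noteq> 0"
  have "CARD('n) = card (range \<tau>)" using inj by (simp add: card_image)
  also have "\<dots> \<le> card {x. poly p x = 0}"
    using assms(2) poly_roots_finite[OF p] by (intro card_mono) auto
  also have "\<dots> \<le> degree p" by (rule card_poly_roots_bound[OF p])
  finally show False using assms(1) by simp
qed

definition lagrange_weight :: "'n \<Rightarrow> complex" where "lagrange_weight k = 1 / (\<Prod>j\<in>UNIV - {k}. \<tau> k - \<tau> j)"

definition lagrange :: "'n \<Rightarrow> complex poly" where
  "lagrange k = smult (lagrange_weight k) (\<Prod>j\<in>UNIV - {k}. [:- \<tau> j, 1:])"

lemma poly_lagrange: "poly (lagrange k) (\<tau> j) = (if j = k then 1 else 0)"
proof -
  have "(\<Prod>j\<in>UNIV - {k}. \<tau> k - \<tau> j) \<noteq> 0" using inj by (auto simp: inj_eq)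
  moreover have "(\<Prod>i\<in>UNIV - {k}. \<tau> j - \<tau> i) = 0" if "j \<noteq> k" using that by auto
  ultimately show ?thesis by (auto simp: lagrange_def lagrange_weight_def poly_prod)
qed

lemma lagrange_nz: "lagrange k \<noteq> 0"
  using poly_lagrange[of k k] by auto

lemma degree_lagrange: "degree (lagrange k) < CARD('n)"
proof -
  have "degree (lagrange k) \<le> degree (\<Prod>j\<in>UNIV - {k}. [:- \<tau> j, 1:])"
    unfolding lagrange_def by (rule degree_smult_le)
  also have "\<dots> = card (UNIV - {k})" by (subst degree_prod_eq_sum_degree) auto
  also have "\<dots> < CARD('n)" by (rule psubset_card_mono) auto
  finally show ?thesis .
qed

text \<open>The monic polynomial with value \<open>s $ k\<close> at the node \<open>\<tau> k\<close>: the
  first summand vanishes at all nodes and the sum is the interpolation polynomial.\<close>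

definition monic_of :: "complex ^ 'n \<Rightarrow> complex poly" where
  "monic_of s = root_poly (\<chi> i. \<tau> i) + (\<Sum>k\<in>UNIV. smult (s $ k) (lagrange k))"

lemma degree_correction: "degree (\<Sum>k\<in>UNIV. smult (s k) (lagrange k)) < CARD('n)"
  by (rule degree_sum_less) (use le_less_trans[OF degree_smult_le degree_lagrange] in blast, simp)

lemma degree_monic_of: "degree (monic_of s) = CARD('n)"
  unfolding monic_of_def using degree_correction[of "\<lambda>k. s $ k"]
  by (subst degree_add_eq_left) (auto simp: degree_root_poly)

lemma lead_coeff_monic_of: "lead_coeff (monic_of s) = 1"
  unfolding degree_monic_of unfolding monic_of_def coeff_add
  using lead_coeff_root_poly[of "\<chi> i. \<tau> i"] coeff_eq_0[OF degree_correction[of "\<lambda>k. s $ k"]]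
  by (simp add: degree_root_poly)

lemma poly_monic_of: "poly (monic_of s) (\<tau> k) = s $ k"
proof -
  have "(\<Prod>i\<in>UNIV. \<tau> k - \<tau> i) = 0" by auto
  moreover have "(\<Sum>j\<in>UNIV. s $ j * (if k = j then 1 else 0)) = s $ k"
    by (simp add: if_distrib cong: if_cong)
  ultimately show ?thesis by (simp add: monic_of_def poly_root_poly poly_sum poly_lagrange)
qed

lemma monic_of_line: "monic_of (s + axis k t) = monic_of s + smult t (lagrange k)"
proof -
  have "(\<Sum>j\<in>UNIV. smult (axis k t $ j) (lagrange j)) = smult t (lagrange k)"
    by (subst sum.remove[of _ k]) (auto simp: axis_def intro!: sum.neutral)
  then show ?thesis by (simp add: monic_of_def smult_add_left sum.distrib)
qed

lemma root_poly_eq: "root_poly w = monic_of (\<sigma> w)"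
proof -
  let ?p = "root_poly w - monic_of (\<sigma> w)"
  have le: "degree ?p \<le> CARD('n)"
    by (rule order_trans[OF degree_diff_le_max]) (simp add: degree_root_poly degree_monic_of)
  have "coeff ?p CARD('n) = 0"
    using lead_coeff_root_poly[of w] lead_coeff_monic_of[of "\<sigma> w"] by (simp add: degree_root_poly degree_monic_of)
  with le have "?p = 0 \<or> degree ?p < CARD('n)" by (rule eq_zero_or_degree_less)
  moreover have "poly ?p (\<tau> k) = 0" for k by (simp add: poly_monic_of poly_root_poly \<sigma>_def)
  ultimately have "?p = 0" using poly_eqI_nodes by blast
  then show ?thesis by simp
qed

lemma \<sigma>_surj: "\<exists>w. \<sigma> w = s"
proof -
  obtain w where w: "monic_of s = (\<Prod>i\<in>(UNIV::'n set). [:- w i, 1:])"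
    using monic_splits[of "UNIV :: 'n set" "monic_of s"] lead_coeff_monic_of degree_monic_of by auto
  then have "root_poly (\<chi> i. w i) = monic_of s" by (simp add: root_poly_def)
  then have "\<sigma> (\<chi> i. w i) $ k = s $ k" for k
    using poly_monic_of[of s k] poly_root_poly[of "\<chi> i. w i" "\<tau> k"] by (simp add: \<sigma>_def)
  then show ?thesis by (metis vec_eq_iff)
qed

lemma \<sigma>_permute: "\<pi> permutes UNIV \<Longrightarrow> \<sigma> (\<chi> i. w $ (\<pi> i)) = \<sigma> w"
  unfolding \<sigma>_def by (auto simp: vec_eq_iff intro!: prod.reindex_bij_betw permutes_imp_bij)

lemma \<sigma>_eqD:
  fixes w w' :: "complex ^ 'n"
  assumes "\<sigma> w = \<sigma> w'"
  obtains \<pi> where "\<pi> permutes UNIV" "w = (\<chi> i. w' $ (\<pi> i))"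
  using root_poly_eqD[of w w'] assms by (auto simp: root_poly_eq)

lemma cdiff_\<sigma>: "complex_differentiable_at (\<lambda>w. \<sigma> w $ k) w"
  unfolding \<sigma>_def by (auto intro!: cdiff_prod cdiff_diff)

lemma continuous_\<sigma>: "continuous_on S \<sigma>"
  unfolding \<sigma>_def by (intro continuous_intros)

text \<open>If \<open>a = w $ i\<close> is not a node, dividing the polynomial with roots \<open>w\<close>
  by the product of all \<open>a - \<tau> k\<close> gives
  \<open>0 = 1 + (\<Sum>k. s $ k * c k / (a - \<tau> k))\<close> for
  \<open>s = \<sigma> w\<close> and the weights \<open>c k\<close>, which fails when
  \<open>a\<close> is far from all nodes.\<close>

lemma root_bound:
  shows "\<exists>k. cmod (w $ i - \<tau> k) < 2 * (\<Sum>k\<in>UNIV. cmod (lagrange_weight k)) * norm (\<sigma> w) + 1"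
proof (rule ccontr)
  define a s C where "a = w $ i" and "s = \<sigma> w" and "C = (\<Sum>k\<in>UNIV. cmod (lagrange_weight k))"
  assume "\<not> ?thesis"
  then have far: "cmod (a - \<tau> k) \<ge> 2 * C * norm s + 1" for k
    unfolding a_def s_def C_def by (meson not_less)
  have C0: "C \<ge> 0" unfolding C_def by (intro sum_nonneg) auto
  then have pos: "2 * C * norm s + 1 > 0" by (simp add: add_nonneg_pos)
  have ne: "a - \<tau> k \<noteq> 0" for k using far[of k] pos by auto
  define Q where "Q = (\<Prod>j\<in>UNIV. a - \<tau> j)"
  have Q: "Q \<noteq> 0" unfolding Q_def using ne by simp
  have lag: "poly (lagrange k) a = lagrange_weight k * (Q / (a - \<tau> k))" for k
  proof -
    have "Q = (a - \<tau> k) * (\<Prod>j\<in>UNIV - {k}. a - \<tau> j)" unfolding Q_def by (rule prod.remove) auto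
    then show ?thesis using ne[of k] by (simp add: lagrange_def poly_prod)
  qed
  have "poly (root_poly w) a = 0" unfolding poly_root_poly a_def by auto
  then have "poly (monic_of s) a = 0" unfolding root_poly_eq s_def .
  then have "Q + (\<Sum>k\<in>UNIV. s $ k * (lagrange_weight k * (Q / (a - \<tau> k)))) = 0"
    unfolding monic_of_def by (simp add: poly_root_poly poly_sum lag Q_def)
  then have "Q * (1 + (\<Sum>k\<in>UNIV. s $ k * (lagrange_weight k / (a - \<tau> k)))) = 0"
    by (simp add: algebra_simps sum_distrib_left)
  then have "(\<Sum>k\<in>UNIV. s $ k * (lagrange_weight k / (a - \<tau> k))) = -1" using Q by (simp add: add_eq_0_iff)
  then have "1 = cmod (\<Sum>k\<in>UNIV. s $ k * (lagrange_weight k / (a - \<tau> k)))" by simp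
  also have "\<dots> \<le> (\<Sum>k\<in>UNIV. norm s * (cmod (lagrange_weight k) / (2 * C * norm s + 1)))"
  proof (rule order_trans[OF norm_sum], rule sum_mono)
    fix k
    show "cmod (s $ k * (lagrange_weight k / (a - \<tau> k))) \<le> norm s * (cmod (lagrange_weight k) / (2 * C * norm s + 1))"
      unfolding norm_mult norm_divide
      by (intro mult_mono divide_left_mono far Finite_Cartesian_Product.norm_nth_le mult_pos_pos pos)
        (use ne pos C0 in auto)
  qed
  also have "\<dots> = C * norm s / (2 * C * norm s + 1)"
    unfolding C_def by (simp add: sum_distrib_left sum_divide_distrib mult.commute)
  also have "\<dots> < 1"
  proof -
    have "C * norm s \<ge> 0" using C0 by simp
    then have "C * norm s < 2 * C * norm s + 1" by linarith
    then show ?thesis using pos by simp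
  qed
  finally show False by simp
qed

text \<open>By \<open>root_bound\<close> the preimages of a convergent sequence are bounded, so a subsequence
  of them converges.\<close>

lemma closed_\<sigma>_image:
  assumes "closed K" shows "closed (\<sigma> ` K)"
  unfolding closed_sequential_limits
proof (intro allI impI, elim conjE)
  fix y l assume y: "\<forall>j. y j \<in> \<sigma> ` K" and lim: "y \<longlonglongrightarrow> l"
  then have "\<forall>j. \<exists>v. v \<in> K \<and> y j = \<sigma> v" by blast
  from choice[OF this] obtain w where w: "\<And>j. w j \<in> K" "\<And>j. y j = \<sigma> (w j)" by blast
  obtain M where M: "\<And>j. norm (y j) \<le> M"
    using convergent_imp_bounded[OF lim] by (auto simp: bounded_iff)
  define C where "C = (\<Sum>k\<in>UNIV. cmod (lagrange_weight k))"
  define T where "T = (\<Sum>k\<in>UNIV. cmod (\<tau> k))"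
  have C0: "C \<ge> 0" unfolding C_def by (intro sum_nonneg) auto
  have comp: "cmod (w j $ i) \<le> T + (2 * C * M + 1)" for i j
  proof -
    obtain k where "cmod (w j $ i - \<tau> k) < 2 * C * norm (y j) + 1"
      using root_bound[of "w j" i] unfolding w(2) C_def by blast
    moreover have "2 * C * norm (y j) \<le> 2 * C * M" using M C0 by (intro mult_left_mono) auto
    moreover have "cmod (\<tau> k) \<le> T" unfolding T_def by (rule member_le_sum) auto
    moreover have "cmod (w j $ i) \<le> cmod (w j $ i - \<tau> k) + cmod (\<tau> k)"
      by (metis diff_add_cancel norm_triangle_ineq)
    ultimately show ?thesis by linarith
  qed
  have "norm (w j) \<le> CARD('n) * (T + (2 * C * M + 1))" for j
  proof -
    have "norm (w j) \<le> (\<Sum>i\<in>UNIV. cmod (w j $ i))" unfolding norm_vec_def by (rule L2_set_le_sum) auto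
    also have "\<dots> \<le> (\<Sum>i\<in>(UNIV::'n set). (T + (2 * C * M + 1)))" by (intro sum_mono comp)
    finally show ?thesis by simp
  qed
  then have "bounded (range w)" by (auto simp: bounded_iff)
  then obtain l' r where r: "strict_mono (r :: nat \<Rightarrow> nat)" "(w \<circ> r) \<longlonglongrightarrow> l'"
    using bounded_imp_convergent_subsequence by blast
  have "l' \<in> K" using assms r(2) w(1) unfolding closed_sequential_limits by (metis comp_apply)
  have "((\<lambda>j. \<sigma> ((w \<circ> r) j))) \<longlonglongrightarrow> \<sigma> l'"
    using continuous_on_tendsto_compose[OF continuous_\<sigma>[of UNIV] r(2)] by simp
  moreover have "(\<lambda>j. \<sigma> ((w \<circ> r) j)) = y \<circ> r" by (auto simp: w(2))
  ultimately have "l = \<sigma> l'" using LIMSEQ_subseq_LIMSEQ[OF lim r(1)] LIMSEQ_unique by metis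
  then show "l \<in> \<sigma> ` K" using \<open>l' \<in> K\<close> by blast
qed

text \<open>The complement of the image of \<open>U\<close> is the image of the complement of all permuted
  copies of \<open>U\<close>, which is closed.\<close>

lemma open_\<sigma>_image:
  assumes "open U" shows "open (\<sigma> ` U)"
proof -
  define V where "V = (\<Union>\<pi>\<in>{\<pi>. \<pi> permutes (UNIV::'n set)}. (\<lambda>w. \<chi> i. w $ (\<pi> i)) -` U)"
  have "open ((\<lambda>w :: complex ^ 'n. \<chi> i. w $ (\<pi> i)) -` U)" for \<pi>
    by (intro open_vimage assms continuous_intros)
  then have "open V" unfolding V_def by blast
  then have "closed (\<sigma> ` (- V))" by (intro closed_\<sigma>_image) (simp add: closed_Compl)
  moreover have "\<sigma> ` (- V) = - (\<sigma> ` U)"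
  proof (intro equalityI subsetI)
    fix s assume "s \<in> - (\<sigma> ` U)"
    obtain w where w: "\<sigma> w = s" using \<sigma>_surj by blast
    have "w \<notin> V"
    proof
      assume "w \<in> V"
      then obtain \<pi> where "\<pi> permutes UNIV" "(\<chi> i. w $ (\<pi> i)) \<in> U" by (auto simp: V_def)
      from imageI[OF this(2), of \<sigma>] have "s \<in> \<sigma> ` U"
        unfolding \<sigma>_permute[OF \<open>\<pi> permutes UNIV\<close>] w .
      then show False using \<open>s \<in> - (\<sigma> ` U)\<close> by blast
    qed
    then show "s \<in> \<sigma> ` (- V)" using w by blast
  next
    fix s assume "s \<in> \<sigma> ` (- V)"
    then obtain w where w: "w \<notin> V" "s = \<sigma> w" by blast
    show "s \<in> - (\<sigma> ` U)"
    proof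
      assume "s \<in> \<sigma> ` U"
      then obtain u where u: "u \<in> U" "\<sigma> u = \<sigma> w" using w by auto
      then obtain \<pi> where "\<pi> permutes UNIV" "u = (\<chi> i. w $ (\<pi> i))" using \<sigma>_eqD by blast
      then show False using w u by (auto simp: V_def)
    qed
  qed
  ultimately show ?thesis by (simp add: closed_def)
qed

end

context interpolation_nodes
begin

text \<open>Choosing for each parameter a root vector closest to \<open>w1\<close> makes the choice continuous
  at that parameter, since \<open>\<sigma>\<close> is open.\<close>

lemma continuous_root_selection:
  fixes y :: "complex \<Rightarrow> complex ^ 'n"
  assumes y: "isCont y t1" and w1: "\<sigma> w1 = y t1"
  obtains w where "\<And>t. \<sigma> (w t) = y t" "w t1 = w1" "isCont w t1"
proof -
  have cl: "closed (\<sigma> -` {s})" for s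
    by (rule continuous_closed_vimage) (use continuous_\<sigma>[of UNIV] in \<open>auto simp: continuous_on_eq_continuous_at\<close>)
  have ne: "\<sigma> -` {s} \<noteq> {}" for s using \<sigma>_surj[of s] by blast
  have "\<forall>t. \<exists>u. \<sigma> u = y t \<and> (\<forall>u'. \<sigma> u' = y t \<longrightarrow> dist w1 u \<le> dist w1 u')"
  proof
    fix t
    obtain u where "u \<in> \<sigma> -` {y t}" "\<And>u'. u' \<in> \<sigma> -` {y t} \<Longrightarrow> dist w1 u \<le> dist w1 u'"
      using distance_attains_inf[OF cl ne] by blast
    then show "\<exists>u. \<sigma> u = y t \<and> (\<forall>u'. \<sigma> u' = y t \<longrightarrow> dist w1 u \<le> dist w1 u')"
      by (intro exI[of _ u]) simp
  qed
  from choice[OF this] obtain w where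
    w: "\<And>t. \<sigma> (w t) = y t" "\<And>t u'. \<sigma> u' = y t \<Longrightarrow> dist w1 (w t) \<le> dist w1 u'" by blast
  have w1': "w t1 = w1" using w(2)[OF w1] by simp
  have "isCont w t1"
    unfolding isCont_def w1'
  proof (rule tendstoI)
    fix e :: real assume e: "e > 0"
    have "open (\<sigma> ` ball w1 e)" by (rule open_\<sigma>_image) simp
    moreover have "y t1 \<in> \<sigma> ` ball w1 e" using w1 e by (metis centre_in_ball imageI)
    ultimately have "\<forall>\<^sub>F t in at t1. y t \<in> \<sigma> ` ball w1 e"
      using y unfolding isCont_def by (rule topological_tendstoD[rotated])
    then show "\<forall>\<^sub>F t in at t1. dist (w t) w1 < e"
    proof eventually_elim
      case (elim t)
      then obtain u where "dist w1 u < e" "\<sigma> u = y t" by auto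
      then show ?case using w(2)[of u t] by (simp add: dist_commute)
    qed
  qed
  with w(1) w1' show ?thesis by (rule that)
qed

text \<open>A direct implicit differentiation. The polynomials along the line are
  \<open>P + (t - t1) L\<close>; writing \<open>P = (X - r) R\<close> for a simple root
  \<open>r\<close> of \<open>P\<close>, the moving root \<open>r t\<close> satisfies
  \<open>(r t - r) / (t - t1) = - L (r t) / R (r t)\<close>.\<close>

lemma simple_roots_differentiable:
  fixes w :: "complex \<Rightarrow> complex ^ 'n"
  assumes w: "\<And>t. \<sigma> (w t) = s + axis k t" and cont: "isCont w t1" and simple: "inj (($) (w t1))"
  shows "\<exists>D. ((\<lambda>t. w t $ i) has_field_derivative D) (at t1)"
proof -
  define R where "R a = (\<Prod>j\<in>UNIV - {i}. a - w t1 $ j)" for a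
  define r where "r t = w t $ i" for t
  have rc: "isCont r t1" unfolding r_def
    using cont by (rule bounded_linear.isCont[OF bounded_linear_vec_nth])
  have eq: "(r t - r t1) * R (r t) = - (t - t1) * poly (lagrange k) (r t)" for t
  proof -
    have "root_poly (w t) = monic_of (s + axis k t1) + smult (t - t1) (lagrange k)"
      unfolding root_poly_eq w monic_of_line by (simp add: smult_diff_left)
    also have "monic_of (s + axis k t1) = root_poly (w t1)" by (simp add: root_poly_eq w)
    finally have "poly (root_poly (w t)) (r t) = poly (root_poly (w t1)) (r t) + (t - t1) * poly (lagrange k) (r t)"
      by simp
    moreover have "poly (root_poly (w t)) (r t) = 0" unfolding poly_root_poly r_def by auto
    moreover have "poly (root_poly (w t1)) (r t) = (r t - r t1) * R (r t)"
      unfolding poly_root_poly R_def r_def by (rule prod.remove) auto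
    ultimately have "(r t - r t1) * R (r t) + (t - t1) * poly (lagrange k) (r t) = 0" by simp
    then show ?thesis by algebra
  qed
  have R1: "R (r t1) \<noteq> 0" unfolding R_def r_def using simple by (auto simp: inj_eq)
  have Rc: "isCont (\<lambda>t. R (r t)) t1" unfolding R_def by (intro continuous_intros rc)
  have pc: "isCont (\<lambda>t. poly (lagrange k) (r t)) t1" by (intro continuous_intros rc)
  have "((\<lambda>t. - poly (lagrange k) (r t) / R (r t)) \<longlongrightarrow> - poly (lagrange k) (r t1) / R (r t1)) (at t1)"
    using Rc pc R1 unfolding isCont_def by (intro tendsto_divide tendsto_minus)
  moreover have "\<forall>\<^sub>F t in at t1. - poly (lagrange k) (r t) / R (r t) = (r t - r t1) / (t - t1)"
  proof -
    have "\<forall>\<^sub>F t in at t1. R (r t) \<noteq> 0"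
      using Rc R1 unfolding isCont_def by (rule tendsto_imp_eventually_ne)
    moreover have "\<forall>\<^sub>F t in at t1. t \<noteq> t1" by (rule eventually_neq_at_within)
    ultimately show ?thesis
    proof eventually_elim
      case (elim t)
      then show ?case using eq[of t] by (simp add: field_simps)
    qed
  qed
  ultimately have "((\<lambda>t. (r t - r t1) / (t - t1)) \<longlongrightarrow> - poly (lagrange k) (r t1) / R (r t1)) (at t1)"
    by (rule Lim_transform_eventually)
  then show ?thesis unfolding r_def has_field_derivative_iff by blast
qed

text \<open>A multiple root of \<open>A + t B\<close> is a zero of the Wronskian
  \<open>Q = A B' - A' B\<close>, and it determines \<open>t\<close>. The Wronskian is not
  zero: otherwise \<open>B\<close> would vanish at the \<open>n\<close> simple roots of
  \<open>A\<close>, although it is a nonzero polynomial of degree less than \<open>n\<close>.\<close>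

lemma finitely_many_multiple_roots:
  fixes w0 :: "complex ^ 'n"
  assumes w0: "inj (($) w0)"
  shows "finite {t. \<exists>w. \<sigma> w = \<sigma> w0 + axis k t \<and> \<not> inj (($) w)}"
proof -
  define A B where "A = root_poly w0" and "B = lagrange k"
  define Q where "Q = A * pderiv B - pderiv A * B"
  have simple: "poly (pderiv A) a \<noteq> 0" if "poly A a = 0" for a
  proof -
    have "(\<Prod>i\<in>UNIV. a - w0 $ i) = 0" using that unfolding A_def poly_root_poly .
    then have "\<exists>i. a - w0 $ i = 0" by (simp add: prod_zero_iff)
    then obtain i where i: "a = w0 $ i" using eq_iff_diff_eq_0 by blast
    define S where "S = (\<Prod>j\<in>UNIV - {i}. [:- w0 $ j, 1:])"
    have A: "A = [:- a, 1:] * S" unfolding A_def root_poly_def S_def i by (rule prod.remove) auto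
    have "poly (pderiv A) a = poly S a" unfolding A pderiv_mult by (simp add: pderiv_pCons)
    also have "\<dots> \<noteq> 0" unfolding S_def i poly_prod using w0 by (auto simp: inj_eq)
    finally show ?thesis .
  qed
  have "Q \<noteq> 0"
  proof
    assume Q: "Q = 0"
    have "poly B (w0 $ i) = 0" for i
    proof -
      have "poly A (w0 $ i) = 0" unfolding A_def poly_root_poly by auto
      moreover from this have "poly (pderiv A) (w0 $ i) \<noteq> 0" by (rule simple)
      moreover have "poly Q (w0 $ i) = 0" using Q by simp
      ultimately show ?thesis by (simp add: Q_def)
    qed
    then have "range (($) w0) \<subseteq> {x. poly B x = 0}" by auto
    then have "card (range (($) w0)) \<le> card {x. poly B x = 0}"
      using poly_roots_finite[OF lagrange_nz] unfolding B_def by (intro card_mono) auto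
    also have "\<dots> \<le> degree B" unfolding B_def by (rule card_poly_roots_bound[OF lagrange_nz])
    also have "\<dots> < CARD('n)" unfolding B_def by (rule degree_lagrange)
    finally show False using w0 by (simp add: card_image)
  qed
  then have fin: "finite {a. poly Q a = 0}" by (rule poly_roots_finite)
  let ?T = "\<Union>a\<in>{a. poly Q a = 0}. {- poly A a / poly B a, - poly (pderiv A) a / poly (pderiv B) a}"
  have "{t. \<exists>w. \<sigma> w = \<sigma> w0 + axis k t \<and> \<not> inj (($) w)} \<subseteq> ?T"
  proof
    fix t assume "t \<in> {t. \<exists>w. \<sigma> w = \<sigma> w0 + axis k t \<and> \<not> inj (($) w)}"
    then obtain w :: "complex ^ 'n" where w: "\<sigma> w = \<sigma> w0 + axis k t" "\<not> inj (($) w)" by blast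
    then obtain i j where ij: "i \<noteq> j" "w $ i = w $ j" by (auto simp: inj_def)
    define a where "a = w $ i"
    define S where "S = (\<Prod>l\<in>UNIV - {i} - {j}. [:- w $ l, 1:])"
    have P: "root_poly w = A + smult t B" unfolding root_poly_eq A_def B_def w(1) monic_of_line by simp
    have "root_poly w = [:- w $ i, 1:] * (\<Prod>l\<in>UNIV - {i}. [:- w $ l, 1:])"
      unfolding root_poly_def by (rule prod.remove) auto
    also have "(\<Prod>l\<in>UNIV - {i}. [:- w $ l, 1:]) = [:- w $ j, 1:] * S"
      unfolding S_def by (rule prod.remove) (use ij in auto)
    finally have dbl: "A + smult t B = [:- a, 1:] * ([:- a, 1:] * S)" using P ij by (simp add: a_def)
    have 1: "poly A a + t * poly B a = 0" using arg_cong[OF dbl, of "\<lambda>p. poly p a"] by simp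
    have "poly (pderiv ([:- a, 1:] * ([:- a, 1:] * S))) a = 0" unfolding pderiv_mult by simp
    then have 2: "poly (pderiv A) a + t * poly (pderiv B) a = 0"
      unfolding dbl[symmetric] by (simp add: pderiv_add pderiv_smult)
    have A: "poly A a = - t * poly B a" "poly (pderiv A) a = - t * poly (pderiv B) a"
      using 1 2 by (simp_all add: add_eq_0_iff2)
    have "poly Q a = 0" by (simp add: Q_def A)
    moreover have "t = - poly A a / poly B a \<or> t = - poly (pderiv A) a / poly (pderiv B) a"
    proof (cases "poly B a = 0")
      case True
      then have "poly A a = 0" using A by simp
      then have "poly (pderiv A) a \<noteq> 0" by (rule simple)
      then show ?thesis using A(2) by (intro disjI2) simp
    next
      case False
      then show ?thesis using A by simp
    qed
    ultimately show "t \<in> ?T" by blast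
  qed
  moreover have "finite ?T" using fin by blast
  ultimately show ?thesis by (rule finite_subset)
qed

lemma continuous_of_pullback:
  assumes E: "open E" and hol: "holomorphic_fun_on (\<lambda>w. h (\<sigma> w)) (\<sigma> -` E)"
  shows "continuous_on E h"
  unfolding continuous_on_open_vimage[OF E]
proof (intro allI impI)
  fix B :: "complex set" assume B: "open B"
  have oE: "open (\<sigma> -` E)" using E continuous_\<sigma>[of UNIV] by (intro open_vimage) auto
  have "continuous_on (\<sigma> -` E) (\<lambda>w. h (\<sigma> w))"
    using hol unfolding holomorphic_fun_on_iff by (intro continuous_at_imp_continuous_on ballI cdiff_isCont) auto
  then have "open ((\<lambda>w. h (\<sigma> w)) -` B \<inter> \<sigma> -` E)"
    using B continuous_on_open_vimage[OF oE] by blast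
  then have "open (\<sigma> ` ((\<lambda>w. h (\<sigma> w)) -` B \<inter> \<sigma> -` E))" by (rule open_\<sigma>_image)
  also have "\<sigma> ` ((\<lambda>w. h (\<sigma> w)) -` B \<inter> \<sigma> -` E) = h -` B \<inter> E"
  proof (intro equalityI subsetI)
    fix s assume s: "s \<in> h -` B \<inter> E"
    obtain w where "\<sigma> w = s" using \<sigma>_surj by blast
    then show "s \<in> \<sigma> ` ((\<lambda>w. h (\<sigma> w)) -` B \<inter> \<sigma> -` E)" using s by (intro image_eqI[of _ _ w]) auto
  qed auto
  finally show "open (h -` B \<inter> E)" .
qed

text \<open>On a coordinate line that contains a polynomial with simple roots, all but finitely many
  parameters have simple roots. There the roots are differentiable functions of the parameter, and
  continuity removes the remaining singularities.\<close>

lemma holomorphic_on_good_line: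
  fixes w0 :: "complex ^ 'n"
  assumes E: "open E" and hol: "holomorphic_fun_on (\<lambda>w. h (\<sigma> w)) (\<sigma> -` E)"
    and w0: "inj (($) w0)" and O: "open U" "\<And>t. t \<in> U \<Longrightarrow> \<sigma> w0 + axis k t \<in> E"
  shows "(\<lambda>t. h (\<sigma> w0 + axis k t)) holomorphic_on U"
proof -
  let ?f = "\<lambda>t. h (\<sigma> w0 + axis k t)"
  let ?K = "{t. \<exists>w. \<sigma> w = \<sigma> w0 + axis k t \<and> \<not> inj (($) w)}"
  have fin: "finite ?K" by (rule finitely_many_multiple_roots[OF w0])
  have line: "isCont (\<lambda>t. \<sigma> w0 + axis k t) t" for t
  proof -
    have "bounded_linear (axis k :: complex \<Rightarrow> complex ^ 'n)"
      unfolding linear_conv_bounded_linear[symmetric] by (rule linearI) (auto simp: vec_eq_iff axis_def)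
    then show ?thesis by (intro continuous_intros) (rule bounded_linear.isCont, auto)
  qed
  have cont: "isCont ?f t" if "t \<in> U" for t
  proof -
    have "isCont h (\<sigma> w0 + axis k t)"
      using continuous_of_pullback[OF E hol] O(2)[OF that] E continuous_on_eq_continuous_at by blast
    then show ?thesis using isCont_o2[OF line] by blast
  qed
  have "?f holomorphic_on (U - ?K)"
    unfolding holomorphic_on_def
  proof
    fix t1 assume t1: "t1 \<in> U - ?K"
    obtain w1 where w1: "\<sigma> w1 = \<sigma> w0 + axis k t1" using \<sigma>_surj by blast
    obtain w where w: "\<And>t. \<sigma> (w t) = \<sigma> w0 + axis k t" "w t1 = w1" "isCont w t1"
      using continuous_root_selection[OF line w1] by blast
    have simple: "inj (($) (w t1))" using t1 w(1)[of t1] by blast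
    obtain v where v: "\<And>i. ((\<lambda>t. w t $ i) has_field_derivative v i) (at t1)"
      using simple_roots_differentiable[OF w(1,3) simple] by metis
    have "complex_differentiable_at (\<lambda>w. h (\<sigma> w)) (w t1)"
      using hol O(2) t1 w(1)[of t1] unfolding holomorphic_fun_on_iff by auto
    then have "\<exists>D. ((\<lambda>t. h (\<sigma> (w t))) has_field_derivative D) (at t1)"
      by (rule has_field_derivative_along_curve[where s = w and v = "\<chi> i. v i" and t = t1
            and h = "\<lambda>w. h (\<sigma> w)", rotated]) (simp add: v)
    then show "?f field_differentiable at t1 within U - ?K"
      unfolding w(1) field_differentiable_def by (blast intro: has_field_derivative_at_within)
  qed
  moreover have "(?f \<longlongrightarrow> ?f t) (at t within U)" if "t \<in> U" for t
    using cont[OF that] unfolding isCont_def by (rule tendsto_within_subset) simp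
  ultimately show ?thesis
    using no_isolated_singularity'[of "?K \<inter> U" ?f U] O(1) fin by (auto simp: Diff_Int)
qed

text \<open>By Osgood's lemma it suffices to consider coordinate lines. A line all of whose polynomials have
  multiple roots is a limit of parallel lines through polynomials with simple roots, and locally
  uniform limits of holomorphic functions are holomorphic.\<close>

theorem holomorphic_of_pullback:
  assumes E: "open E" and hol: "holomorphic_fun_on (\<lambda>w. h (\<sigma> w)) (\<sigma> -` E)"
  shows "holomorphic_fun_on h E"
proof (rule osgood[OF E continuous_of_pullback[OF E hol]])
  fix s k assume s: "s \<in> E"
  obtain r0 where r0: "r0 > 0" "cball s r0 \<subseteq> E" using E s by (meson open_contains_cball)
  define r where "r = r0 / 2"
  have r: "r > 0" "2 * r = r0" using r0 by (simp_all add: r_def)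
  obtain w where w: "\<sigma> w = s" using \<sigma>_surj by blast
  have "\<exists>u :: complex ^ 'n. inj (($) u) \<and> dist (\<sigma> u) s < e" if e: "e > 0" for e
  proof -
    have "isCont \<sigma> w" using continuous_\<sigma>[of UNIV] by (simp add: continuous_on_eq_continuous_at)
    then obtain d where d: "d > 0" "\<And>u. dist u w < d \<Longrightarrow> dist (\<sigma> u) (\<sigma> w) < e"
      using e unfolding continuous_at_eps_delta by blast
    \<comment> \<open>Moving the roots in the direction of the distinct nodes separates them for all but finitely many \<open>x\<close>.\<close>
    have "\<exists>x\<in>{0<..<1::real}. inj (\<lambda>i. w $ i + of_real (x * d / (1 + norm (\<chi> i. \<tau> i))) * \<tau> i)"
    proof -
      define q where "q = d / (1 + norm (\<chi> i. \<tau> i))"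
      have q: "q > 0" using d(1) by (simp add: q_def add_pos_nonneg)
      let ?bad = "\<Union>(i, j)\<in>UNIV. {x. i \<noteq> j \<and> w $ i + of_real (x * q) * \<tau> i = w $ j + of_real (x * q) * \<tau> j}"
      have "finite {x. i \<noteq> j \<and> w $ i + of_real (x * q) * \<tau> i = w $ j + of_real (x * q) * \<tau> j}" for i j
      proof (cases "i = j")
        case False
        then have "\<tau> i - \<tau> j \<noteq> 0" using inj by (auto simp: inj_eq)
        have "x = Re ((w $ j - w $ i) / (\<tau> i - \<tau> j)) / q"
          if "w $ i + of_real (x * q) * \<tau> i = w $ j + of_real (x * q) * \<tau> j" for x
        proof -
          have "of_real (x * q) * (\<tau> i - \<tau> j) = w $ j - w $ i" using that by (simp add: algebra_simps)
          then have "of_real (x * q) = (w $ j - w $ i) / (\<tau> i - \<tau> j)"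
            using \<open>\<tau> i - \<tau> j \<noteq> 0\<close> by (simp add: eq_divide_eq)
          then have "x * q = Re ((w $ j - w $ i) / (\<tau> i - \<tau> j))" by (metis Re_complex_of_real)
          then show ?thesis using q by (simp add: eq_divide_eq)
        qed
        then have "{x. i \<noteq> j \<and> w $ i + of_real (x * q) * \<tau> i = w $ j + of_real (x * q) * \<tau> j}
            \<subseteq> {Re ((w $ j - w $ i) / (\<tau> i - \<tau> j)) / q}" by blast
        then show ?thesis using finite_subset by blast
      qed simp
      then have "finite ?bad" by auto
      have "\<not> {0<..<1} \<subseteq> ?bad"
      proof
        assume "{0<..<1} \<subseteq> ?bad"
        then have "finite {0<..<1::real}" using \<open>finite ?bad\<close> by (rule finite_subset)
        then show False using infinite_Ioo[of 0 "1::real"] by simp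
      qed
      then obtain x where "x \<in> {0<..<1}" "x \<notin> ?bad" by blast
      then show ?thesis unfolding q_def by (intro bexI[of _ x]) (auto simp: inj_def)
    qed
    then obtain x :: real where x: "0 < x" "x < 1"
      and inju: "inj (\<lambda>i. w $ i + of_real (x * d / (1 + norm (\<chi> i. \<tau> i))) * \<tau> i)" by auto
    define u where "u = w + of_real (x * d / (1 + norm (\<chi> i. \<tau> i))) *s (\<chi> i. \<tau> i)"
    have "dist u w = norm ((x * d / (1 + norm (\<chi> i. \<tau> i))) *\<^sub>R (\<chi> i. \<tau> i))"
      unfolding u_def dist_norm by (intro arg_cong[of _ _ norm]) (simp add: vec_eq_iff, simp add: scaleR_conv_of_real)
    also have "\<dots> = x * d * (norm (\<chi> i. \<tau> i) / (1 + norm (\<chi> i. \<tau> i)))" using x d(1) by simp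
    also have "\<dots> \<le> x * d * 1"
      using x d(1) by (intro mult_left_mono) (auto simp: divide_le_eq add_pos_nonneg)
    also have "\<dots> < d" using x d(1) by simp
    finally have "dist (\<sigma> u) s < e" using d(2) w by simp
    moreover have "(($) u) = (\<lambda>i. w $ i + of_real (x * d / (1 + norm (\<chi> i. \<tau> i))) * \<tau> i)"
      by (simp add: u_def fun_eq_iff)
    ultimately show ?thesis using inju by metis
  qed
  note dense = this
  have "\<exists>u :: complex ^ 'n. inj (($) u) \<and> dist (\<sigma> u) s < min r (1 / Suc j)" for j
    by (rule dense) (use r in simp)
  then have "\<forall>j. \<exists>u :: complex ^ 'n. inj (($) u) \<and> dist (\<sigma> u) s < min r (1 / Suc j)" by blast
  from choice[OF this] obtain u :: "nat \<Rightarrow> complex ^ 'n" where u: "\<And>j. inj (($) (u j))" "\<And>j. dist (\<sigma> (u j)) s < min r (1 / Suc j)" by blast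
  have lim: "(\<lambda>j. \<sigma> (u j)) \<longlonglongrightarrow> s"
  proof (rule metric_LIMSEQ_I)
    fix e :: real assume "e > 0"
    then obtain N where N: "1 / Suc N < e" using nat_approx_posE by blast
    have "dist (\<sigma> (u j)) s < e" if "j \<ge> N" for j
    proof -
      have "1 / Suc j \<le> 1 / Suc N" using that by (simp add: frac_le)
      then show ?thesis using u(2)[of j] N by simp
    qed
    then show "\<exists>N. \<forall>j\<ge>N. dist (\<sigma> (u j)) s < e" by blast
  qed
  have inE: "y + axis k t \<in> cball s r0" if "dist y s \<le> r" "cmod t \<le> r" for y t
  proof -
    have "dist (y + axis k t) s \<le> norm (y - s) + norm (axis k t :: complex ^ 'n)"
      using norm_triangle_ineq[of "y - s" "axis k t"] by (simp add: dist_norm algebra_simps)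
    then show ?thesis using that r by (simp add: dist_norm norm_minus_commute)
  qed
  have "(\<lambda>t. h (s + axis k t)) holomorphic_on ball 0 r"
  proof (rule holomorphic_uniform_sequence[where f = "\<lambda>j t. h (\<sigma> (u j) + axis k t)"])
    show "(\<lambda>t. h (\<sigma> (u j) + axis k t)) holomorphic_on ball 0 r" for j
    proof (rule holomorphic_on_good_line[OF E hol u(1)])
      fix t :: complex assume "t \<in> ball 0 r"
      then show "\<sigma> (u j) + axis k t \<in> E" using inE[of "\<sigma> (u j)" t] u(2)[of j] r0 by (simp add: subset_iff)
    qed simp
    have uc: "uniformly_continuous_on (cball s r0) h"
      using continuous_of_pullback[OF E hol] r0(2) by (intro compact_uniformly_continuous) (auto intro: continuous_on_subset)
    have ul: "uniform_limit (ball 0 r) (\<lambda>j t. h (\<sigma> (u j) + axis k t)) (\<lambda>t. h (s + axis k t)) sequentially"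
    proof (rule uniform_limitI)
      fix e :: real assume "e > 0"
      then obtain d where d: "d > 0" "\<And>x y. x \<in> cball s r0 \<Longrightarrow> y \<in> cball s r0 \<Longrightarrow> dist y x < d \<Longrightarrow> dist (h y) (h x) < e"
        using uc unfolding uniformly_continuous_on_def by metis
      have "\<forall>\<^sub>F j in sequentially. dist (\<sigma> (u j)) s < d" using lim d(1) by (rule tendstoD)
      then show "\<forall>\<^sub>F j in sequentially. \<forall>t\<in>ball 0 r. dist (h (\<sigma> (u j) + axis k t)) (h (s + axis k t)) < e"
      proof eventually_elim
        case (elim j)
        show ?case
        proof
          fix t :: complex assume t: "t \<in> ball 0 r"
          have "dist (\<sigma> (u j)) s \<le> r" using u(2)[of j] by simp
          then show "dist (h (\<sigma> (u j) + axis k t)) (h (s + axis k t)) < e"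
            using t elim r by (intro d(2) inE) auto
        qed
      qed
    qed
    show "\<exists>d>0. cball x d \<subseteq> ball 0 r \<and>
        uniform_limit (cball x d) (\<lambda>j t. h (\<sigma> (u j) + axis k t)) (\<lambda>t. h (s + axis k t)) sequentially"
      if "x \<in> ball 0 r" for x
    proof -
      have "\<exists>d>0. cball x d \<subseteq> ball 0 r" using open_contains_cball[of "ball 0 r"] \<open>x \<in> ball 0 r\<close> open_ball by blast
      then obtain d where "d > 0" "cball x d \<subseteq> ball 0 r" by blast
      then show ?thesis using uniform_limit_on_subset[OF ul] by blast
    qed
  qed simp
  then show "(\<lambda>t. h (s + axis k t)) field_differentiable at 0"
    using r(1) by (simp add: holomorphic_on_imp_differentiable_at)
qed

end

section \<open>Charts of the symmetric product\<close>

text \<open>An injective holomorphic function on an open subset of the surface, which need not be connected.\<close>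

definition local_coordinate :: "'a topology \<Rightarrow> ('a, complex) chart set \<Rightarrow> 'a set \<Rightarrow> ('a \<Rightarrow> complex) \<Rightarrow> bool" where
  "local_coordinate X A U \<zeta> \<longleftrightarrow> openin X U \<and> inj_on \<zeta> U \<and>
     (\<forall>c\<in>A. (\<zeta> \<circ> chart_inv c) holomorphic_on snd c ` (U \<inter> fst c))"

lemma chart_facts:
  assumes "is_chart T c"
  shows "openin T (fst c)" "fst c \<subseteq> topspace T" "inj_on (snd c) (fst c)"
    "\<And>V. openin T V \<Longrightarrow> open (snd c ` (V \<inter> fst c))"
    "\<And>W. open W \<Longrightarrow> openin T {x \<in> fst c. snd c x \<in> W}"
    "\<And>x. x \<in> fst c \<Longrightarrow> chart_inv c (snd c x) = x"
proof -
  have o: "openin T (fst c)" and oi: "open (chart_image c)"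
    and h: "homeomorphic_map (subtopology T (fst c)) (top_of_set (chart_image c)) (snd c)"
    using assms unfolding is_chart_def by auto
  show "openin T (fst c)" by fact
  show s: "fst c \<subseteq> topspace T" using o by (rule openin_subset)
  have ts: "topspace (subtopology T (fst c)) = fst c" using s by auto
  show inj: "inj_on (snd c) (fst c)" using homeomorphic_imp_injective_map[OF h] unfolding ts .
  show "open (snd c ` (V \<inter> fst c))" if "openin T V" for V
  proof -
    have "openin (subtopology T (fst c)) (V \<inter> fst c)" using that by (auto simp: openin_subtopology)
    then have "openin (top_of_set (chart_image c)) (snd c ` (V \<inter> fst c))"
      using homeomorphic_imp_open_map[OF h] unfolding open_map_def by blast
    then show ?thesis using oi openin_open_trans by blast
  qed
  show "openin T {x \<in> fst c. snd c x \<in> W}" if "open W" for W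
  proof -
    have "openin (top_of_set (chart_image c)) (chart_image c \<inter> W)" using that by (simp add: openin_open_Int)
    then have "openin (subtopology T (fst c)) {x \<in> fst c. snd c x \<in> chart_image c \<inter> W}"
      using openin_continuous_map_preimage[OF homeomorphic_imp_continuous_map[OF h]] unfolding ts by blast
    moreover have "{x \<in> fst c. snd c x \<in> chart_image c \<inter> W} = {x \<in> fst c. snd c x \<in> W}" by auto
    ultimately show ?thesis using o openin_trans_full by metis
  qed
  show "chart_inv c (snd c x) = x" if "x \<in> fst c" for x
    using inv_into_f_f[OF inj that] .
qed

lemma disjoint_neighbourhoods:
  assumes "Hausdorff_space X" "finite Q" "Q \<subseteq> topspace X"
  obtains N where "\<And>q. q \<in> Q \<Longrightarrow> openin X (N q) \<and> q \<in> N q"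
    "\<And>p q. p \<in> Q \<Longrightarrow> q \<in> Q \<Longrightarrow> p \<noteq> q \<Longrightarrow> N p \<inter> N q = {}"
proof -
  have "\<exists>U V. p \<in> Q \<longrightarrow> q \<in> Q \<longrightarrow> p \<noteq> q \<longrightarrow> openin X U \<and> openin X V \<and> p \<in> U \<and> q \<in> V \<and> disjnt U V" for p q
    using assms(1,3) unfolding Hausdorff_space_def by (meson subsetD)
  then obtain U V where UV: "\<And>p q. p \<in> Q \<Longrightarrow> q \<in> Q \<Longrightarrow> p \<noteq> q \<Longrightarrow>
      openin X (U p q) \<and> openin X (V p q) \<and> p \<in> U p q \<and> q \<in> V p q \<and> disjnt (U p q) (V p q)" by metis
  define N where "N p = (\<Inter>q\<in>Q - {p}. U p q \<inter> V q p) \<inter> topspace X" for p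
  show ?thesis
  proof (rule that[of N])
    show "openin X (N q) \<and> q \<in> N q" if q: "q \<in> Q" for q
    proof
      show "q \<in> N q" unfolding N_def using UV q assms(3) by auto
      have "openin X (U q p \<inter> V p q)" if "p \<in> Q - {q}" for p
        using UV[of q p] UV[of p q] that q by (intro openin_Int) auto
      then show "openin X (N q)" unfolding N_def using assms(2) by (intro openin_INT) auto
    qed
    show "N p \<inter> N q = {}" if "p \<in> Q" "q \<in> Q" "p \<noteq> q" for p q
    proof -
      have "N p \<subseteq> U p q" "N q \<subseteq> V p q" unfolding N_def using that by auto
      then show ?thesis using UV[OF that] unfolding disjnt_def by blast
    qed
  qed
qed

context
  fixes X :: "'a topology" and A :: "('a, complex) chart set"
  assumes RS: "riemann_surface X A"
begin

lemma is_chart_A: "c \<in> A \<Longrightarrow> is_chart X c" using RS unfolding riemann_surface_def by blast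

lemma chart_at:
  assumes "x \<in> topspace X" obtains c where "c \<in> A" "x \<in> fst c"
proof -
  have "(\<Union>c\<in>A. fst c) = topspace X" using RS unfolding riemann_surface_def by (elim conjE)
  then have "x \<in> (\<Union>c\<in>A. fst c)" using assms by (simp only:)
  then show ?thesis using that by blast
qed

text \<open>The points of \<open>Q\<close> have disjoint neighbourhoods inside coordinate discs of radius 1.
  The images are moved to centres \<open>3 * b q\<close> for distinct natural numbers
  \<open>b q\<close>, so they are disjoint as well.\<close>

lemma exists_local_coordinate:
  assumes Q: "finite Q" "Q \<subseteq> topspace X"
  obtains U \<zeta> where "local_coordinate X A U \<zeta>" "Q \<subseteq> U"
proof -
  have haus: "Hausdorff_space X" using RS unfolding riemann_surface_def by (elim conjE)
  obtain N where N: "\<And>q. q \<in> Q \<Longrightarrow> openin X (N q) \<and> q \<in> N q"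
    "\<And>p q. p \<in> Q \<Longrightarrow> q \<in> Q \<Longrightarrow> p \<noteq> q \<Longrightarrow> N p \<inter> N q = {}"
    by (rule disjoint_neighbourhoods[OF haus Q]) blast
  have "\<forall>q\<in>Q. \<exists>c. c \<in> A \<and> q \<in> fst c" using Q(2) by (meson chart_at subsetD)
  from bchoice[OF this] obtain c where c: "\<And>q. q \<in> Q \<Longrightarrow> c q \<in> A" "\<And>q. q \<in> Q \<Longrightarrow> q \<in> fst (c q)" by blast
  obtain b :: "'a \<Rightarrow> nat" where b: "inj_on b Q" using finite_imp_inj_to_nat_seg[OF Q(1)] by blast
  define O' where "O' q = N q \<inter> {x \<in> fst (c q). snd (c q) x \<in> ball (snd (c q) q) 1}" for q
  have O_open: "openin X (O' q)" if "q \<in> Q" for q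
    unfolding O'_def using N(1)[OF that] chart_facts(5)[OF is_chart_A[OF c(1)[OF that]], of "ball (snd (c q) q) 1"]
    by (intro openin_Int) auto
  have O_mem: "q \<in> O' q" if "q \<in> Q" for q unfolding O'_def using N(1)[OF that] c(2)[OF that] by simp
  have O_disj: "p = q" if "p \<in> Q" "q \<in> Q" "x \<in> O' p" "x \<in> O' q" for p q x
    using N(2)[OF that(1,2)] that(3,4) unfolding O'_def by blast
  define U where "U = (\<Union>q\<in>Q. O' q)"
  define \<zeta> where "\<zeta> x = (let q = (THE q. q \<in> Q \<and> x \<in> O' q) in snd (c q) x - snd (c q) q + of_nat (3 * b q))" for x
  have \<zeta>: "\<zeta> x = snd (c q) x - snd (c q) q + of_nat (3 * b q)" if "q \<in> Q" "x \<in> O' q" for q x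
  proof -
    have "(THE q. q \<in> Q \<and> x \<in> O' q) = q" using that O_disj by (intro the_equality) auto
    then show ?thesis unfolding \<zeta>_def by (simp add: Let_def)
  qed
  have "local_coordinate X A U \<zeta>"
    unfolding local_coordinate_def
  proof (intro conjI ballI)
    show "openin X U" unfolding U_def using O_open by blast
    show "inj_on \<zeta> U"
    proof (rule inj_onI)
      fix x y assume "x \<in> U" "y \<in> U" and eq: "\<zeta> x = \<zeta> y"
      then obtain p q where pq: "p \<in> Q" "q \<in> Q" "x \<in> O' p" "y \<in> O' q" unfolding U_def by blast
      define u v where "u = snd (c p) x - snd (c p) p" and "v = snd (c q) y - snd (c q) q"
      have uv: "cmod u < 1" "cmod v < 1"
        using pq unfolding O'_def u_def v_def by (auto simp: dist_norm norm_minus_commute)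
      have "of_nat (3 * b p) - of_nat (3 * b q) = v - u"
        using eq unfolding \<zeta>[OF pq(1,3)] \<zeta>[OF pq(2,4)] u_def v_def by (simp add: algebra_simps)
      then have "cmod (of_nat (3 * b p) - of_nat (3 * b q)) \<le> cmod v + cmod u"
        by (simp only: norm_triangle_ineq4)
      moreover have "cmod (of_nat (3 * b p) - of_nat (3 * b q)) = \<bar>real (3 * b p) - real (3 * b q)\<bar>"
        by (metis norm_of_real of_real_diff of_real_of_nat_eq real_norm_def)
      ultimately have "\<bar>real (3 * b p) - real (3 * b q)\<bar> < 2" using uv by linarith
      then have "b p = b q" by linarith
      then have "p = q" using b pq(1,2) by (meson inj_onD)
      then have "snd (c p) x = snd (c p) y" using eq unfolding \<zeta>[OF pq(1,3)] \<zeta>[OF pq(2,4)] by simp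
      moreover have "x \<in> fst (c p)" "y \<in> fst (c p)" using pq \<open>p = q\<close> unfolding O'_def by auto
      ultimately show "x = y" using chart_facts(3)[OF is_chart_A[OF c(1)[OF pq(1)]]] by (meson inj_onD)
    qed
    fix c' assume c': "c' \<in> A"
    note cf = chart_facts[OF is_chart_A[OF c']]
    show "(\<zeta> \<circ> chart_inv c') holomorphic_on snd c' ` (U \<inter> fst c')"
      unfolding holomorphic_on_def
    proof
      fix z assume "z \<in> snd c' ` (U \<inter> fst c')"
      then obtain x q where x: "z = snd c' x" "x \<in> fst c'" "q \<in> Q" "x \<in> O' q" unfolding U_def by blast
      have "transition c' (c q) holomorphic_on snd c' ` (fst c' \<inter> fst (c q))"
        using RS c' c(1)[OF x(3)] unfolding riemann_surface_def by blast
      moreover have "snd c' ` (O' q \<inter> fst c') \<subseteq> snd c' ` (fst c' \<inter> fst (c q))" unfolding O'_def by blast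
      ultimately have "transition c' (c q) holomorphic_on snd c' ` (O' q \<inter> fst c')" by (rule holomorphic_on_subset)
      then have "(\<lambda>z. transition c' (c q) z - snd (c q) q + of_nat (3 * b q)) holomorphic_on snd c' ` (O' q \<inter> fst c')"
        by (intro holomorphic_intros)
      then have "(\<zeta> \<circ> chart_inv c') holomorphic_on snd c' ` (O' q \<inter> fst c')"
      proof (rule holomorphic_transform)
        fix y assume "y \<in> snd c' ` (O' q \<inter> fst c')"
        then obtain u where u: "y = snd c' u" "u \<in> O' q" "u \<in> fst c'" by blast
        then show "transition c' (c q) y - snd (c q) q + of_nat (3 * b q) = (\<zeta> \<circ> chart_inv c') y"
          using cf(6)[OF u(3)] \<zeta>[OF x(3) u(2)] by (simp add: transition_def)
      qed
      then have "(\<zeta> \<circ> chart_inv c') field_differentiable at z"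
        using cf(4)[OF O_open[OF x(3)]] x by (intro holomorphic_on_imp_differentiable_at) auto
      then show "(\<zeta> \<circ> chart_inv c') field_differentiable at z within snd c' ` (U \<inter> fst c')"
        by (rule field_differentiable_at_within)
    qed
  qed
  moreover have "Q \<subseteq> U" unfolding U_def using O_mem by blast
  ultimately show ?thesis by (rule that)
qed

text \<open>A local coordinate is open with holomorphic inverse, because injective holomorphic functions of
  one variable are.\<close>

lemma local_coordinate_facts:
  assumes lc: "local_coordinate X A U \<zeta>"
  shows "openin X U" "U \<subseteq> topspace X" "inj_on \<zeta> U"
    "\<And>V. openin X V \<Longrightarrow> V \<subseteq> U \<Longrightarrow> open (\<zeta> ` V)"
    "\<And>W. open W \<Longrightarrow> openin X {x \<in> U. \<zeta> x \<in> W}"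
    "\<And>c. c \<in> A \<Longrightarrow> (\<zeta> \<circ> chart_inv c) holomorphic_on snd c ` (U \<inter> fst c)"
    "\<And>c. c \<in> A \<Longrightarrow> (snd c \<circ> inv_into U \<zeta>) holomorphic_on \<zeta> ` (U \<inter> fst c)"
    "\<And>x. x \<in> U \<Longrightarrow> inv_into U \<zeta> (\<zeta> x) = x"
proof -
  show oU: "openin X U" and inj: "inj_on \<zeta> U"
    and hol: "\<And>c. c \<in> A \<Longrightarrow> (\<zeta> \<circ> chart_inv c) holomorphic_on snd c ` (U \<inter> fst c)"
    using lc unfolding local_coordinate_def by auto
  show sub: "U \<subseteq> topspace X" using oU by (rule openin_subset)
  show inv: "inv_into U \<zeta> (\<zeta> x) = x" if "x \<in> U" for x using inv_into_f_f[OF inj that] .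
  have img: "\<zeta> ` (V \<inter> fst c) = (\<zeta> \<circ> chart_inv c) ` (snd c ` (V \<inter> fst c))" if "c \<in> A" for V c
    using chart_facts(6)[OF is_chart_A[OF that]] by (force simp: image_image)
  have injc: "inj_on (\<zeta> \<circ> chart_inv c) (snd c ` (V \<inter> fst c))" if "c \<in> A" "V \<subseteq> U" for V c
    using chart_facts(6)[OF is_chart_A[OF that(1)]] inj that(2) by (auto simp: inj_on_def)
  show "open (\<zeta> ` V)" if V: "openin X V" "V \<subseteq> U" for V
  proof -
    have "open (\<zeta> ` (V \<inter> fst c))" if c: "c \<in> A" for c
      unfolding img[OF c]
    proof (rule open_mapping_thm3)
      show "(\<zeta> \<circ> chart_inv c) holomorphic_on snd c ` (V \<inter> fst c)"
        using hol[OF c] by (rule holomorphic_on_subset) (use V in blast)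
      show "open (snd c ` (V \<inter> fst c))" using chart_facts(4)[OF is_chart_A[OF c] V(1)] .
      show "inj_on (\<zeta> \<circ> chart_inv c) (snd c ` (V \<inter> fst c))" using injc c V(2) by blast
    qed
    then have "open (\<Union>c\<in>A. \<zeta> ` (V \<inter> fst c))" by blast
    moreover have "(\<Union>c\<in>A. \<zeta> ` (V \<inter> fst c)) = \<zeta> ` V"
      using V(2) sub chart_at by (auto, metis IntI image_eqI subsetD)
    ultimately show ?thesis by simp
  qed
  show "openin X {x \<in> U. \<zeta> x \<in> W}" if W: "open W" for W
  proof -
    have "openin X {x \<in> U \<inter> fst c. \<zeta> x \<in> W}" if c: "c \<in> A" for c
    proof -
      note cf = chart_facts[OF is_chart_A[OF c]]
      have oS: "open (snd c ` (U \<inter> fst c))" by (rule cf(4)[OF oU])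
      have "open ((\<zeta> \<circ> chart_inv c) -` W \<inter> snd c ` (U \<inter> fst c))"
        using holomorphic_on_imp_continuous_on[OF hol[OF c]] W continuous_on_open_vimage[OF oS] by blast
      from openin_Int[OF oU cf(5)[OF this]] show ?thesis
      proof (rule back_subst[of "openin X"])
        show "U \<inter> {x \<in> fst c. snd c x \<in> (\<zeta> \<circ> chart_inv c) -` W \<inter> snd c ` (U \<inter> fst c)} = {x \<in> U \<inter> fst c. \<zeta> x \<in> W}"
        proof (intro equalityI subsetI)
          fix x assume x: "x \<in> U \<inter> {x \<in> fst c. snd c x \<in> (\<zeta> \<circ> chart_inv c) -` W \<inter> snd c ` (U \<inter> fst c)}"
          then have "\<zeta> (chart_inv c (snd c x)) \<in> W" by simp
          then show "x \<in> {x \<in> U \<inter> fst c. \<zeta> x \<in> W}" using x cf(6)[of x] by simp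
        next
          fix x assume x: "x \<in> {x \<in> U \<inter> fst c. \<zeta> x \<in> W}"
          then have "chart_inv c (snd c x) = x" by (intro cf(6)) simp
          then show "x \<in> U \<inter> {x \<in> fst c. snd c x \<in> (\<zeta> \<circ> chart_inv c) -` W \<inter> snd c ` (U \<inter> fst c)}"
            using x by simp
        qed
      qed
    qed
    then have "openin X (\<Union>c\<in>A. {x \<in> U \<inter> fst c. \<zeta> x \<in> W})" by blast
    moreover have "(\<Union>c\<in>A. {x \<in> U \<inter> fst c. \<zeta> x \<in> W}) = {x \<in> U. \<zeta> x \<in> W}"
      using sub chart_at by (auto, metis subsetD)
    ultimately show ?thesis by simp
  qed
  show "(snd c \<circ> inv_into U \<zeta>) holomorphic_on \<zeta> ` (U \<inter> fst c)" if c: "c \<in> A" for c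
  proof -
    note cf = chart_facts[OF is_chart_A[OF c]]
    obtain g where g: "g holomorphic_on (\<zeta> \<circ> chart_inv c) ` (snd c ` (U \<inter> fst c))"
      "\<And>z. z \<in> snd c ` (U \<inter> fst c) \<Longrightarrow> g ((\<zeta> \<circ> chart_inv c) z) = z"
      using holomorphic_has_inverse[OF hol[OF c] cf(4)[OF oU] injc[OF c order_refl]] by metis
    show ?thesis
      using g(1)[folded img[OF c]]
    proof (rule holomorphic_transform)
      fix w assume "w \<in> \<zeta> ` (U \<inter> fst c)"
      then obtain x where x: "w = \<zeta> x" "x \<in> U" "x \<in> fst c" by blast
      then show "g w = (snd c \<circ> inv_into U \<zeta>) w" using g(2)[of "snd c x"] cf(6)[OF x(3)] inv[OF x(2)] by auto
    qed
  qed
qed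

end

lemma sym_orbit_self: "p \<in> sym_orbit p"
  unfolding sym_orbit_def using permutes_id[of UNIV] by (intro CollectI exI[of _ id]) simp

lemma sym_orbit_eq_iff: "sym_orbit p = sym_orbit p' \<longleftrightarrow> (\<exists>\<pi>. \<pi> permutes UNIV \<and> p' = p \<circ> \<pi>)"
proof
  assume "sym_orbit p = sym_orbit p'"
  then have "p' \<in> sym_orbit p" using sym_orbit_self by metis
  then show "\<exists>\<pi>. \<pi> permutes UNIV \<and> p' = p \<circ> \<pi>" unfolding sym_orbit_def by blast
next
  have sub: "sym_orbit (q \<circ> \<pi>) \<subseteq> sym_orbit q" if "\<pi> permutes UNIV" for q :: "'c \<Rightarrow> 'd" and \<pi>
    unfolding sym_orbit_def using permutes_compose[OF _ that] by (fastforce simp: comp_assoc)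
  assume "\<exists>\<pi>. \<pi> permutes UNIV \<and> p' = p \<circ> \<pi>"
  then obtain \<pi> where \<pi>: "\<pi> permutes UNIV" "p' = p \<circ> \<pi>" by blast
  have "p = p' \<circ> inv \<pi>" unfolding \<pi>(2) comp_assoc using permutes_inv_o(1)[OF \<pi>(1)] by simp
  then show "sym_orbit p = sym_orbit p'"
    using sub[OF \<pi>(1), of p] sub[OF permutes_inv[OF \<pi>(1)], of p'] \<pi>(2) by auto
qed

lemma topspace_power: "p \<in> topspace (power_space X) \<longleftrightarrow> (\<forall>i. p i \<in> topspace X)"
  by (auto simp: PiE_iff)

text \<open>Openness by boxes, in the form in which openness in \<open>\<complex>^n\<close> is defined.\<close>

lemma openin_power_iff:
  fixes P :: "('n::finite \<Rightarrow> 'a) set"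
  shows "openin (power_space X) P \<longleftrightarrow>
    (\<forall>p\<in>P. \<exists>B. (\<forall>i. openin X (B i) \<and> p i \<in> B i) \<and> (\<forall>q. (\<forall>i. q i \<in> B i) \<longrightarrow> q \<in> P))"
  unfolding openin_product_topology_alt
proof (intro ball_cong refl ex_cong1)
  fix p and B :: "'n \<Rightarrow> 'a set"
  have "Pi\<^sub>E UNIV B = {q. \<forall>i. q i \<in> B i}" by (auto simp: PiE_iff)
  then show "(finite {i \<in> UNIV. B i \<noteq> topspace X} \<and> (\<forall>i\<in>UNIV. openin X (B i)) \<and> p \<in> Pi\<^sub>E UNIV B \<and> Pi\<^sub>E UNIV B \<subseteq> P)
      = ((\<forall>i. openin X (B i) \<and> p i \<in> B i) \<and> (\<forall>q. (\<forall>i. q i \<in> B i) \<longrightarrow> q \<in> P))" by auto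
qed

lemma openin_powerE:
  fixes P :: "('n::finite \<Rightarrow> 'a) set"
  assumes "openin (power_space X) P" "p \<in> P"
  obtains B where "\<And>i. openin X (B i) \<and> p i \<in> B i" "\<And>q. (\<forall>i. q i \<in> B i) \<Longrightarrow> q \<in> P"
  using bspec[OF assms(1)[unfolded openin_power_iff] assms(2)] that by metis

lemma open_vecE:
  fixes W :: "(complex ^ 'n::finite) set" and x :: "complex ^ 'n"
  assumes "open W" "x \<in> W"
  obtains A where "\<And>i. open (A i) \<and> x $ i \<in> A i" "\<And>y. (\<forall>i. y $ i \<in> A i) \<Longrightarrow> y \<in> W"
  using bspec[OF assms(1)[unfolded open_vec_def] assms(2)] that by metis

locale sym_charts = interpolation_nodes \<tau> for \<tau> :: "'n::finite \<Rightarrow> complex" +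
  fixes X :: "'a topology" and A :: "('a, complex) chart set"
  assumes RS: "riemann_surface X A"
begin

abbreviation XX :: "('n \<Rightarrow> 'a) topology" where "XX \<equiv> power_space X"

definition coords :: "('a \<Rightarrow> complex) \<Rightarrow> ('n \<Rightarrow> 'a) \<Rightarrow> complex ^ 'n" where
  "coords \<zeta> p = (\<chi> i. \<zeta> (p i))"

text \<open>The orbit of \<open>p\<close> is sent to \<open>\<sigma> (coords \<zeta> p)\<close>; since
  \<open>\<sigma>\<close> is symmetric, this does not depend on the chosen representative
  (\<open>sym_chart_orbit\<close>).\<close>

definition sym_chart :: "'a set \<Rightarrow> ('a \<Rightarrow> complex) \<Rightarrow> (('n \<Rightarrow> 'a) set, complex ^ 'n) chart" where
  "sym_chart U \<zeta> = (sym_orbit ` {p. \<forall>i. p i \<in> U}, \<lambda>o'. \<sigma> (coords \<zeta> (SOME p. p \<in> o')))"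

lemma sym_chart_orbit: "snd (sym_chart U \<zeta>) (sym_orbit p) = \<sigma> (coords \<zeta> p)"
proof -
  have "(SOME p'. p' \<in> sym_orbit p) \<in> sym_orbit p" by (rule someI[of "\<lambda>p'. p' \<in> sym_orbit p", OF sym_orbit_self])
  then obtain \<pi> where \<pi>: "\<pi> permutes UNIV" "(SOME p'. p' \<in> sym_orbit p) = p \<circ> \<pi>" unfolding sym_orbit_def by blast
  show ?thesis using \<sigma>_permute[OF \<pi>(1), of "coords \<zeta> p"] unfolding sym_chart_def snd_conv \<pi>(2) by (simp add: coords_def)
qed

lemma mem_sym_chart: "sym_orbit p \<in> fst (sym_chart U \<zeta>) \<longleftrightarrow> (\<forall>i. p i \<in> U)"
proof
  assume "sym_orbit p \<in> fst (sym_chart U \<zeta>)"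
  then obtain p' where p': "sym_orbit p = sym_orbit p'" "\<forall>i. p' i \<in> U" unfolding sym_chart_def by auto
  then obtain \<pi> where \<pi>: "\<pi> permutes UNIV" "p' = p \<circ> \<pi>" unfolding sym_orbit_eq_iff by blast
  show "\<forall>i. p i \<in> U"
  proof
    fix i
    obtain j where "i = \<pi> j" using permutes_surj[OF \<pi>(1)] by (meson surjD)
    then show "p i \<in> U" using p'(2) \<pi>(2) by auto
  qed
qed (auto simp: sym_chart_def)

lemma fst_sym_chart: "fst (sym_chart U \<zeta>) = sym_orbit ` {p. \<forall>i. p i \<in> U}"
  unfolding sym_chart_def by simp

lemma open_chart_box:
  assumes c: "\<And>i. c i \<in> A" and S: "openin XX S"
  shows "open {z :: complex ^ 'n. (\<forall>i. z $ i \<in> chart_image (c i)) \<and> (\<lambda>i. chart_inv (c i) (z $ i)) \<in> S}" (is "open ?S")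
  unfolding open_vec_def
proof
  fix z assume z: "z \<in> ?S"
  then have pS: "(\<lambda>i. chart_inv (c i) (z $ i)) \<in> S" by simp
  obtain B where B: "\<And>i. openin X (B i) \<and> chart_inv (c i) (z $ i) \<in> B i" "\<And>q. (\<forall>i. q i \<in> B i) \<Longrightarrow> q \<in> S"
    by (rule openin_powerE[OF S pS]) blast
  note cf = chart_facts[OF is_chart_A[OF RS c]]
  show "\<exists>A. (\<forall>i. open (A i) \<and> z $ i \<in> A i) \<and> (\<forall>y. (\<forall>i. y $ i \<in> A i) \<longrightarrow> y \<in> ?S)"
  proof (intro exI[of _ "\<lambda>i. snd (c i) ` (B i \<inter> fst (c i))"] conjI allI impI)
    fix i
    show "open (snd (c i) ` (B i \<inter> fst (c i)))" using cf(4) B(1) by blast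
    obtain x where "x \<in> fst (c i)" "z $ i = snd (c i) x" using z by blast
    then show "z $ i \<in> snd (c i) ` (B i \<inter> fst (c i))" using B(1)[of i] cf(6)[of x i] by auto
  next
    fix y assume y: "\<forall>i. y $ i \<in> snd (c i) ` (B i \<inter> fst (c i))"
    have "chart_inv (c i) (y $ i) \<in> B i \<and> y $ i \<in> chart_image (c i)" for i
    proof -
      obtain x where "x \<in> B i" "x \<in> fst (c i)" "y $ i = snd (c i) x" using y by blast
      then show ?thesis using cf(6)[of x i] by simp
    qed
    then show "y \<in> ?S" using B(2)[of "\<lambda>i. chart_inv (c i) (y $ i)"] by simp
  qed
qed

context
  fixes U :: "'a set" and \<zeta> :: "'a \<Rightarrow> complex"
  assumes lc: "local_coordinate X A U \<zeta>"
begin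

lemmas lcf = local_coordinate_facts[OF RS lc]

lemma open_coords_image:
  assumes P: "openin XX P" and sub: "P \<subseteq> {p. \<forall>i. p i \<in> U}"
  shows "open (coords \<zeta> ` P)"
  unfolding open_vec_def
proof
  fix x assume "x \<in> coords \<zeta> ` P"
  then obtain p where p: "p \<in> P" "x = coords \<zeta> p" by blast
  obtain B where B: "\<And>i. openin X (B i) \<and> p i \<in> B i" "\<And>q. (\<forall>i. q i \<in> B i) \<Longrightarrow> q \<in> P"
    by (rule openin_powerE[OF P p(1)]) blast
  show "\<exists>A. (\<forall>i. open (A i) \<and> x $ i \<in> A i) \<and> (\<forall>y. (\<forall>i. y $ i \<in> A i) \<longrightarrow> y \<in> coords \<zeta> ` P)"
  proof (intro exI[of _ "\<lambda>i. \<zeta> ` (B i \<inter> U)"] conjI allI impI)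
    fix i
    show "open (\<zeta> ` (B i \<inter> U))" using B(1) lcf(1) by (intro lcf(4)) auto
    show "x $ i \<in> \<zeta> ` (B i \<inter> U)" using p sub B(1)[of i] by (auto simp: coords_def)
  next
    fix y assume "\<forall>i. y $ i \<in> \<zeta> ` (B i \<inter> U)"
    then have "\<forall>i. \<exists>q. q \<in> B i \<and> y $ i = \<zeta> q" by blast
    from choice[OF this] obtain q where "\<And>i. q i \<in> B i" "\<And>i. y $ i = \<zeta> (q i)" by blast
    then show "y \<in> coords \<zeta> ` P" using B(2) by (intro image_eqI[of _ _ q]) (auto simp: coords_def vec_eq_iff)
  qed
qed

lemma openin_coords_vimage:
  assumes W: "open W"
  shows "openin XX {p. (\<forall>i. p i \<in> U) \<and> coords \<zeta> p \<in> W}"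
  unfolding openin_power_iff
proof
  fix p assume p: "p \<in> {p. (\<forall>i. p i \<in> U) \<and> coords \<zeta> p \<in> W}"
  then have pW: "coords \<zeta> p \<in> W" by simp
  obtain A where A: "\<And>i. open (A i) \<and> coords \<zeta> p $ i \<in> A i" "\<And>y. (\<forall>i. y $ i \<in> A i) \<Longrightarrow> y \<in> W"
    by (rule open_vecE[OF W pW]) blast
  show "\<exists>B. (\<forall>i. openin X (B i) \<and> p i \<in> B i) \<and> (\<forall>q. (\<forall>i. q i \<in> B i) \<longrightarrow> q \<in> {p. (\<forall>i. p i \<in> U) \<and> coords \<zeta> p \<in> W})"
  proof (intro exI[of _ "\<lambda>i. {x \<in> U. \<zeta> x \<in> A i}"] conjI allI impI)
    show "openin X {x \<in> U. \<zeta> x \<in> A i}" for i using A(1) lcf(5) by blast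
    show "p i \<in> {x \<in> U. \<zeta> x \<in> A i}" for i using p A(1)[of i] by (simp add: coords_def)
    show "q \<in> {p. (\<forall>i. p i \<in> U) \<and> coords \<zeta> p \<in> W}" if "\<forall>i. q i \<in> {x \<in> U. \<zeta> x \<in> A i}" for q
      using that A(2)[of "coords \<zeta> q"] by (simp add: coords_def)
  qed
qed

lemma chart_image_sym_chart: "chart_image (sym_chart U \<zeta>) = \<sigma> ` coords \<zeta> ` {p. \<forall>i. p i \<in> U}"
  unfolding fst_sym_chart by (auto simp: sym_chart_orbit image_image)

lemma coords_image: "coords \<zeta> ` {p. \<forall>i. p i \<in> U} = {w. \<forall>i. w $ i \<in> \<zeta> ` U}"
proof (intro equalityI subsetI)
  fix w :: "complex ^ 'n" assume "w \<in> {w. \<forall>i. w $ i \<in> \<zeta> ` U}"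
  then have "\<forall>i. \<exists>q. q \<in> U \<and> w $ i = \<zeta> q" by blast
  from choice[OF this] obtain q where "\<And>i. q i \<in> U" "\<And>i. w $ i = \<zeta> (q i)" by blast
  then show "w \<in> coords \<zeta> ` {p. \<forall>i. p i \<in> U}" by (intro image_eqI[of _ _ q]) (auto simp: coords_def vec_eq_iff)
qed (auto simp: coords_def)

lemma openin_UN: "openin XX {p. \<forall>i. p i \<in> U}"
  using openin_coords_vimage[of UNIV] by simp

lemma UN_sub: "(\<forall>i. p i \<in> U) \<Longrightarrow> p \<in> topspace XX"
  using lcf(2) by (auto simp: topspace_power)

lemma vimage_eq: "{p \<in> topspace XX. sym_orbit p \<in> fst (sym_chart U \<zeta>) \<and> snd (sym_chart U \<zeta>) (sym_orbit p) \<in> E}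
    = {p. (\<forall>i. p i \<in> U) \<and> \<sigma> (coords \<zeta> p) \<in> E}"
  using UN_sub by (auto simp: mem_sym_chart sym_chart_orbit)

lemma is_chart_sym_chart: "is_chart (sym_product X) (sym_chart U \<zeta>)"
  unfolding is_chart_def
proof (intro conjI)
  let ?N = "fst (sym_chart U \<zeta>)" and ?k = "snd (sym_chart U \<zeta>)"
  have sub: "?N \<subseteq> sym_orbit ` topspace XX" unfolding fst_sym_chart using UN_sub by blast
  have "{p \<in> topspace XX. sym_orbit p \<in> ?N} = {p. \<forall>i. p i \<in> U}" using UN_sub by (auto simp: mem_sym_chart)
  then show oN: "openin (sym_product X) ?N" unfolding openin_sym_product using sub openin_UN by simp
  show oI: "open (chart_image (sym_chart U \<zeta>))"
    unfolding chart_image_sym_chart by (intro open_\<sigma>_image open_coords_image openin_UN) simp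
  have ts: "topspace (subtopology (sym_product X) ?N) = ?N"
    using sub by (auto simp: topspace_sym_product)
  show "homeomorphic_map (subtopology (sym_product X) ?N) (top_of_set (chart_image (sym_chart U \<zeta>))) ?k"
  proof (rule bijective_open_imp_homeomorphic_map)
    show "continuous_map (subtopology (sym_product X) ?N) (top_of_set (chart_image (sym_chart U \<zeta>))) ?k"
      unfolding continuous_map_def ts
    proof (intro conjI allI impI)
      fix W assume "openin (top_of_set (chart_image (sym_chart U \<zeta>))) W"
      then have W: "open W" using oI openin_open_trans by blast
      have "openin (sym_product X) {x \<in> ?N. ?k x \<in> W}"
        unfolding openin_sym_product
      proof
        show "{x \<in> ?N. ?k x \<in> W} \<subseteq> sym_orbit ` topspace XX" using sub by blast
        have "{p \<in> topspace XX. sym_orbit p \<in> {x \<in> ?N. ?k x \<in> W}} = {p. (\<forall>i. p i \<in> U) \<and> coords \<zeta> p \<in> \<sigma> -` W}"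
          using UN_sub by (auto simp: mem_sym_chart sym_chart_orbit)
        moreover have "open (\<sigma> -` W)" using W continuous_\<sigma>[of UNIV] by (intro open_vimage) auto
        ultimately show "openin XX {p \<in> topspace XX. sym_orbit p \<in> {x \<in> ?N. ?k x \<in> W}}"
          using openin_coords_vimage[of "\<sigma> -` W"] by (simp only:)
      qed
      then show "openin (subtopology (sym_product X) ?N) {x \<in> ?N. ?k x \<in> W}"
        by (simp add: openin_open_subtopology[OF oN] subset_iff)
    qed (auto)
    show "open_map (subtopology (sym_product X) ?N) (top_of_set (chart_image (sym_chart U \<zeta>))) ?k"
      unfolding open_map_def
    proof (intro allI impI)
      fix T assume "openin (subtopology (sym_product X) ?N) T"
      then have T: "openin (sym_product X) T" "T \<subseteq> ?N"
        using oN by (auto simp: openin_open_subtopology)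
      let ?P = "{p \<in> topspace XX. sym_orbit p \<in> T}"
      have P: "openin XX ?P" using T(1) unfolding openin_sym_product by blast
      have PU: "?P \<subseteq> {p. \<forall>i. p i \<in> U}" using T(2) mem_sym_chart by blast
      have "?k ` T = \<sigma> ` coords \<zeta> ` ?P"
      proof -
        have "T = sym_orbit ` ?P" using T(1) unfolding openin_sym_product by blast
        then have "?k ` T = ?k ` sym_orbit ` ?P" by simp
        then show ?thesis by (simp add: image_image sym_chart_orbit)
      qed
      moreover have "open (\<sigma> ` coords \<zeta> ` ?P)" by (intro open_\<sigma>_image open_coords_image P PU)
      moreover have "?k ` T \<subseteq> chart_image (sym_chart U \<zeta>)" using T(2) by blast
      ultimately show "openin (top_of_set (chart_image (sym_chart U \<zeta>))) (?k ` T)"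
        using oI by (simp add: openin_open_eq)
    qed
    show "?k ` topspace (subtopology (sym_product X) ?N) = topspace (top_of_set (chart_image (sym_chart U \<zeta>)))"
      unfolding ts by simp
    show "inj_on ?k (topspace (subtopology (sym_product X) ?N))"
      unfolding ts
    proof (rule inj_onI)
      fix a b assume ab: "a \<in> ?N" "b \<in> ?N" "?k a = ?k b"
      then obtain p q where pq: "a = sym_orbit p" "b = sym_orbit q" "\<And>i. p i \<in> U" "\<And>i. q i \<in> U"
        unfolding fst_sym_chart by blast
      then have "\<sigma> (coords \<zeta> p) = \<sigma> (coords \<zeta> q)" using ab(3) by (simp add: sym_chart_orbit)
      then obtain \<pi> where \<pi>: "\<pi> permutes UNIV" "coords \<zeta> p = (\<chi> i. coords \<zeta> q $ (\<pi> i))" by (rule \<sigma>_eqD)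
      have "p i = q (\<pi> i)" for i
      proof -
        have "coords \<zeta> p $ i = coords \<zeta> q $ (\<pi> i)" using \<pi>(2) by simp
        then show ?thesis using lcf(3) pq(3)[of i] pq(4)[of "\<pi> i"] by (auto simp: coords_def dest: inj_onD)
      qed
      then have "p = q \<circ> \<pi>" by auto
      then have "sym_orbit q = sym_orbit p" unfolding sym_orbit_eq_iff using \<pi>(1) by blast
      then show "a = b" using pq by simp
    qed
  qed
qed

text \<open>In one direction the chart is composed with holomorphic functions. In the other one, passing from
  charts of \<open>X\<close> to \<open>\<zeta>\<close> makes the pullback under
  \<open>\<sigma>\<close> holomorphic, and \<open>holomorphic_of_pullback\<close> applies.\<close>

theorem sym_chart_in_sym_atlas: "sym_chart U \<zeta> \<in> sym_atlas X A"
  unfolding sym_atlas_def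
proof (intro CollectI conjI allI impI is_chart_sym_chart)
  fix E :: "(complex ^ 'n) set" and h :: "complex ^ 'n \<Rightarrow> complex"
  assume E: "open E" "E \<subseteq> chart_image (sym_chart U \<zeta>)"
  let ?H = "\<lambda>p. h (snd (sym_chart U \<zeta>) (sym_orbit p))"
  let ?S = "{p \<in> topspace XX. sym_orbit p \<in> fst (sym_chart U \<zeta>) \<and> snd (sym_chart U \<zeta>) (sym_orbit p) \<in> E}"
  show "holomorphic_fun_on h E \<longleftrightarrow> holomorphic_power_on A ?H ?S"
    unfolding vimage_eq unfolding sym_chart_orbit
  proof
    assume h: "holomorphic_fun_on h E"
    show "holomorphic_power_on A (\<lambda>p. h (\<sigma> (coords \<zeta> p))) {p. (\<forall>i. p i \<in> U) \<and> \<sigma> (coords \<zeta> p) \<in> E}"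
      unfolding holomorphic_power_on_def holomorphic_fun_on_iff
    proof (intro allI impI ballI)
      fix c :: "'n \<Rightarrow> ('a, complex) chart" and z :: "complex ^ 'n"
      assume c: "\<forall>i. c i \<in> A" and z: "z \<in> {z. (\<forall>i. z $ i \<in> chart_image (c i)) \<and>
        (\<lambda>i. chart_inv (c i) (z $ i)) \<in> {p. (\<forall>i. p i \<in> U) \<and> \<sigma> (coords \<zeta> p) \<in> E}}"
      have 1: "complex_differentiable_at (\<lambda>z. coords \<zeta> (\<lambda>i. chart_inv (c i) (z $ i)) $ j) z" for j
      proof -
        note cf = chart_facts[OF is_chart_A[OF RS c[rule_format]]]
        obtain x where x: "x \<in> fst (c j)" "z $ j = snd (c j) x" using z by blast
        moreover have "chart_inv (c j) (z $ j) \<in> U" using z by simp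
        then have "x \<in> U" unfolding x(2) cf(6)[OF x(1)] .
        ultimately have "z $ j \<in> snd (c j) ` (U \<inter> fst (c j))" by blast
        then have "(\<zeta> \<circ> chart_inv (c j)) field_differentiable at (z $ j)"
          using lcf(6) c cf(4)[OF lcf(1)] by (intro holomorphic_on_imp_differentiable_at) auto
        then obtain D where "((\<zeta> \<circ> chart_inv (c j)) has_field_derivative D) (at (z $ j))"
          unfolding field_differentiable_def by blast
        from cdiff_compose_nth[OF this] show ?thesis by (simp add: coords_def)
      qed
      have "complex_differentiable_at (\<lambda>z. \<sigma> (coords \<zeta> (\<lambda>i. chart_inv (c i) (z $ i))) $ j) z" for j
        by (rule cdiff_compose[OF 1 cdiff_\<sigma>])
      moreover have "complex_differentiable_at h (\<sigma> (coords \<zeta> (\<lambda>i. chart_inv (c i) (z $ i))))"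
        using h z unfolding holomorphic_fun_on_iff by blast
      ultimately show "complex_differentiable_at (\<lambda>z. h (\<sigma> (coords \<zeta> (\<lambda>i. chart_inv (c i) (z $ i))))) z"
        by (rule cdiff_compose)
    qed
  next
    assume H: "holomorphic_power_on A (\<lambda>p. h (\<sigma> (coords \<zeta> p))) {p. (\<forall>i. p i \<in> U) \<and> \<sigma> (coords \<zeta> p) \<in> E}"
    show "holomorphic_fun_on h E"
    proof (rule holomorphic_of_pullback[OF E(1)])
      show "holomorphic_fun_on (\<lambda>w. h (\<sigma> w)) (\<sigma> -` E)"
        unfolding holomorphic_fun_on_iff
      proof
        fix w assume w: "w \<in> \<sigma> -` E"
        then obtain p0 where p0: "\<And>i. p0 i \<in> U" "\<sigma> w = \<sigma> (coords \<zeta> p0)" using E(2) unfolding chart_image_sym_chart by blast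
        obtain \<pi> where \<pi>: "\<pi> permutes UNIV" "w = (\<chi> i. coords \<zeta> p0 $ (\<pi> i))" using \<sigma>_eqD[OF p0(2)] by blast
        define p where "p = p0 \<circ> \<pi>"
        have p: "\<And>i. p i \<in> U" "w = coords \<zeta> p" using p0(1) \<pi>(2) by (auto simp: p_def coords_def)
        have "\<forall>i. \<exists>c. c \<in> A \<and> p i \<in> fst c" using p(1) lcf(2) by (meson chart_at[OF RS] subsetD)
        from choice[OF this] obtain c where c: "\<And>i. c i \<in> A" "\<And>i. p i \<in> fst (c i)" by blast
        note cf = chart_facts[OF is_chart_A[OF RS c(1)]]
        define \<Theta> where "\<Theta> w' = (\<chi> i. snd (c i) (inv_into U \<zeta> (w' $ i)))" for w'
        define H where "H z = h (\<sigma> (coords \<zeta> (\<lambda>i. chart_inv (c i) (z $ i))))" for z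
        have \<Theta>w: "\<Theta> w $ i = snd (c i) (p i)" for i
          by (simp add: \<Theta>_def p(2) coords_def lcf(8)[OF p(1)])
        have dH: "complex_differentiable_at H (\<Theta> w)"
        proof -
          have "\<Theta> w \<in> {z. (\<forall>i. z $ i \<in> chart_image (c i)) \<and>
            (\<lambda>i. chart_inv (c i) (z $ i)) \<in> {p. (\<forall>i. p i \<in> U) \<and> \<sigma> (coords \<zeta> p) \<in> E}}"
          proof -
            have a: "chart_inv (c i) (\<Theta> w $ i) = p i" for i unfolding \<Theta>w by (rule cf(6)[OF c(2)])
            have b: "\<Theta> w $ i \<in> chart_image (c i)" for i unfolding \<Theta>w using c(2) by blast
            have "\<sigma> (coords \<zeta> p) \<in> E" using w unfolding p(2) by simp
            then show ?thesis using a b p(1) by simp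
          qed
          then show ?thesis
            using H c(1) unfolding H_def holomorphic_power_on_def holomorphic_fun_on_iff by blast
        qed
        have d\<Theta>: "complex_differentiable_at (\<lambda>w. \<Theta> w $ i) w" for i
        proof -
          have wi: "w $ i = \<zeta> (p i)" by (simp add: p(2) coords_def)
          have "(snd (c i) \<circ> inv_into U \<zeta>) field_differentiable at (w $ i)"
          proof (rule holomorphic_on_imp_differentiable_at[OF lcf(7)[OF c(1)[of i]]])
            show "open (\<zeta> ` (U \<inter> fst (c i)))" using lcf(1) cf(1) by (intro lcf(4)) auto
            show "w $ i \<in> \<zeta> ` (U \<inter> fst (c i))" unfolding wi using p(1) c(2) by blast
          qed
          then obtain D where "((snd (c i) \<circ> inv_into U \<zeta>) has_field_derivative D) (at (w $ i))"
            unfolding field_differentiable_def by blast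
          from cdiff_compose_nth[OF this] show ?thesis by (simp add: \<Theta>_def)
        qed
        have 1: "complex_differentiable_at (\<lambda>w. H (\<Theta> w)) w" by (rule cdiff_compose[OF d\<Theta> dH])
        let ?P = "{q. (\<forall>i. q i \<in> U) \<and> (\<forall>i. q i \<in> fst (c i))}"
        have P: "openin XX ?P" unfolding openin_power_iff
        proof
          fix q assume "q \<in> ?P"
          then show "\<exists>B. (\<forall>i. openin X (B i) \<and> q i \<in> B i) \<and> (\<forall>q. (\<forall>i. q i \<in> B i) \<longrightarrow> q \<in> ?P)"
            using lcf(1) cf(1) by (intro exI[of _ "\<lambda>i. U \<inter> fst (c i)"]) auto
        qed
        have oZ: "open (coords \<zeta> ` ?P)" by (rule open_coords_image[OF P]) auto
        have wZ: "w \<in> coords \<zeta> ` ?P" using p c(2) by blast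
        show "complex_differentiable_at (\<lambda>w. h (\<sigma> w)) w"
        proof (rule cdiff_transform[OF 1 oZ wZ])
          fix y assume "y \<in> coords \<zeta> ` ?P"
          then obtain q where q: "y = coords \<zeta> q" "\<And>i. q i \<in> U" "\<And>i. q i \<in> fst (c i)" by blast
          have "chart_inv (c i) (\<Theta> y $ i) = q i" for i
            using cf(6)[OF q(3)[of i]] by (simp add: \<Theta>_def q(1) coords_def lcf(8)[OF q(2)])
          then show "H (\<Theta> y) = h (\<sigma> y)" unfolding H_def by (simp add: q(1))
        qed
      qed
    qed
  qed
qed

end

lemma sym_atlas_holomorphic_iff:
  fixes c :: "(('n \<Rightarrow> 'a) set, complex ^ 'n) chart" and h :: "complex ^ 'n \<Rightarrow> complex"
  assumes "c \<in> sym_atlas X A" "open E" "E \<subseteq> chart_image c"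
  shows "holomorphic_fun_on h E \<longleftrightarrow> holomorphic_power_on A (\<lambda>p. h (snd c (sym_orbit p)))
    {p \<in> topspace XX. sym_orbit p \<in> fst c \<and> snd c (sym_orbit p) \<in> E}"
  using assms unfolding sym_atlas_def by simp

text \<open>The components of a transition map are the coordinate functions of the second chart, and these
  have the same pullback to \<open>X^n\<close> in both charts.\<close>

lemma sym_atlas_transition:
  fixes c c' :: "(('n \<Rightarrow> 'a) set, complex ^ 'n) chart"
  assumes c: "c \<in> sym_atlas X A" and c': "c' \<in> sym_atlas X A"
  shows "open (snd c ` (fst c \<inter> fst c'))"
    "\<And>x. x \<in> snd c ` (fst c \<inter> fst c') \<Longrightarrow> complex_differentiable_at (\<lambda>z. transition c c' z $ k) x"
proof -
  have ic: "is_chart (sym_product X) c" "is_chart (sym_product X) c'"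
    using c c' unfolding sym_atlas_def by auto
  note f = chart_facts[OF ic(1)] and f' = chart_facts[OF ic(2)]
  let ?E = "snd c ` (fst c \<inter> fst c')" and ?E' = "snd c' ` (fst c \<inter> fst c')"
  show oE: "open ?E" using f(4)[OF f'(1)] by (simp add: Int_commute)
  have oE': "open ?E'" using f'(4)[OF f(1)] .
  let ?S = "{p \<in> topspace XX. sym_orbit p \<in> fst c \<and> sym_orbit p \<in> fst c'}"
  have S: "{p \<in> topspace XX. sym_orbit p \<in> fst c \<and> snd c (sym_orbit p) \<in> ?E} = ?S"
    using inj_onD[OF f(3)] by blast
  have S': "{p \<in> topspace XX. sym_orbit p \<in> fst c' \<and> snd c' (sym_orbit p) \<in> ?E'} = ?S"
    using inj_onD[OF f'(3)] by blast
  have "openin (sym_product X) (fst c \<inter> fst c')" using f(1) f'(1) by blast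
  then have oS: "openin XX ?S" unfolding openin_sym_product by simp
  have "holomorphic_fun_on (\<lambda>w. w $ k) ?E'" unfolding holomorphic_fun_on_iff by blast
  then have "holomorphic_power_on A (\<lambda>p. snd c' (sym_orbit p) $ k) ?S"
    using sym_atlas_holomorphic_iff[OF c' oE', of "\<lambda>w. w $ k"] unfolding S' by blast
  then have "holomorphic_power_on A (\<lambda>p. transition c c' (snd c (sym_orbit p)) $ k) ?S"
    unfolding holomorphic_power_on_def holomorphic_fun_on_iff
  proof (intro allI impI ballI)
    fix e :: "'n \<Rightarrow> ('a, complex) chart" and z :: "complex ^ 'n"
    let ?B = "{z. (\<forall>i. z $ i \<in> chart_image (e i)) \<and> (\<lambda>i. chart_inv (e i) (z $ i)) \<in> ?S}"
    assume hol: "\<forall>e. (\<forall>i. e i \<in> A) \<longrightarrow> (\<forall>z\<in>{z. (\<forall>i. z $ i \<in> chart_image (e i)) \<and> (\<lambda>i. chart_inv (e i) (z $ i)) \<in> ?S}.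
      complex_differentiable_at (\<lambda>z. snd c' (sym_orbit (\<lambda>i. chart_inv (e i) (z $ i))) $ k) z)"
      and e: "\<forall>i. e i \<in> A" and z: "z \<in> ?B"
    have "complex_differentiable_at (\<lambda>z. snd c' (sym_orbit (\<lambda>i. chart_inv (e i) (z $ i))) $ k) z"
      using hol e z by blast
    then show "complex_differentiable_at (\<lambda>z. transition c c' (snd c (sym_orbit (\<lambda>i. chart_inv (e i) (z $ i)))) $ k) z"
    proof (rule cdiff_transform[OF _ open_chart_box[OF e[rule_format] oS] z])
      fix y assume "y \<in> ?B"
      then have "chart_inv c (snd c (sym_orbit (\<lambda>i. chart_inv (e i) (y $ i)))) = sym_orbit (\<lambda>i. chart_inv (e i) (y $ i))"
        by (intro f(6)) blast
      then show "snd c' (sym_orbit (\<lambda>i. chart_inv (e i) (y $ i))) $ k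
          = transition c c' (snd c (sym_orbit (\<lambda>i. chart_inv (e i) (y $ i)))) $ k"
        unfolding transition_def by simp
    qed
  qed
  then have "holomorphic_fun_on (\<lambda>z. transition c c' z $ k) ?E"
    using sym_atlas_holomorphic_iff[OF c oE, of "\<lambda>z. transition c c' z $ k"] unfolding S by blast
  then show "complex_differentiable_at (\<lambda>z. transition c c' z $ k) x" if "x \<in> ?E" for x
    using that unfolding holomorphic_fun_on_iff by blast
qed

end

section \<open>Holomorphic spheres and nonpositive curvature\<close>

definition vderiv :: "(complex \<Rightarrow> complex ^ 'n::finite) \<Rightarrow> complex \<Rightarrow> complex ^ 'n" where
  "vderiv s z = (\<chi> i. deriv (\<lambda>z. s z $ i) z)"

definition holomorphic_curve_on :: "(complex \<Rightarrow> complex ^ 'n::finite) \<Rightarrow> complex set \<Rightarrow> bool" where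
  "holomorphic_curve_on s W \<longleftrightarrow> (\<forall>i. (\<lambda>z. s z $ i) holomorphic_on W)"

lemma vderiv_has_derivative:
  assumes "holomorphic_curve_on s W" "open W" "z \<in> W"
  shows "(s has_derivative (\<lambda>h. h *s vderiv s z)) (at z)"
proof (rule has_derivative_vecI)
  fix i
  have "((\<lambda>z. s z $ i) has_field_derivative deriv (\<lambda>z. s z $ i) z) (at z)"
    using assms unfolding holomorphic_curve_on_def by (blast intro: holomorphic_derivI)
  moreover have "(*) (deriv (\<lambda>z. s z $ i) z) = (\<lambda>h. (h *s vderiv s z) $ i)"
    by (simp add: vderiv_def fun_eq_iff)
  ultimately show "((\<lambda>z. s z $ i) has_derivative (\<lambda>h. (h *s vderiv s z) $ i)) (at z)"
    unfolding has_field_derivative_def by simp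
qed

lemma vderiv_unique:
  assumes "(s has_derivative (\<lambda>h. h *s v)) (at z)" "holomorphic_curve_on s W" "open W" "z \<in> W"
  shows "vderiv s z = v"
proof -
  have "(\<lambda>h. h *s vderiv s z) = (\<lambda>h. h *s v)"
    using has_derivative_unique[OF vderiv_has_derivative[OF assms(2-4)] assms(1)] .
  from fun_cong[OF this, of 1] show ?thesis by simp
qed

lemma holomorphic_curve_vderiv:
  assumes "holomorphic_curve_on s W" "open W"
  shows "holomorphic_curve_on (vderiv s) W"
  using assms unfolding holomorphic_curve_on_def vderiv_def by (auto intro: holomorphic_deriv)

lemma holomorphic_curve_continuous:
  assumes "holomorphic_curve_on s W" shows "continuous_on W s"
  using assms unfolding holomorphic_curve_on_def
  by (intro continuous_on_vec_lambda[of W "\<lambda>i z. s z $ i", simplified] holomorphic_on_imp_continuous_on) auto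

context kaehler_domain
begin

text \<open>The squared speed is a polynomial in the components of the velocity and the coefficients of the
  metric.\<close>

lemma continuous_squared_speed:
  assumes "continuous_on W s" "continuous_on W v" "s ` W \<subseteq> S"
  shows "continuous_on W (\<lambda>z. g (s z) (v z) (v z))"
proof -
  have c: "continuous_on S (\<lambda>x. g x b b')" for b b'
    by (intro continuous_at_imp_continuous_on ballI differentiable_imp_continuous_within diff_g)
  have "continuous_on W (\<lambda>z. g (s z) b b')" for b b'
    using continuous_on_compose2[OF c assms(1,3)] .
  then have "continuous_on W (\<lambda>z. \<Sum>b\<in>Basis. \<Sum>b'\<in>Basis. ((v z \<bullet> b) * (v z \<bullet> b')) *\<^sub>R g (s z) b b')"
    by (intro continuous_intros assms(2))
  then show ?thesis
  proof (rule continuous_on_eq)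
    fix z assume "z \<in> W"
    then have "s z \<in> S" using assms(3) by blast
    from bilinear_expand[OF bil_g[OF this], of "v z" "v z"]
    show "(\<Sum>b\<in>Basis. \<Sum>b'\<in>Basis. ((v z \<bullet> b) * (v z \<bullet> b')) *\<^sub>R g (s z) b b') = g (s z) (v z) (v z)" by simp
  qed
qed

end

lemma kaehler_domain_of_form:
  assumes K: "kaehler_form \<A> \<omega>" and c: "c \<in> \<A>" and o: "open (chart_image c)"
  shows "kaehler_domain (chart_image c) (\<omega> c)" "kaehler_domain.g (\<omega> c) = kaehler_metric \<omega> c"
proof -
  have s: "smooth_two_form \<A> \<omega>" and cl: "closed_two_form \<A> \<omega>"
    and k: "\<And>x. x \<in> chart_image c \<Longrightarrow> (\<forall>v w. \<omega> c x (J v) (J w) = \<omega> c x v w) \<and> (\<forall>v. v \<noteq> 0 \<longrightarrow> \<omega> c x v (J v) > 0)"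
    using K c unfolding kaehler_form_def by auto
  have s1: "\<And>x. x \<in> chart_image c \<Longrightarrow> bilinear (\<omega> c x) \<and> (\<forall>v. \<omega> c x v v = 0)"
    and s2: "\<And>v w. smooth_on (chart_image c) (\<lambda>x. \<omega> c x v w)"
    using s c unfolding smooth_two_form_def by auto
  have c1: "\<And>x u v w. x \<in> chart_image c \<Longrightarrow>
     dirD (\<lambda>y. \<omega> c y v w) x u + dirD (\<lambda>y. \<omega> c y w u) x v + dirD (\<lambda>y. \<omega> c y u v) x w = 0"
    using cl c unfolding closed_two_form_def by blast
  show "kaehler_domain (chart_image c) (\<omega> c)"
  proof
    fix x u v w assume x: "x \<in> chart_image c"
    show "bilinear (\<omega> c x)" "\<omega> c x v v = 0" using s1[OF x] by auto
    show "dirD (\<lambda>y. \<omega> c y v w) x u + dirD (\<lambda>y. \<omega> c y w u) x v + dirD (\<lambda>y. \<omega> c y u v) x w = 0"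
      by (rule c1[OF x])
    show "\<omega> c x (J v) (J w) = \<omega> c x v w" using k[OF x] by simp
    show "\<omega> c x v (J v) > 0" if "v \<noteq> 0" using k[OF x] that by simp
  qed (rule o, rule s2)
  then interpret kaehler_domain "chart_image c" "\<omega> c" .
  show "kaehler_domain.g (\<omega> c) = kaehler_metric \<omega> c"
    by (intro ext) (simp add: g_def kaehler_metric_def)
qed

context sym_charts
begin

definition curve_in_chart :: "(('n \<Rightarrow> 'a) set, complex ^ 'n) chart \<Rightarrow> (complex \<Rightarrow> complex ^ 'n) \<Rightarrow> complex set \<Rightarrow>
    (complex \<Rightarrow> ('n \<Rightarrow> 'a) set) \<Rightarrow> bool" where
  "curve_in_chart c s W \<phi> \<longleftrightarrow> c \<in> sym_atlas X A \<and> open W \<and> holomorphic_curve_on s W \<and>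
     (\<forall>z\<in>W. \<phi> z \<in> fst c \<and> s z = snd c (\<phi> z))"

definition squared_speed :: "(('n \<Rightarrow> 'a) set, 'n) two_form \<Rightarrow> (('n \<Rightarrow> 'a) set, complex ^ 'n) chart \<Rightarrow>
    (complex \<Rightarrow> complex ^ 'n) \<Rightarrow> complex \<Rightarrow> real" where
  "squared_speed \<omega> c s z = kaehler_metric \<omega> c (s z) (vderiv s z) (vderiv s z)"

lemma is_chart_sym_atlas: "c \<in> sym_atlas X A \<Longrightarrow> is_chart (sym_product X) c"
  unfolding sym_atlas_def by blast

lemma open_chart_image: "c \<in> sym_atlas X A \<Longrightarrow> open (chart_image c)"
  using is_chart_sym_atlas unfolding is_chart_def by blast

text \<open>The differential of a transition map is complex linear, so it carries \<open>J v\<close> for the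
  velocity \<open>v\<close> in one chart to \<open>J\<close> of the velocity in the other chart.\<close>

lemma squared_speed_chart_independent:
  assumes K: "kaehler_form (sym_atlas X A) \<omega>"
    and c: "curve_in_chart c s W \<phi>" and c': "curve_in_chart c' s' W' \<phi>" and z: "z \<in> W" "z \<in> W'"
  shows "squared_speed \<omega> c s z = squared_speed \<omega> c' s' z"
proof -
  let ?T = "transition c c'"
  have cA: "c \<in> sym_atlas X A" "open W" "holomorphic_curve_on s W" "\<And>z. z \<in> W \<Longrightarrow> \<phi> z \<in> fst c \<and> s z = snd c (\<phi> z)"
    using c unfolding curve_in_chart_def by auto
  have cA': "c' \<in> sym_atlas X A" "open W'" "holomorphic_curve_on s' W'" "\<And>z. z \<in> W' \<Longrightarrow> \<phi> z \<in> fst c' \<and> s' z = snd c' (\<phi> z)"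
    using c' unfolding curve_in_chart_def by auto
  note f = chart_facts[OF is_chart_sym_atlas[OF cA(1)]]
  have mem: "s z \<in> snd c ` (fst c \<inter> fst c')" if "z \<in> W \<inter> W'" for z
    using cA(4)[of z] cA'(4)[of z] that by auto
  have Ts: "?T (s z) = s' z" if "z \<in> W \<inter> W'" for z
    using cA(4)[of z] cA'(4)[of z] f(6)[of "\<phi> z"] that by (simp add: transition_def)
  have zz: "z \<in> W \<inter> W'" using z by blast
  obtain D where D: "(?T has_derivative D) (at (s z))" "\<And>a v. D (a *s v) = a *s D v"
    by (rule has_derivative_of_cdiff_components[OF sym_atlas_transition(2)[OF cA(1) cA'(1) mem[OF zz]]]) blast
  have Df: "frechet_derivative ?T (at (s z)) = D" using frechet_derivative_at[OF D(1)] by simp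
  have "((\<lambda>z. ?T (s z)) has_derivative (\<lambda>h. D (h *s vderiv s z))) (at z)"
    using has_derivative_compose[OF vderiv_has_derivative[OF cA(3,2) z(1)] D(1)] .
  then have "(s' has_derivative (\<lambda>h. D (h *s vderiv s z))) (at z)"
    by (rule has_derivative_transform_within_open[OF _ _ zz Ts]) (use cA(2) cA'(2) in auto)
  then have v: "vderiv s' z = D (vderiv s z)"
    unfolding D(2) by (rule vderiv_unique[OF _ cA'(3,2) z(2)])
  have "\<forall>x\<in>snd c ` (fst c \<inter> fst c'). \<forall>v w. \<omega> c x v w = \<omega> c' (?T x) (dirD ?T x v) (dirD ?T x w)"
    using K cA(1) cA'(1) unfolding kaehler_form_def smooth_two_form_def by blast
  then have "\<omega> c (s z) v w = \<omega> c' (?T (s z)) (D v) (D w)" for v w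
    using mem[OF zz] unfolding Df[symmetric] by blast
  from this[of "vderiv s z" "J (vderiv s z)"] show ?thesis
    unfolding squared_speed_def kaehler_metric_def v Ts[OF zz] D(2) .
qed

text \<open>The curve \<open>\<phi>\<close> is holomorphic on \<open>\<complex>\<close>, and \<open>si\<close>
  extends \<open>w \<mapsto> \<phi> (1 / w)\<close> over \<open>0\<close> in the chart
  \<open>ci\<close>. Since \<open>d(1/z)/dz = - 1/z\<^sup>2\<close>, the squared speed is
  \<open>|1/z|^4\<close> times a function that is bounded near infinity, and its product with
  \<open>1 + |z|\<^sup>2\<close> has a global maximum.\<close>

theorem no_holomorphic_sphere:
  fixes \<omega> :: "(('n \<Rightarrow> 'a) set, 'n) two_form"
  assumes K: "kaehler_form (sym_atlas X A) \<omega>" and H: "nonpositive_hsc (sym_atlas X A) \<omega>"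
    and fin: "\<And>z. \<exists>c s W. z \<in> W \<and> curve_in_chart c s W \<phi>"
    and ci: "ci \<in> sym_atlas X A" and si: "holomorphic_curve_on si (ball 0 r)" and r: "r > 0"
    and si_im: "\<And>w. w \<in> ball 0 r \<Longrightarrow> si w \<in> chart_image ci"
    and si_eq: "\<And>w. w \<in> ball 0 r \<Longrightarrow> w \<noteq> 0 \<Longrightarrow> \<phi> (1 / w) \<in> fst ci \<and> si w = snd ci (\<phi> (1 / w))"
    and c0: "curve_in_chart c0 s0 W0 \<phi>" "z0 \<in> W0" "vderiv s0 z0 \<noteq> 0"
  shows False
proof -
  have "\<forall>z. \<exists>q. z \<in> snd (snd q) \<and> curve_in_chart (fst q) (fst (snd q)) (snd (snd q)) \<phi>" using fin by fastforce
  from choice[OF this] obtain q where q: "\<And>z. z \<in> snd (snd (q z))"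
    "\<And>z. curve_in_chart (fst (q z)) (fst (snd (q z))) (snd (snd (q z))) \<phi>" by blast
  define E where "E z = squared_speed \<omega> (fst (q z)) (fst (snd (q z))) z" for z
  have E: "E z = squared_speed \<omega> c s z" if "curve_in_chart c s W \<phi>" "z \<in> W" for c s W z
    unfolding E_def by (rule squared_speed_chart_independent[OF K q(2) that(1) q(1) that(2)])
  define F where "F z = E z * (1 + (cmod z)\<^sup>2)" for z
  have kd: "kaehler_domain (chart_image c) (\<omega> c)" "kaehler_domain.g (\<omega> c) = kaehler_metric \<omega> c"
    if "c \<in> sym_atlas X A" for c
    using kaehler_domain_of_form[OF K that open_chart_image[OF that]] by auto
  have Econt: "continuous_on UNIV E"
  proof (rule continuous_at_imp_continuous_on, rule ballI)
    fix z
    obtain c s W where W: "z \<in> W" "curve_in_chart c s W \<phi>" using fin by blast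
    then have cA: "c \<in> sym_atlas X A" "open W" "holomorphic_curve_on s W" "s ` W \<subseteq> chart_image c"
      unfolding curve_in_chart_def by auto
    have "continuous_on W (\<lambda>z. squared_speed \<omega> c s z)"
      unfolding squared_speed_def kd(2)[OF cA(1), symmetric]
      by (intro kaehler_domain.continuous_squared_speed[OF kd(1)[OF cA(1)]] holomorphic_curve_continuous
          holomorphic_curve_vderiv cA)
    then have "continuous_on W E" by (rule continuous_on_eq) (simp add: E[OF W(2)])
    then show "isCont E z" using cA(2) W(1) continuous_on_eq_continuous_at by blast
  qed
  have Fcont: "continuous_on UNIV F" unfolding F_def by (intro continuous_intros Econt)
  have E0: "E z0 > 0"
  proof -
    have cA: "c0 \<in> sym_atlas X A" "s0 z0 \<in> chart_image c0" using c0 unfolding curve_in_chart_def by auto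
    show ?thesis unfolding E[OF c0(1,2)] squared_speed_def kd(2)[OF cA(1), symmetric]
      by (rule kaehler_domain.g_pos[OF kd(1)[OF cA(1)] cA(2) c0(3)])
  qed
  have F0: "F z0 > 0" unfolding F_def using E0 by (simp add: add_pos_nonneg)
  define G where "G w = squared_speed \<omega> ci si w" for w
  have EG: "E z = (cmod (1 / z)) ^ 4 * G (1 / z)" if z: "cmod z > 1 / r" for z
  proof -
    define V where "V = {z. cmod z > 1 / r}"
    have V: "open V" unfolding V_def by (intro open_Collect_less continuous_intros)
    have zpos: "cmod z > 0" if "z \<in> V" for z using that r unfolding V_def by (auto intro: order.strict_trans[rotated])
    have inb: "1 / z \<in> ball 0 r" "1 / z \<noteq> 0" if "z \<in> V" for z
      using that zpos[OF that] r unfolding V_def by (auto simp: norm_divide field_simps)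
    define s where "s z = si (1 / z)" for z
    have sder: "(s has_derivative (\<lambda>h. h *s ((- (1 / z\<^sup>2)) *s vderiv si (1 / z)))) (at z)" if "z \<in> V" for z
    proof -
      have "((\<lambda>z. 1 / z) has_field_derivative - (1 / z\<^sup>2)) (at z)"
        using zpos[OF that] by (auto intro!: derivative_eq_intros simp: power2_eq_square)
      from has_derivative_compose[OF this[unfolded has_field_derivative_def]
          vderiv_has_derivative[OF si open_ball inb(1)[OF that]]]
      show ?thesis unfolding s_def by (rule has_derivative_eq_rhs) (simp add: fun_eq_iff vec_eq_iff)
    qed
    have hol: "holomorphic_curve_on s V"
      unfolding holomorphic_curve_on_def s_def
    proof
      fix i
      have "(\<lambda>w. si w $ i) holomorphic_on ball 0 r" using si unfolding holomorphic_curve_on_def by blast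
      moreover have "(\<lambda>z. 1 / z) holomorphic_on V" using zpos by (intro holomorphic_intros) auto
      moreover have "(\<lambda>z. 1 / z) ` V \<subseteq> ball 0 r" using inb by blast
      ultimately show "(\<lambda>z. si (1 / z) $ i) holomorphic_on V"
        using holomorphic_on_compose_gen[of "\<lambda>z. 1 / z" V "\<lambda>w. si w $ i" "ball 0 r"] by (simp add: o_def)
    qed
    have zV: "z \<in> V" using z unfolding V_def by simp
    have "curve_in_chart ci s V \<phi>"
      unfolding curve_in_chart_def
    proof (intro conjI ballI ci V hol)
      fix z assume "z \<in> V"
      then show "\<phi> z \<in> fst ci" "s z = snd ci (\<phi> z)" using si_eq[OF inb] by (simp_all add: s_def)
    qed
    then have "E z = squared_speed \<omega> ci s z" using E zV by blast
    also have "\<dots> = kaehler_metric \<omega> ci (si (1 / z)) ((- (1 / z\<^sup>2)) *s vderiv si (1 / z)) ((- (1 / z\<^sup>2)) *s vderiv si (1 / z))"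
      unfolding squared_speed_def vderiv_unique[OF sder[OF zV] hol V zV] by (simp only: s_def)
    also have "\<dots> = (cmod (- (1 / z\<^sup>2)))\<^sup>2 * G (1 / z)"
      unfolding G_def squared_speed_def kd(2)[OF ci, symmetric]
      by (rule kaehler_domain.g_theta[OF kd(1)[OF ci] si_im[OF inb(1)[OF zV]]])
    finally show ?thesis by (simp add: norm_divide norm_power power_divide flip: power_mult)
  qed
  have "continuous_on (cball 0 (r / 2)) G"
  proof -
    have "continuous_on (ball 0 r) G"
      unfolding G_def squared_speed_def kd(2)[OF ci, symmetric]
      using si_im by (intro kaehler_domain.continuous_squared_speed[OF kd(1)[OF ci]] holomorphic_curve_continuous
          holomorphic_curve_vderiv si) auto
    then show ?thesis by (rule continuous_on_subset) (use r in auto)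
  qed
  then have "bounded (G ` cball 0 (r / 2))" by (intro compact_imp_bounded compact_continuous_image) auto
  then obtain B where B: "B > 0" "\<And>w. w \<in> cball 0 (r / 2) \<Longrightarrow> \<bar>G w\<bar> \<le> B"
    unfolding bounded_pos by auto
  \<comment> \<open>Beyond \<open>R\<close>, with \<open>t = 1 / |z| \<le> 1\<close>, the product is at most \<open>B (t^4 + t\<^sup>2) \<le> 2 B t\<^sup>2 < F z0\<close>.\<close>
  define R where "R = max (max 1 (2 / r)) (max (cmod z0) (sqrt (2 * B / F z0)) + 1)"
  have small: "F z < F z0" if z: "cmod z \<ge> R" for z
  proof -
    have R: "cmod z \<ge> 1" "cmod z \<ge> 2 / r" "cmod z > sqrt (2 * B / F z0)" using z unfolding R_def by auto
    have "1 / r < 2 / r" using r by (simp add: divide_strict_right_mono)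
    then have zr: "cmod z > 1 / r" using R(2) by linarith
    define t where "t = cmod (1 / z)"
    have z1: "cmod z > 0" using R(1) by linarith
    have t: "0 < t" "t \<le> 1" "t * cmod z = 1"
      using R(1) z1 by (simp_all add: t_def norm_divide divide_le_eq)
    have "t \<le> r / 2" using R(2) z1 r by (simp add: t_def norm_divide field_simps)
    then have "\<bar>G (1 / z)\<bar> \<le> B" by (intro B(2)) (simp add: t_def)
    then have "E z \<le> t ^ 4 * B" unfolding EG[OF zr] t_def[symmetric] using t(1) by (intro mult_left_mono) auto
    then have "F z \<le> t ^ 4 * B * (1 + (cmod z)\<^sup>2)" unfolding F_def by (intro mult_right_mono) auto
    also have "\<dots> = B * (t ^ 4 + t\<^sup>2 * (t * cmod z)\<^sup>2)" by (simp add: algebra_simps power2_eq_square power4_eq_xxxx)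
    also have "\<dots> = B * (t ^ 4 + t\<^sup>2)" unfolding t(3) by simp
    also have "\<dots> \<le> B * (2 * t\<^sup>2)"
      using B(1) t(1,2) power_decreasing[of 2 4 t] by (intro mult_left_mono) auto
    also have "\<dots> < F z0"
    proof -
      have "2 * B / F z0 < (cmod z)\<^sup>2"
        using R(3) B(1) F0 by (metis divide_pos_pos less_le mult_pos_pos real_sqrt_less_iff real_sqrt_abs abs_norm_cancel zero_less_numeral)
      then have "2 * B < F z0 * (cmod z)\<^sup>2" using F0 by (simp add: divide_less_eq mult.commute)
      then have "t\<^sup>2 * (2 * B) < t\<^sup>2 * (F z0 * (cmod z)\<^sup>2)" using t(1) by (intro mult_strict_left_mono) auto
      also have "\<dots> = F z0 * (t * cmod z)\<^sup>2" by (simp add: power_mult_distrib)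
      finally show ?thesis unfolding t(3) by (simp add: mult_ac)
    qed
    finally show ?thesis .
  qed
  have z0R: "z0 \<in> cball 0 R" unfolding R_def by auto
  obtain zm where zm: "zm \<in> cball 0 R" "\<And>z. z \<in> cball 0 R \<Longrightarrow> F z \<le> F zm"
    using continuous_attains_sup[of "cball 0 R" F] continuous_on_subset[OF Fcont] z0R compact_cball by (metis empty_iff subset_UNIV)
  have max: "F z \<le> F zm" for z
    using small[of z] zm(2)[of z] zm(2)[OF z0R] by (cases "cmod z \<le> R") auto
  have Fm: "F zm > 0" using max[of z0] F0 by linarith
  obtain c s W where W: "zm \<in> W" "curve_in_chart c s W \<phi>" using fin by blast
  then have cA: "c \<in> sym_atlas X A" "open W" "holomorphic_curve_on s W" "\<And>z. z \<in> W \<Longrightarrow> s z \<in> chart_image c"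
    unfolding curve_in_chart_def by auto
  interpret kaehler_domain "chart_image c" "\<omega> c" by (rule kd(1)[OF cA(1)])
  have gE: "g (s z) (vderiv s z) (vderiv s z) = E z" if "z \<in> W" for z
    unfolding E[OF W(2) that] squared_speed_def kd(2)[OF cA(1)] ..
  have hv: "holomorphic_curve_on (vderiv s) W" "holomorphic_curve_on (vderiv (vderiv s)) W"
    using holomorphic_curve_vderiv cA(2,3) by blast+
  have nz: "vderiv s zm \<noteq> 0"
  proof
    assume "vderiv s zm = 0"
    then have "E zm = 0" using gE[OF W(1)] bilinear_lzero[OF bil_g[OF cA(4)[OF W(1)]]] by simp
    then show False using Fm by (simp add: F_def)
  qed
  have hsc: "sectional_curvature g (s zm) (vderiv s zm) (J (vderiv s zm)) \<le> 0"
    using H cA(1) cA(4)[OF W(1)] nz unfolding nonpositive_hsc_def holomorphic_sectional_curvature_def kd(2)[OF cA(1)] by blast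
  show False
  proof (rule no_local_maximum[OF cA(2) W(1) cA(4) vderiv_has_derivative[OF cA(3,2)] vderiv_has_derivative[OF hv(1) cA(2)]
        vderiv_has_derivative[OF hv(2) cA(2) W(1)] nz hsc])
    fix z assume "z \<in> W"
    then show "g (s z) (vderiv s z) (vderiv s z) * (1 + (cmod z)\<^sup>2)
        \<le> g (s zm) (vderiv s zm) (vderiv s zm) * (1 + (cmod zm)\<^sup>2)"
      using max[of z] W(1) unfolding F_def by (simp add: gE)
  qed
qed

end

section \<open>Fibres of a meromorphic function\<close>

text \<open>A chart of the projective line together with its inverse, which for both charts is defined on all
  of \<open>\<complex>\<close>.\<close>

definition projective_parameter :: "(complex option, complex) chart \<Rightarrow> (complex \<Rightarrow> complex option) \<Rightarrow> bool" where
  "projective_parameter c \<psi> \<longleftrightarrow> c \<in> CP1_atlas \<and> continuous_map euclidean CP1 \<psi> \<and> openin CP1 (fst c) \<and>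
     (\<forall>w. \<psi> w \<in> fst c \<and> snd c (\<psi> w) = w) \<and> (\<forall>y\<in>fst c. \<psi> (snd c y) = y)"

definition at_infinity_param :: "complex \<Rightarrow> complex option" where
  "at_infinity_param w = (if w = 0 then None else Some (1 / w))"

lemma topspace_CP1 [simp]: "topspace CP1 = UNIV"
  unfolding CP1_def by (auto simp: UNIV_option_conv)

lemma Hausdorff_CP1: "Hausdorff_space CP1"
  unfolding CP1_def
  by (simp add: Hausdorff_space_Alexandroff_compactification locally_compact_space_euclidean)

lemma projective_parameter_Some: "projective_parameter (range Some, the) Some"
  unfolding projective_parameter_def CP1_atlas_def CP1_def
  by (auto simp: continuous_map_Some)

lemma continuous_at_infinity_param: "continuous_map euclidean CP1 at_infinity_param"
  unfolding continuous_map_def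
proof (intro conjI allI impI)
  fix V assume "openin CP1 V"
  then consider U where "open U" "V = Some ` U" | C where "compact C" "V = insert None (Some ` (- C))"
    unfolding CP1_def openin_Alexandroff_compactification by (auto simp: Compl_eq_Diff_UNIV)
  then have "open {w. at_infinity_param w \<in> V}"
  proof cases
    case 1
    have c: "continuous_on (- {0 :: complex}) (\<lambda>w. 1 / w)" by (intro continuous_intros) auto
    have "open ((\<lambda>w. 1 / w) -` U \<inter> - {0 :: complex})"
      using c 1(1) continuous_on_open_vimage[of "- {0 :: complex}"] by (metis open_Compl closed_singleton)
    moreover have "{w. at_infinity_param w \<in> V} = (\<lambda>w. 1 / w) -` U \<inter> - {0}"
      unfolding 1 at_infinity_param_def by auto
    ultimately show ?thesis by simp
  next
    case 2
    have c: "continuous_on (- {0 :: complex}) (\<lambda>w. 1 / w)" by (intro continuous_intros) auto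
    have "open (- C)" using 2(1) compact_imp_closed by blast
    then have o: "open ((\<lambda>w. 1 / w) -` (- C) \<inter> - {0 :: complex})"
      using c continuous_on_open_vimage[of "- {0 :: complex}"] by (metis open_Compl closed_singleton)
    obtain M where M: "M > 0" "\<And>z. z \<in> C \<Longrightarrow> cmod z \<le> M"
      using compact_imp_bounded[OF 2(1)] unfolding bounded_pos by blast
    have "1 / w \<notin> C" if "w \<in> ball 0 (1 / M)" "w \<noteq> 0" for w
    proof
      assume "1 / w \<in> C"
      then have "1 / cmod w \<le> M" using M(2)[of "1 / w"] by (simp add: norm_divide)
      then show False using that M(1) by (simp add: field_simps)
    qed
    then have "{w. at_infinity_param w \<in> V} = ((\<lambda>w. 1 / w) -` (- C) \<inter> - {0}) \<union> ball 0 (1 / M)"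
      unfolding 2 at_infinity_param_def using M(1) by auto
    then show ?thesis using open_Un[OF o open_ball] by (simp only:)
  qed
  then show "openin euclidean {w \<in> topspace euclidean. at_infinity_param w \<in> V}" by simp
qed simp

lemma projective_parameter_infinity:
  "projective_parameter (- {Some 0}, \<lambda>p. case p of None \<Rightarrow> 0 | Some z \<Rightarrow> inverse z) at_infinity_param"
proof -
  have "closedin CP1 {Some 0}" using Hausdorff_CP1 by (simp add: closedin_Hausdorff_singleton)
  then have "openin CP1 (- {Some 0})" unfolding closedin_def by (simp add: Compl_eq_Diff_UNIV)
  then show ?thesis
    unfolding projective_parameter_def CP1_atlas_def using continuous_at_infinity_param
    by (auto simp: at_infinity_param_def inverse_eq_divide split: option.split)
qed

lemma exists_projective_parameter: "\<exists>c \<psi>. projective_parameter c \<psi> \<and> y \<in> fst c"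
proof (cases y)
  case None
  then have "y \<in> fst (- {Some 0}, \<lambda>p. case p of None \<Rightarrow> 0 | Some z \<Rightarrow> inverse z)" by simp
  then show ?thesis using projective_parameter_infinity by blast
next
  case (Some z)
  then have "y \<in> fst (range Some, the)" by simp
  then show ?thesis using projective_parameter_Some by blast
qed

text \<open>Compactness turns local isolation into finiteness.\<close>

lemma finite_of_isolated:
  assumes "compact_space X" and "\<And>x. x \<in> topspace X \<Longrightarrow> \<exists>V. openin X V \<and> x \<in> V \<and> V \<inter> S \<subseteq> {x}"
  shows "finite (topspace X \<inter> S)"
proof -
  obtain V where V: "\<And>x. x \<in> topspace X \<Longrightarrow> openin X (V x) \<and> x \<in> V x \<and> V x \<inter> S \<subseteq> {x}" using assms(2) by metis
  have "(\<forall>U \<in> V ` topspace X. openin X U) \<and> topspace X \<subseteq> \<Union>(V ` topspace X)" using V by blast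
  from assms(1)[unfolded compact_space_alt, THEN spec, THEN mp, OF this]
  obtain \<F> where F: "finite \<F>" "\<F> \<subseteq> V ` topspace X" "topspace X \<subseteq> \<Union>\<F>" by (elim exE conjE)
  obtain T where T: "T \<subseteq> topspace X" "finite T" "\<F> = V ` T" using finite_subset_image[OF F(1,2)] by blast
  have "topspace X \<inter> S \<subseteq> T" using F(3) T V by blast
  then show ?thesis using T(2) by (rule finite_subset)
qed

lemma local_coordinate_chart:
  assumes RS: "riemann_surface X A" and c: "c \<in> A"
  shows "local_coordinate X A (fst c) (snd c)"
  unfolding local_coordinate_def
proof (intro conjI ballI)
  note cf = chart_facts[OF is_chart_A[OF RS c]]
  show "openin X (fst c)" "inj_on (snd c) (fst c)" by (rule cf(1), rule cf(3))
  fix c' assume c': "c' \<in> A"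
  have "\<forall>c\<in>A. \<forall>c'\<in>A. transition c c' holomorphic_on snd c ` (fst c \<inter> fst c')"
    using RS unfolding riemann_surface_def by (elim conjE)
  then have "transition c' c holomorphic_on snd c' ` (fst c' \<inter> fst c)" using c c' by blast
  then show "(snd c \<circ> chart_inv c') holomorphic_on snd c' ` (fst c \<inter> fst c')"
    unfolding transition_def by (simp add: Int_commute)
qed

locale meromorphic_cover =
  fixes X :: "'a topology" and A :: "('a, complex) chart set" and f :: "'a \<Rightarrow> complex option"
  assumes RS: "riemann_surface X A" and compact: "compact_space X" and conn: "connected_space X"
    and hol: "holomorphic_map X A CP1 CP1_atlas f" and nonconst: "nonconstant_map X f"
begin

text \<open>Local injectivity expresses that \<open>f\<close> is unramified at \<open>x\<close> without
  reference to coordinates; in any coordinates it means that the derivative does not vanish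
  (\<open>deriv_nonzero_iff_locally_injective\<close>).\<close>

definition locally_injective :: "'a \<Rightarrow> bool" where
  "locally_injective x \<longleftrightarrow> (\<exists>V. openin X V \<and> x \<in> V \<and> inj_on f V)"

definition fibre :: "complex option \<Rightarrow> 'a set" where
  "fibre y = {x \<in> topspace X. f x = y}"

definition regular_value :: "complex option \<Rightarrow> bool" where
  "regular_value y \<longleftrightarrow> (\<forall>x\<in>fibre y. locally_injective x)"

lemma f_cont: "continuous_map X CP1 f" using hol unfolding holomorphic_map_def by blast

text \<open>Factor through a chart of the atlas, in which the holomorphy of \<open>f\<close> is given.\<close>

lemma coordinate_expression:
  assumes lc: "local_coordinate X A U \<zeta>" and \<psi>: "projective_parameter c' \<psi>"
  shows "openin X {x \<in> U. f x \<in> fst c'}" "open (\<zeta> ` {x \<in> U. f x \<in> fst c'})"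
    "(snd c' \<circ> f \<circ> inv_into U \<zeta>) holomorphic_on \<zeta> ` {x \<in> U. f x \<in> fst c'}"
proof -
  note lcf = local_coordinate_facts[OF RS lc]
  have "openin X {x \<in> topspace X. f x \<in> fst c'}"
    using f_cont \<psi> unfolding projective_parameter_def by (intro openin_continuous_map_preimage) auto
  from openin_Int[OF lcf(1) this] show o: "openin X {x \<in> U. f x \<in> fst c'}"
    using lcf(2) by (auto elim!: back_subst[of "openin X"])
  then show oi: "open (\<zeta> ` {x \<in> U. f x \<in> fst c'})" by (intro lcf(4)) auto
  show "(snd c' \<circ> f \<circ> inv_into U \<zeta>) holomorphic_on \<zeta> ` {x \<in> U. f x \<in> fst c'}"
    unfolding holomorphic_on_def
  proof
    fix z assume "z \<in> \<zeta> ` {x \<in> U. f x \<in> fst c'}"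
    then obtain x where x: "z = \<zeta> x" "x \<in> U" "f x \<in> fst c'" by blast
    obtain c where c: "c \<in> A" "x \<in> fst c" using chart_at[OF RS] x(2) lcf(2) by blast
    note cf = chart_facts[OF is_chart_A[OF RS c(1)]]
    let ?O = "{x \<in> U. f x \<in> fst c'} \<inter> fst c"
    have oO: "openin X ?O" using o cf(1) by blast
    have h1: "(snd c' \<circ> f \<circ> chart_inv c) holomorphic_on snd c ` {x \<in> fst c. f x \<in> fst c'}"
      using hol c(1) \<psi> unfolding holomorphic_map_def projective_parameter_def by blast
    have h2: "(snd c \<circ> inv_into U \<zeta>) holomorphic_on \<zeta> ` ?O"
      by (rule holomorphic_on_subset[OF lcf(7)[OF c(1)]]) blast
    have "(snd c' \<circ> f \<circ> chart_inv c) \<circ> (snd c \<circ> inv_into U \<zeta>) holomorphic_on \<zeta> ` ?O"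
    proof (rule holomorphic_on_compose_gen[OF h2 h1])
      show "(snd c \<circ> inv_into U \<zeta>) ` \<zeta> ` ?O \<subseteq> snd c ` {x \<in> fst c. f x \<in> fst c'}" using lcf(8) by auto
    qed
    then have "(snd c' \<circ> f \<circ> inv_into U \<zeta>) holomorphic_on \<zeta> ` ?O"
    proof (rule holomorphic_transform)
      fix y assume "y \<in> \<zeta> ` ?O"
      then obtain u where u: "y = \<zeta> u" "u \<in> U" "u \<in> fst c" by blast
      show "((snd c' \<circ> f \<circ> chart_inv c) \<circ> (snd c \<circ> inv_into U \<zeta>)) y = (snd c' \<circ> f \<circ> inv_into U \<zeta>) y"
        by (simp add: u(1) lcf(8)[OF u(2)] cf(6)[OF u(3)])
    qed
    moreover have "open (\<zeta> ` ?O)" by (rule lcf(4)[OF oO]) auto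
    moreover have "z \<in> \<zeta> ` ?O" using x c(2) by blast
    ultimately have "(snd c' \<circ> f \<circ> inv_into U \<zeta>) field_differentiable at z"
      by (rule holomorphic_on_imp_differentiable_at)
    then show "(snd c' \<circ> f \<circ> inv_into U \<zeta>) field_differentiable at z within \<zeta> ` {x \<in> U. f x \<in> fst c'}"
      by (rule field_differentiable_at_within)
  qed
qed

lemma deriv_nonzero_iff_locally_injective:
  assumes lc: "local_coordinate X A U \<zeta>" and \<psi>: "projective_parameter c' \<psi>" and x: "x \<in> U" "f x \<in> fst c'"
  shows "deriv (snd c' \<circ> f \<circ> inv_into U \<zeta>) (\<zeta> x) \<noteq> 0 \<longleftrightarrow> locally_injective x"
proof
  note lcf = local_coordinate_facts[OF RS lc] and ce = coordinate_expression[OF lc \<psi>]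
  let ?F = "snd c' \<circ> f \<circ> inv_into U \<zeta>" and ?O = "{x \<in> U. f x \<in> fst c'}"
  {
    assume "deriv ?F (\<zeta> x) \<noteq> 0"
    then obtain r where r: "r > 0" "ball (\<zeta> x) r \<subseteq> \<zeta> ` ?O" "inj_on ?F (ball (\<zeta> x) r)"
      using has_complex_derivative_locally_injective[OF ce(3) _ ce(2)] x by blast
    show "locally_injective x" unfolding locally_injective_def
    proof (intro exI conjI)
      show "openin X {u \<in> U. \<zeta> u \<in> ball (\<zeta> x) r}" by (rule lcf(5)) simp
      show "x \<in> {u \<in> U. \<zeta> u \<in> ball (\<zeta> x) r}" using x r by simp
      show "inj_on f {u \<in> U. \<zeta> u \<in> ball (\<zeta> x) r}"
      proof (rule inj_onI)
        fix u v assume u: "u \<in> {u \<in> U. \<zeta> u \<in> ball (\<zeta> x) r}" and v: "v \<in> {u \<in> U. \<zeta> u \<in> ball (\<zeta> x) r}" and "f u = f v"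
        then have "?F (\<zeta> u) = ?F (\<zeta> v)" using lcf(8)[of u] lcf(8)[of v] by simp
        then have "\<zeta> u = \<zeta> v" by (rule inj_onD[OF r(3)]) (use u v in auto)
        then show "u = v" using lcf(3) u v by (auto dest: inj_onD)
      qed
    qed
  }
  assume "locally_injective x"
  then obtain V where V: "openin X V" "x \<in> V" "inj_on f V" unfolding locally_injective_def by blast
  have o: "openin X (?O \<inter> V)" using ce(1) V(1) by blast
  show "deriv ?F (\<zeta> x) \<noteq> 0"
  proof (rule holomorphic_injective_imp_regular)
    show "?F holomorphic_on \<zeta> ` (?O \<inter> V)" by (rule holomorphic_on_subset[OF ce(3)]) blast
    show "open (\<zeta> ` (?O \<inter> V))" by (rule lcf(4)[OF o]) auto
    show "\<zeta> x \<in> \<zeta> ` (?O \<inter> V)" using x V by blast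
    have \<psi>': "\<psi> (snd c' y) = y" if "y \<in> fst c'" for y using \<psi> that unfolding projective_parameter_def by blast
    show "inj_on ?F (\<zeta> ` (?O \<inter> V))"
    proof (rule inj_onI)
      fix a b assume "a \<in> \<zeta> ` (?O \<inter> V)" "b \<in> \<zeta> ` (?O \<inter> V)" and eq: "?F a = ?F b"
      then obtain u v where uv: "a = \<zeta> u" "b = \<zeta> v" "u \<in> U" "v \<in> U" "f u \<in> fst c'" "f v \<in> fst c'" "u \<in> V" "v \<in> V" by blast
      have "snd c' (f u) = snd c' (f v)" using eq lcf(8)[OF uv(3)] lcf(8)[OF uv(4)] by (simp add: uv(1,2))
      then have "f u = f v" using \<psi>'[OF uv(5)] \<psi>'[OF uv(6)] by metis
      then show "a = b" using V(3) uv by (auto dest: inj_onD)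
    qed
  qed
qed

text \<open>In coordinates: the zeros of \<open>F - F (\<zeta> x)\<close> and those of the derivative of
  \<open>F\<close> are isolated unless \<open>F\<close> is constant near
  \<open>\<zeta> x\<close>.\<close>

lemma locally_constant_or_isolated:
  assumes x: "x \<in> topspace X"
  shows "(\<exists>V. openin X V \<and> x \<in> V \<and> (\<forall>u\<in>V. f u = f x)) \<or>
    (\<exists>V. openin X V \<and> x \<in> V \<and> (\<forall>u\<in>V - {x}. f u \<noteq> f x \<and> locally_injective u))"
proof -
  obtain c where c: "c \<in> A" "x \<in> fst c" using chart_at[OF RS x] by blast
  define U \<zeta> where "U = fst c" and "\<zeta> = snd c"
  have lc: "local_coordinate X A U \<zeta>" unfolding U_def \<zeta>_def by (rule local_coordinate_chart[OF RS c(1)])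
  have xU: "x \<in> U" using c by (simp add: U_def)
  obtain c' \<psi> where \<psi>: "projective_parameter c' \<psi>" "f x \<in> fst c'" using exists_projective_parameter by blast
  have \<psi>': "\<psi> (snd c' y) = y" if "y \<in> fst c'" for y using \<psi>(1) that unfolding projective_parameter_def by blast
  note lcf = local_coordinate_facts[OF RS lc] and ce = coordinate_expression[OF lc \<psi>(1)]
  let ?F = "snd c' \<circ> f \<circ> inv_into U \<zeta>" and ?O = "{x \<in> U. f x \<in> fst c'}"
  have Fx: "?F (\<zeta> u) = snd c' (f u)" if "u \<in> U" for u using lcf(8)[OF that] by simp
  obtain e where e: "e > 0" "ball (\<zeta> x) e \<subseteq> \<zeta> ` ?O" using ce(2) xU \<psi>(2) openE[of "\<zeta> ` ?O" "\<zeta> x"] by blast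
  have hF: "?F holomorphic_on ball (\<zeta> x) e" by (rule holomorphic_on_subset[OF ce(3) e(2)])
  have memO: "u \<in> ?O" if u: "u \<in> U" "\<zeta> u \<in> ball (\<zeta> x) e" for u
  proof -
    obtain v where v: "v \<in> ?O" "\<zeta> u = \<zeta> v" using e(2) u(2) by blast
    then have "u = v" using inj_onD[OF lcf(3) v(2) u(1)] by blast
    then show ?thesis using v(1) by simp
  qed
  show ?thesis
  proof (cases "\<forall>z\<in>ball (\<zeta> x) e. ?F z = ?F (\<zeta> x)")
    case True
    have "f u = f x" if "u \<in> U" "\<zeta> u \<in> ball (\<zeta> x) e" for u
    proof -
      have "snd c' (f u) = snd c' (f x)" using True that(2) Fx[OF that(1)] Fx[OF xU] by metis
      then show ?thesis using \<psi>'[of "f u"] \<psi>'[OF \<psi>(2)] memO[OF that] by simp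
    qed
    moreover have "openin X {u \<in> U. \<zeta> u \<in> ball (\<zeta> x) e}" by (rule lcf(5)) simp
    moreover have "x \<in> {u \<in> U. \<zeta> u \<in> ball (\<zeta> x) e}" using xU e(1) by simp
    ultimately show ?thesis by blast
  next
    case False
    then obtain \<beta> where \<beta>: "\<beta> \<in> ball (\<zeta> x) e" "?F \<beta> \<noteq> ?F (\<zeta> x)" by blast
    have hG: "(\<lambda>z. ?F z - ?F (\<zeta> x)) holomorphic_on ball (\<zeta> x) e" using hF by (intro holomorphic_intros)
    have xb: "\<zeta> x \<in> ball (\<zeta> x) e" using e(1) by simp
    have n1: "\<forall>\<^sub>F w in at (\<zeta> x). ?F w - ?F (\<zeta> x) \<noteq> 0 \<and> w \<in> ball (\<zeta> x) e"
      by (rule non_zero_neighbour_alt[OF hG open_ball _ xb \<beta>(1)]) (use \<beta>(2) in auto)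
    have hD: "deriv ?F holomorphic_on ball (\<zeta> x) e" using hF by (rule holomorphic_deriv) simp
    have "\<exists>\<beta>'\<in>ball (\<zeta> x) e. deriv ?F \<beta>' \<noteq> 0"
    proof (rule ccontr)
      assume "\<not> ?thesis"
      then have dz: "(?F has_field_derivative 0) (at z)" if "z \<in> ball (\<zeta> x) e" for z
        using holomorphic_derivI[OF hF open_ball that] that by auto
      have "\<exists>k. \<forall>z\<in>ball (\<zeta> x) e. ?F z = k"
        by (rule has_field_derivative_zero_constant[OF convex_ball])
          (rule has_field_derivative_at_within[OF dz])
      then obtain k where "\<And>z. z \<in> ball (\<zeta> x) e \<Longrightarrow> ?F z = k" by blast
      then have "?F \<beta> = ?F (\<zeta> x)" using \<beta>(1) xb by metis
      then show False using \<beta>(2) by simp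
    qed
    then obtain \<beta>' where "\<beta>' \<in> ball (\<zeta> x) e" "deriv ?F \<beta>' \<noteq> 0" by blast
    then have n2: "\<forall>\<^sub>F w in at (\<zeta> x). deriv ?F w \<noteq> 0 \<and> w \<in> ball (\<zeta> x) e"
      by (intro non_zero_neighbour_alt[OF hD open_ball _ xb]) auto
    from eventually_conj[OF n1 n2] obtain r where r: "r > 0"
      "\<And>w. w \<noteq> \<zeta> x \<Longrightarrow> dist w (\<zeta> x) < r \<Longrightarrow> ?F w \<noteq> ?F (\<zeta> x) \<and> deriv ?F w \<noteq> 0 \<and> w \<in> ball (\<zeta> x) e"
      unfolding eventually_at by auto
    show ?thesis
    proof (intro disjI2 exI conjI ballI)
      show "openin X {u \<in> U. \<zeta> u \<in> ball (\<zeta> x) r}" by (rule lcf(5)) simp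
      show "x \<in> {u \<in> U. \<zeta> u \<in> ball (\<zeta> x) r}" using xU r(1) by simp
      fix u assume u: "u \<in> {u \<in> U. \<zeta> u \<in> ball (\<zeta> x) r} - {x}"
      then have uU: "u \<in> U" by simp
      have "\<zeta> u \<noteq> \<zeta> x" using lcf(3) u xU by (auto dest: inj_onD)
      moreover have "dist (\<zeta> u) (\<zeta> x) < r" using u by (simp add: dist_commute)
      ultimately have rr: "?F (\<zeta> u) \<noteq> ?F (\<zeta> x)" "deriv ?F (\<zeta> u) \<noteq> 0" "\<zeta> u \<in> ball (\<zeta> x) e" using r(2)[of "\<zeta> u"] by auto
      show "f u \<noteq> f x" using rr(1) unfolding Fx[OF uU] Fx[OF xU] by metis
      show "locally_injective u"
        using deriv_nonzero_iff_locally_injective[OF lc \<psi>(1) uU] memO[OF uU rr(3)] rr(2) by blast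
    qed
  qed
qed

lemma no_open_point: "\<not> openin X {x}"
proof
  assume o: "openin X {x}"
  then have "x \<in> topspace X" using openin_subset by blast
  then obtain c where c: "c \<in> A" "x \<in> fst c" using chart_at[OF RS] by blast
  have "open (snd c ` ({x} \<inter> fst c))" by (rule chart_facts(4)[OF is_chart_A[OF RS c(1)] o])
  moreover have "snd c ` ({x} \<inter> fst c) = {snd c x}" using c(2) by auto
  ultimately show False using not_open_singleton[of "snd c x"] by simp
qed

text \<open>The set of points near which \<open>f\<close> is constantly \<open>y\<close> is open and closed.
  It is closed because \<open>f\<close> is locally injective at all other points near a point
  where it is not locally constant.\<close>

lemma not_locally_constant:
  assumes "openin X V" "x \<in> V" "\<forall>u\<in>V. f u = y"
  shows False
proof -
  define S where "S = {x \<in> topspace X. \<exists>V. openin X V \<and> x \<in> V \<and> (\<forall>u\<in>V. f u = y)}"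
  have S_val: "f u = y" if "u \<in> S" for u using that unfolding S_def by blast
  have S_open: "openin X S"
  proof (subst openin_subopen, intro ballI)
    fix x assume "x \<in> S"
    then obtain V where V: "openin X V" "x \<in> V" "\<forall>u\<in>V. f u = y" unfolding S_def by blast
    have "V \<subseteq> S" using V openin_subset[OF V(1)] unfolding S_def by blast
    then show "\<exists>T. openin X T \<and> x \<in> T \<and> T \<subseteq> S" using V by blast
  qed
  have "openin X (topspace X - S)"
  proof (subst openin_subopen, intro ballI)
    fix x assume x: "x \<in> topspace X - S"
    then consider V where "openin X V" "x \<in> V" "\<forall>u\<in>V. f u = f x"
      | V where "openin X V" "x \<in> V" "\<forall>u\<in>V - {x}. f u \<noteq> f x \<and> locally_injective u"
      using locally_constant_or_isolated[of x] by blast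
    then show "\<exists>T. openin X T \<and> x \<in> T \<and> T \<subseteq> topspace X - S"
    proof cases
      case 1
      have "f x \<noteq> y" using x 1 unfolding S_def by blast
      then have "V \<inter> S = {}" using 1(3) S_val by fastforce
      then show ?thesis using 1 openin_subset[OF 1(1)] by blast
    next
      case 2
      have "u \<notin> S" if u: "u \<in> V" "u \<noteq> x" for u
      proof
        assume "u \<in> S"
        then obtain V1 where V1: "openin X V1" "u \<in> V1" "\<forall>v\<in>V1. f v = y" unfolding S_def by blast
        obtain V2 where V2: "openin X V2" "u \<in> V2" "inj_on f V2" using 2(3) u unfolding locally_injective_def by blast
        have "v = u" if "v \<in> V1 \<inter> V2" for v
          by (rule inj_onD[OF V2(3)]) (use V1(2,3) V2(2) that in simp_all)
        then have "V1 \<inter> V2 = {u}" using V1(2) V2(2) by blast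
        then have "openin X {u}" using openin_Int[OF V1(1) V2(1)] by simp
        then show False using no_open_point by blast
      qed
      then have "V \<subseteq> topspace X - S" using openin_subset[OF 2(1)] x by blast
      then show ?thesis using 2 by blast
    qed
  qed
  then have "closedin X S" unfolding closedin_def S_def by auto
  then have "S = {} \<or> S = topspace X" using conn S_open unfolding connected_space_clopen_in by blast
  moreover have "x \<in> S" using assms openin_subset[OF assms(1)] unfolding S_def by blast
  ultimately have "S = topspace X" by blast
  then have "\<forall>x\<in>topspace X. f x = y" unfolding S_def by blast
  then show False using nonconst unfolding nonconstant_map_def by blast
qed

lemma isolated_point:
  assumes "x \<in> topspace X"
  shows "\<exists>V. openin X V \<and> x \<in> V \<and> (\<forall>u\<in>V - {x}. f u \<noteq> f x \<and> locally_injective u)"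
  using locally_constant_or_isolated[OF assms]
proof
  assume "\<exists>V. openin X V \<and> x \<in> V \<and> (\<forall>u\<in>V. f u = f x)"
  then show ?thesis using not_locally_constant by blast
qed

lemma finite_critical: "finite {x \<in> topspace X. \<not> locally_injective x}"
proof -
  have "finite (topspace X \<inter> {x. \<not> locally_injective x})"
  proof (rule finite_of_isolated[OF compact])
    fix x assume "x \<in> topspace X"
    then obtain V where "openin X V" "x \<in> V" "\<forall>u\<in>V - {x}. f u \<noteq> f x \<and> locally_injective u"
      using isolated_point by blast
    then show "\<exists>V. openin X V \<and> x \<in> V \<and> V \<inter> {x. \<not> locally_injective x} \<subseteq> {x}" by blast
  qed
  moreover have "topspace X \<inter> {x. \<not> locally_injective x} = {x \<in> topspace X. \<not> locally_injective x}" by blast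
  ultimately show ?thesis by simp
qed

lemma finite_fibre: "finite (fibre y)"
proof -
  have "finite (topspace X \<inter> {x. f x = y})"
  proof (rule finite_of_isolated[OF compact])
    fix x assume x: "x \<in> topspace X"
    show "\<exists>V. openin X V \<and> x \<in> V \<and> V \<inter> {x. f x = y} \<subseteq> {x}"
    proof (cases "f x = y")
      case True
      obtain V where "openin X V" "x \<in> V" "\<forall>u\<in>V - {x}. f u \<noteq> f x \<and> locally_injective u"
        using isolated_point[OF x] by blast
      then show ?thesis using True by blast
    next
      case False
      have "closedin CP1 {y}" using Hausdorff_CP1 by (simp add: closedin_Hausdorff_singleton)
      then have "openin CP1 (topspace CP1 - {y})" by blast
      from openin_continuous_map_preimage[OF f_cont this]
      have "openin X {x \<in> topspace X. f x \<noteq> y}" by simp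
      then show ?thesis using x False by blast
    qed
  qed
  moreover have "topspace X \<inter> {x. f x = y} = fibre y" unfolding fibre_def by blast
  ultimately show ?thesis by simp
qed

lemma map_mult_eq_1:
  assumes x: "x \<in> topspace X" "locally_injective x"
  shows "map_mult A CP1_atlas f x = 1"
proof -
  have 1: "zorder (\<lambda>z. snd c' (f (chart_inv c z)) - snd c' (f x)) (snd c x) = 1"
    if c: "c \<in> A" "x \<in> fst c" and c': "c' \<in> CP1_atlas" "f x \<in> fst c'" for c c'
  proof -
    obtain \<psi> where \<psi>: "projective_parameter c' \<psi>"
      using c'(1) projective_parameter_Some projective_parameter_infinity unfolding CP1_atlas_def by blast
    have lc: "local_coordinate X A (fst c) (snd c)" by (rule local_coordinate_chart[OF RS c(1)])
    note ce = coordinate_expression[OF lc \<psi>]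
    let ?F = "snd c' \<circ> f \<circ> chart_inv c" and ?O = "snd c ` {x \<in> fst c. f x \<in> fst c'}"
    have d: "deriv ?F (snd c x) \<noteq> 0" using deriv_nonzero_iff_locally_injective[OF lc \<psi> c(2) c'(2)] x(2) by blast
    have mem: "snd c x \<in> ?O" using c c' by blast
    have "?F field_differentiable at (snd c x)" using holomorphic_on_imp_differentiable_at[OF ce(3,2) mem] .
    then have "deriv (\<lambda>z. ?F z - snd c' (f x)) (snd c x) = deriv ?F (snd c x)" by (subst deriv_diff) auto
    then have d': "deriv (\<lambda>z. ?F z - snd c' (f x)) (snd c x) \<noteq> 0" using d by simp
    have "zorder (\<lambda>z. ?F z - snd c' (f x)) (snd c x) = 1"
    proof (rule zorder_zero_eqI[OF _ ce(2) mem])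
      show "(\<lambda>z. ?F z - snd c' (f x)) holomorphic_on ?O" using ce(3) by (intro holomorphic_intros)
      show "(deriv ^^ i) (\<lambda>z. ?F z - snd c' (f x)) (snd c x) = 0" if "i < nat 1" for i
        using that chart_facts(6)[OF is_chart_A[OF RS c(1)] c(2)] by simp
      show "(deriv ^^ nat 1) (\<lambda>z. ?F z - snd c' (f x)) (snd c x) \<noteq> 0" using d' by simp
    qed simp
    then show ?thesis by (simp add: o_def)
  qed
  obtain c where c: "c \<in> A" "x \<in> fst c" using chart_at[OF RS x(1)] by blast
  obtain c' \<psi> where c': "projective_parameter c' \<psi>" "f x \<in> fst c'" using exists_projective_parameter by blast
  then have c'A: "c' \<in> CP1_atlas" unfolding projective_parameter_def by blast
  show ?thesis unfolding map_mult_def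
  proof (rule the_equality)
    show "\<forall>c\<in>A. \<forall>c'\<in>CP1_atlas. x \<in> fst c \<longrightarrow> f x \<in> fst c' \<longrightarrow>
      zorder (\<lambda>z. snd c' (f (chart_inv c z)) - snd c' (f x)) (snd c x) = int 1" using 1 by simp
    fix k :: nat
    assume "\<forall>c\<in>A. \<forall>c'\<in>CP1_atlas. x \<in> fst c \<longrightarrow> f x \<in> fst c' \<longrightarrow>
      zorder (\<lambda>z. snd c' (f (chart_inv c z)) - snd c' (f x)) (snd c x) = int k"
    then have "int k = 1" using 1[OF c c'A c'(2)] c c'A c'(2) by metis
    then show "k = 1" by simp
  qed
qed

lemma card_regular_fibre:
  assumes "has_degree X A CP1 CP1_atlas f d" "regular_value y"
  shows "card (fibre y) = d"
proof -
  have "(\<Sum>x\<in>fibre y. map_mult A CP1_atlas f x) = d"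
    using assms(1) unfolding has_degree_def fibre_def by simp
  moreover have "(\<Sum>x\<in>fibre y. map_mult A CP1_atlas f x) = (\<Sum>x\<in>fibre y. 1)"
    using assms(2) unfolding regular_value_def by (intro sum.cong map_mult_eq_1) (auto simp: fibre_def)
  ultimately show ?thesis by simp
qed

text \<open>A continuous map from a compact space to a Hausdorff space is closed.\<close>

lemma fibre_neighbourhood:
  assumes \<psi>: "projective_parameter c' \<psi>" and V: "openin X V" "fibre (\<psi> w0) \<subseteq> V"
  obtains r where "r > 0" "\<And>w. w \<in> ball w0 r \<Longrightarrow> fibre (\<psi> w) \<subseteq> V"
proof -
  have "closedin X (topspace X - V)" using V(1) by blast
  then have "compactin X (topspace X - V)" using compact closedin_compact_space by blast
  then have "compactin CP1 (f ` (topspace X - V))" using f_cont image_compactin by blast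
  then have "closedin CP1 (f ` (topspace X - V))" using Hausdorff_CP1 compactin_imp_closedin by blast
  then have "openin CP1 (topspace CP1 - f ` (topspace X - V))" by blast
  moreover have "continuous_map euclidean CP1 \<psi>" using \<psi> unfolding projective_parameter_def by blast
  ultimately have "openin euclidean {w \<in> topspace euclidean. \<psi> w \<in> topspace CP1 - f ` (topspace X - V)}"
    by (intro openin_continuous_map_preimage)
  then have o: "open {w. \<psi> w \<notin> f ` (topspace X - V)}" by simp
  have "w0 \<in> {w. \<psi> w \<notin> f ` (topspace X - V)}" using V(2) unfolding fibre_def by auto
  then obtain r where r: "r > 0" "ball w0 r \<subseteq> {w. \<psi> w \<notin> f ` (topspace X - V)}" using o openE by blast
  show ?thesis
  proof (rule that[OF r(1)])
    fix w assume "w \<in> ball w0 r"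
    then have "\<psi> w \<notin> f ` (topspace X - V)" using r(2) by blast
    then have "f x \<noteq> \<psi> w" if "x \<in> topspace X - V" for x using that by (metis imageI)
    then show "fibre (\<psi> w) \<subseteq> V" unfolding fibre_def by blast
  qed
qed

lemma regular_punctured:
  assumes \<psi>: "projective_parameter c' \<psi>"
  obtains r where "r > 0" "\<And>w. w \<in> ball w0 r \<Longrightarrow> w \<noteq> w0 \<Longrightarrow> regular_value (\<psi> w)"
proof -
  let ?C = "f ` {x \<in> topspace X. \<not> locally_injective x}"
  have inj: "inj \<psi>" using \<psi> unfolding projective_parameter_def by (metis injI)
  have "finite (\<psi> -` ?C)" using finite_critical inj by (intro finite_vimageI) auto
  from finite_set_avoid[OF this, of w0]
  obtain r where r: "r > 0" "\<forall>w\<in>\<psi> -` ?C. w \<noteq> w0 \<longrightarrow> r \<le> dist w0 w" by (elim exE conjE)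
  show ?thesis
  proof (rule that[OF r(1)])
    fix w assume "w \<in> ball w0 r" "w \<noteq> w0"
    then have "w \<notin> \<psi> -` ?C" using r(2) by fastforce
    then have "\<psi> w \<notin> ?C" by simp
    then have "f x \<noteq> \<psi> w" if "x \<in> topspace X" "\<not> locally_injective x" for x
      using that by (metis (mono_tags, lifting) imageI mem_Collect_eq)
    then show "regular_value (\<psi> w)" unfolding regular_value_def fibre_def by blast
  qed
qed

end

section \<open>The sphere of fibres in the symmetric product\<close>

text \<open>Over a small disc the fibre consists of \<open>d\<close> holomorphic local inverses: their values
  are distinct because they lie in disjoint sets, and there are as many of them as points in the
  fibre.\<close>

lemma regular_fibre_product_holomorphic:
  fixes F :: "complex \<Rightarrow> complex"
  assumes S: "open S" "F holomorphic_on S" and W: "open W"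
    and fib: "\<And>w. w \<in> W \<Longrightarrow> finite {z \<in> S. F z = w} \<and> card {z \<in> S. F z = w} = d"
    and reg: "\<And>w z. w \<in> W \<Longrightarrow> z \<in> S \<Longrightarrow> F z = w \<Longrightarrow> deriv F z \<noteq> 0"
  shows "(\<lambda>w. \<Prod>z\<in>{z \<in> S. F z = w}. t - z) holomorphic_on W"
  unfolding holomorphic_on_def
proof
  fix w1 assume w1: "w1 \<in> W"
  define Q where "Q w = {z \<in> S. F z = w}" for w
  have finQ: "finite (Q w)" "card (Q w) = d" if "w \<in> W" for w using fib[OF that] unfolding Q_def by auto
  have haus: "Hausdorff_space (euclidean :: complex topology)" by simp
  obtain N where N: "\<And>q. q \<in> Q w1 \<Longrightarrow> openin euclidean (N q) \<and> q \<in> N q"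
    "\<And>p q. p \<in> Q w1 \<Longrightarrow> q \<in> Q w1 \<Longrightarrow> p \<noteq> q \<Longrightarrow> N p \<inter> N q = {}"
    by (rule disjoint_neighbourhoods[OF haus finQ(1)[OF w1]]) (simp, blast)
  have "\<exists>r>0. ball z r \<subseteq> S \<and> inj_on F (ball z r)" if "z \<in> Q w1" for z
  proof -
    have "z \<in> S" "deriv F z \<noteq> 0" using that reg[OF w1] unfolding Q_def by auto
    then show ?thesis using has_complex_derivative_locally_injective[OF S(2) _ S(1)] by metis
  qed
  then obtain r where r: "\<And>z. z \<in> Q w1 \<Longrightarrow> r z > 0 \<and> ball z (r z) \<subseteq> S \<and> inj_on F (ball z (r z))" by metis
  define T where "T z = N z \<inter> ball z (r z)" for z
  have T: "open (T z)" "z \<in> T z" "T z \<subseteq> S" "inj_on F (T z)" if "z \<in> Q w1" for z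
    using N(1)[OF that] r[OF that] unfolding T_def by (auto intro: inj_on_subset)
  have holT: "F holomorphic_on T z" if "z \<in> Q w1" for z using S(2) T(3)[OF that] by (rule holomorphic_on_subset)
  define V where "V = W \<inter> (\<Inter>z\<in>Q w1. F ` T z)"
  have oFT: "open (F ` T z)" if "z \<in> Q w1" for z by (rule open_mapping_thm3[OF holT[OF that] T(1)[OF that] T(4)[OF that]])
  have oV: "open V" unfolding V_def using W finQ(1)[OF w1] oFT by (intro open_Int open_INT) auto
  have w1V: "w1 \<in> V" unfolding V_def using w1 T(2) by (auto simp: Q_def)
  define g where "g z = inv_into (T z) F" for z
  have g: "g z w \<in> T z" "F (g z w) = w" if "z \<in> Q w1" "w \<in> V" for z w
  proof -
    have "w \<in> F ` T z" using that unfolding V_def by blast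
    then show "g z w \<in> T z" "F (g z w) = w" unfolding g_def by (auto intro: inv_into_into f_inv_into_f)
  qed
  have holg: "g z holomorphic_on V" if z: "z \<in> Q w1" for z
  proof -
    obtain k where k: "k holomorphic_on F ` T z" "\<And>u. u \<in> T z \<Longrightarrow> k (F u) = u"
      using holomorphic_has_inverse[OF holT[OF z] T(1)[OF z] T(4)[OF z]] by metis
    have "k holomorphic_on V" by (rule holomorphic_on_subset[OF k(1)]) (use z in \<open>auto simp: V_def\<close>)
    then show ?thesis
    proof (rule holomorphic_transform)
      fix w assume "w \<in> V"
      then show "k w = g z w" using k(2)[OF g(1)[OF z]] g(2)[OF z] by metis
    qed
  qed
  have eq: "(\<Prod>z\<in>Q w1. t - g z w) = (\<Prod>z\<in>Q w. t - z)" if w: "w \<in> V" for w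
  proof -
    have wW: "w \<in> W" using w unfolding V_def by blast
    have inj: "inj_on (\<lambda>z. g z w) (Q w1)"
    proof (rule inj_onI, rule ccontr)
      fix p q assume pq: "p \<in> Q w1" "q \<in> Q w1" "g p w = g q w" "p \<noteq> q"
      then show False using g(1)[OF pq(1) w] g(1)[OF pq(2) w] N(2)[OF pq(1,2,4)] unfolding T_def by auto
    qed
    have sub: "(\<lambda>z. g z w) ` Q w1 \<subseteq> Q w" using g[OF _ w] T(3) unfolding Q_def by blast
    have "card ((\<lambda>z. g z w) ` Q w1) = card (Q w)"
      using card_image[OF inj] finQ(2)[OF w1] finQ(2)[OF wW] by simp
    then have "(\<lambda>z. g z w) ` Q w1 = Q w" using card_subset_eq[OF finQ(1)[OF wW] sub] by blast
    then show ?thesis using prod.reindex[OF inj, of "\<lambda>z. t - z"] by (simp add: o_def)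
  qed
  have "(\<lambda>w. \<Prod>z\<in>Q w1. t - g z w) holomorphic_on V" by (intro holomorphic_intros holg)
  then have "(\<lambda>w. \<Prod>z\<in>Q w. t - z) holomorphic_on V" by (rule holomorphic_transform) (rule eq)
  then have "(\<lambda>w. \<Prod>z\<in>Q w. t - z) field_differentiable at w1"
    using oV w1V by (rule holomorphic_on_imp_differentiable_at)
  then show "(\<lambda>w. \<Prod>z\<in>{z \<in> S. F z = w}. t - z) field_differentiable at w1 within W"
    unfolding Q_def by (rule field_differentiable_at_within)
qed

text \<open>The index set \<open>D\<close> receives the points of a fibre, and the other indices receive the
  base point \<open>x0\<close>.\<close>

locale gonal_sphere = meromorphic_cover X A f + sym_charts \<tau> X A
  for X :: "'a topology" and A :: "('a, complex) chart set" and f :: "'a \<Rightarrow> complex option"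
    and \<tau> :: "'n::finite \<Rightarrow> complex" +
  fixes d :: nat and x0 :: 'a and D :: "'n set"
  assumes degree: "has_degree X A CP1 CP1_atlas f d" and x0: "x0 \<in> topspace X" and D: "card D = d"
begin

definition divisor_point :: "complex option \<Rightarrow> 'n \<Rightarrow> 'a" where
  "divisor_point y = (SOME p. bij_betw p D (fibre y) \<and> (\<forall>i. i \<notin> D \<longrightarrow> p i = x0))"

lemma divisor_point:
  assumes "regular_value y"
  shows "bij_betw (divisor_point y) D (fibre y)" "\<And>i. i \<notin> D \<Longrightarrow> divisor_point y i = x0"
proof -
  have "card D = card (fibre y)" using card_regular_fibre[OF degree assms] D by simp
  then obtain p where p: "bij_betw p D (fibre y)"
    using finite_same_card_bij[of D "fibre y"] finite_fibre by auto
  have "bij_betw (\<lambda>i. if i \<in> D then p i else x0) D (fibre y)"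
    using p by (subst bij_betw_cong[of D _ p]) auto
  then have "\<exists>p. bij_betw p D (fibre y) \<and> (\<forall>i. i \<notin> D \<longrightarrow> p i = x0)"
    by (intro exI[of _ "\<lambda>i. if i \<in> D then p i else x0"]) simp
  from someI_ex[OF this] show "bij_betw (divisor_point y) D (fibre y)" "\<And>i. i \<notin> D \<Longrightarrow> divisor_point y i = x0"
    unfolding divisor_point_def by auto
qed

text \<open>The coordinates of a divisor are products over the fibre, in the form required by
  \<open>regular_fibre_product_holomorphic\<close>.\<close>

lemma \<sigma>_divisor_point:
  assumes "regular_value y"
  shows "\<sigma> (coords \<zeta> (divisor_point y)) $ k = (\<Prod>x\<in>fibre y. \<tau> k - \<zeta> x) * (\<tau> k - \<zeta> x0) ^ card (- D)"
proof -
  have "(\<Prod>i\<in>UNIV. \<tau> k - \<zeta> (divisor_point y i))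
      = (\<Prod>i\<in>D. \<tau> k - \<zeta> (divisor_point y i)) * (\<Prod>i\<in>- D. \<tau> k - \<zeta> (divisor_point y i))"
    using prod.union_disjoint[of D "- D" "\<lambda>i. \<tau> k - \<zeta> (divisor_point y i)"] by (simp add: Compl_partition)
  also have "(\<Prod>i\<in>D. \<tau> k - \<zeta> (divisor_point y i)) = (\<Prod>x\<in>fibre y. \<tau> k - \<zeta> x)"
    by (rule prod.reindex_bij_betw[OF divisor_point(1)[OF assms]])
  also have "(\<Prod>i\<in>- D. \<tau> k - \<zeta> (divisor_point y i)) = (\<tau> k - \<zeta> x0) ^ card (- D)"
    using divisor_point(2)[OF assms] by simp
  finally show ?thesis by (simp add: \<sigma>_def coords_def)
qed

lemma compact_neighbourhood:
  assumes "finite Q" "Q \<subseteq> (W :: complex set)" "open W"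
  obtains K where "compact K" "Q \<subseteq> interior K" "K \<subseteq> W"
proof -
  have "\<forall>q\<in>Q. \<exists>e>0. cball q e \<subseteq> W" using assms(2,3) open_contains_cball by blast
  from bchoice[OF this] obtain e where e: "\<And>q. q \<in> Q \<Longrightarrow> e q > 0 \<and> cball q (e q) \<subseteq> W" by blast
  show ?thesis
  proof (rule that[of "\<Union>q\<in>Q. cball q (e q)"])
    show "compact (\<Union>q\<in>Q. cball q (e q))" using assms(1) by (intro compact_UN) auto
    show "(\<Union>q\<in>Q. cball q (e q)) \<subseteq> W" using e by blast
    show "Q \<subseteq> interior (\<Union>q\<in>Q. cball q (e q))"
    proof
      fix q assume q: "q \<in> Q"
      show "q \<in> interior (\<Union>q\<in>Q. cball q (e q))"
        by (rule interiorI[of "ball q (e q)"]) (use q e in \<open>auto intro: less_imp_le\<close>)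
    qed
  qed
qed

text \<open>The curve \<open>s\<close> is \<open>\<phi> \<circ> \<psi>\<close> in the chart \<open>c\<close>
  at regular values; at the centre, if it is critical, \<open>s\<close> supplies the limit.\<close>

definition fibre_curve :: "(complex \<Rightarrow> complex option) \<Rightarrow> complex \<Rightarrow>
    (('n \<Rightarrow> 'a) set, complex ^ 'n) chart \<Rightarrow> (complex \<Rightarrow> complex ^ 'n) \<Rightarrow> real \<Rightarrow> bool" where
  "fibre_curve \<psi> w0 c s r \<longleftrightarrow> r > 0 \<and> c \<in> sym_atlas X A \<and> holomorphic_curve_on s (ball w0 r) \<and>
    (\<forall>w\<in>ball w0 r. s w \<in> chart_image c) \<and> (\<forall>w\<in>ball w0 r. w \<noteq> w0 \<longrightarrow> regular_value (\<psi> w)) \<and>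
    (\<forall>w\<in>ball w0 r. regular_value (\<psi> w) \<longrightarrow>
       sym_orbit (divisor_point (\<psi> w)) \<in> fst c \<and> s w = snd c (sym_orbit (divisor_point (\<psi> w))))"

text \<open>All fibres near \<open>\<psi> w0\<close> lie in a compact part \<open>K\<close> of a coordinate
  \<open>\<zeta>\<close> around the fibre over \<open>\<psi> w0\<close> and the base point. Over
  the regular values the coordinates are holomorphic, and they are bounded because
  \<open>K\<close> is. If \<open>\<psi> w0\<close> is critical, they extend to \<open>w0\<close>
  by Riemann's theorem; the limit belongs to the closed image of \<open>K^n\<close> under
  \<open>\<sigma>\<close>, which lies in the chart.\<close>

theorem local_holomorphic_curve:
  assumes \<psi>: "projective_parameter c' \<psi>"
  shows "\<exists>c s r. fibre_curve \<psi> w0 c s r"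
proof -
  define Q where "Q = insert x0 (fibre (\<psi> w0))"
  have Q: "finite Q" "Q \<subseteq> topspace X" unfolding Q_def using finite_fibre x0 by (auto simp: fibre_def)
  obtain U \<zeta> where lc: "local_coordinate X A U \<zeta>" and QU: "Q \<subseteq> U"
    by (rule exists_local_coordinate[OF RS Q])
  note lcf = local_coordinate_facts[OF RS lc] and ce = coordinate_expression[OF lc \<psi>]
  have "open (\<zeta> ` U)" using lcf(1) by (intro lcf(4)) auto
  then obtain K where K: "compact K" "\<zeta> ` Q \<subseteq> interior K" "K \<subseteq> \<zeta> ` U"
    using compact_neighbourhood[of "\<zeta> ` Q" "\<zeta> ` U"] Q(1) QU by blast
  define V where "V = {x \<in> U. \<zeta> x \<in> interior K}"
  have V: "openin X V" unfolding V_def by (rule lcf(5)) simp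
  have "fibre (\<psi> w0) \<subseteq> V" using QU K(2) unfolding V_def Q_def by auto
  then obtain r1 where r1: "r1 > 0" "\<And>w. w \<in> ball w0 r1 \<Longrightarrow> fibre (\<psi> w) \<subseteq> V"
    using fibre_neighbourhood[OF \<psi> V] by blast
  obtain r2 where r2: "r2 > 0" "\<And>w. w \<in> ball w0 r2 \<Longrightarrow> w \<noteq> w0 \<Longrightarrow> regular_value (\<psi> w)"
    using regular_punctured[OF \<psi>] by blast
  define r where "r = min r1 r2"
  have r: "r > 0" using r1 r2 by (simp add: r_def)
  have fibV: "fibre (\<psi> w) \<subseteq> V" if "w \<in> ball w0 r" for w using r1(2)[of w] that by (simp add: r_def)
  have regp: "regular_value (\<psi> w)" if "w \<in> ball w0 r" "w \<noteq> w0" for w using r2(2)[of w] that by (simp add: r_def)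
  define B where "B = {w \<in> ball w0 r. regular_value (\<psi> w)}"
  define c where "c = sym_chart U \<zeta>"
  have cA: "c \<in> sym_atlas X A" unfolding c_def by (rule sym_chart_in_sym_atlas[OF lc])
  define s0 where "s0 w = \<sigma> (coords \<zeta> (divisor_point (\<psi> w)))" for w
  have Bcases: "B = ball w0 r \<or> B = ball w0 r - {w0}" using regp unfolding B_def by blast
  then have oB: "open B" by (auto simp: open_Diff)
  have pt: "divisor_point (\<psi> w) i \<in> V \<union> {x0}" if w: "w \<in> B" for w i
  proof (cases "i \<in> D")
    case True
    then have "divisor_point (\<psi> w) i \<in> fibre (\<psi> w)"
      using divisor_point(1)[of "\<psi> w"] w unfolding B_def bij_betw_def by blast
    then show ?thesis using fibV w unfolding B_def by blast
  next
    case False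
    then show ?thesis using divisor_point(2)[of "\<psi> w" i] w unfolding B_def by simp
  qed
  have ptU: "divisor_point (\<psi> w) i \<in> U" and ptK: "\<zeta> (divisor_point (\<psi> w) i) \<in> K" if "w \<in> B" for w i
    using pt[OF that, of i] QU K(2) interior_subset[of K] unfolding V_def Q_def by auto
  have in_chart: "sym_orbit (divisor_point (\<psi> w)) \<in> fst c" "snd c (sym_orbit (divisor_point (\<psi> w))) = s0 w" if "w \<in> B" for w
    unfolding c_def mem_sym_chart sym_chart_orbit s0_def using ptU[OF that] by auto
  have hol0: "(\<lambda>w. s0 w $ k) holomorphic_on B" for k
  proof -
    let ?F = "snd c' \<circ> f \<circ> inv_into U \<zeta>" and ?S = "\<zeta> ` {x \<in> U. f x \<in> fst c'}"
    have \<psi>': "\<And>w. \<psi> w \<in> fst c'" "\<And>w. snd c' (\<psi> w) = w" "\<And>y. y \<in> fst c' \<Longrightarrow> \<psi> (snd c' y) = y"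
      using \<psi> unfolding projective_parameter_def by auto
    have fib: "{z \<in> ?S. ?F z = w} = \<zeta> ` fibre (\<psi> w)" if w: "w \<in> B" for w
    proof (intro equalityI subsetI)
      fix z assume "z \<in> {z \<in> ?S. ?F z = w}"
      then obtain x where x: "z = \<zeta> x" "x \<in> U" "f x \<in> fst c'" "?F z = w" by blast
      then have "snd c' (f x) = w" using lcf(8)[OF x(2)] by simp
      then have "f x = \<psi> w" using \<psi>'(3)[OF x(3)] by simp
      then show "z \<in> \<zeta> ` fibre (\<psi> w)" using x lcf(2) unfolding fibre_def by blast
    next
      fix z assume "z \<in> \<zeta> ` fibre (\<psi> w)"
      then obtain x where x: "z = \<zeta> x" "x \<in> fibre (\<psi> w)" by blast
      then have xU: "x \<in> U" using fibV w unfolding B_def V_def by blast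
      have "f x = \<psi> w" using x(2) unfolding fibre_def by simp
      then have "z \<in> ?S" "?F z = w" using x xU \<psi>'(1,2) lcf(8)[OF xU] by auto
      then show "z \<in> {z \<in> ?S. ?F z = w}" by blast
    qed
    have injf: "inj_on \<zeta> (fibre (\<psi> w))" if w: "w \<in> B" for w
      using lcf(3) fibV w unfolding B_def V_def by (blast intro: inj_on_subset)
    have "(\<lambda>w. \<Prod>z\<in>{z \<in> ?S. ?F z = w}. \<tau> k - z) holomorphic_on B"
    proof (rule regular_fibre_product_holomorphic[OF ce(2,3) oB, where d = d])
      fix w assume w: "w \<in> B"
      show "finite {z \<in> ?S. ?F z = w} \<and> card {z \<in> ?S. ?F z = w} = d"
        unfolding fib[OF w] using card_image[OF injf[OF w]] card_regular_fibre[OF degree] finite_fibre w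
        by (simp add: B_def)
      fix z assume "z \<in> ?S" "?F z = w"
      then have "z \<in> \<zeta> ` fibre (\<psi> w)" using fib[OF w] by blast
      then obtain x where x: "z = \<zeta> x" "x \<in> fibre (\<psi> w)" by blast
      have xU: "x \<in> U" using x fibV w unfolding B_def V_def by blast
      have fx: "f x \<in> fst c'" using x(2) \<psi>'(1) unfolding fibre_def by simp
      have "locally_injective x" using w x(2) unfolding B_def regular_value_def by blast
      then show "deriv ?F z \<noteq> 0" unfolding x(1) using deriv_nonzero_iff_locally_injective[OF lc \<psi> xU fx] by blast
    qed
    then have "(\<lambda>w. (\<Prod>z\<in>{z \<in> ?S. ?F z = w}. \<tau> k - z) * (\<tau> k - \<zeta> x0) ^ card (- D)) holomorphic_on B"
      by (intro holomorphic_intros)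
    then show ?thesis
    proof (rule holomorphic_transform)
      fix w assume w: "w \<in> B"
      have "(\<Prod>z\<in>{z \<in> ?S. ?F z = w}. \<tau> k - z) = (\<Prod>x\<in>fibre (\<psi> w). \<tau> k - \<zeta> x)"
        unfolding fib[OF w] using prod.reindex[OF injf[OF w]] by simp
      then show "(\<Prod>z\<in>{z \<in> ?S. ?F z = w}. \<tau> k - z) * (\<tau> k - \<zeta> x0) ^ card (- D) = s0 w $ k"
        unfolding s0_def using \<sigma>_divisor_point[of "\<psi> w"] w by (simp add: B_def)
    qed
  qed
  define KK where "KK = {w :: complex ^ 'n. \<forall>i. w $ i \<in> K}"
  have "KK = (\<Inter>i. (\<lambda>w. w $ i) -` K)" unfolding KK_def by auto
  moreover have "closed ((\<lambda>w :: complex ^ 'n. w $ i) -` K)" for i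
    using compact_imp_closed[OF K(1)] by (intro closed_vimage continuous_intros)
  ultimately have "closed KK" by (simp add: closed_INT)
  then have cl: "closed (\<sigma> ` KK)" by (rule closed_\<sigma>_image)
  have im: "\<sigma> ` KK \<subseteq> chart_image c"
    unfolding c_def chart_image_sym_chart[OF lc] coords_image[OF lc] KK_def using K(3) by blast
  have s0K: "s0 w \<in> \<sigma> ` KK" if "w \<in> B" for w
    unfolding s0_def KK_def using ptK[OF that] by (intro imageI) (simp add: coords_def)
  obtain s where s: "holomorphic_curve_on s (ball w0 r)" "\<And>w. w \<in> B \<Longrightarrow> s w = s0 w"
  proof (cases "B = ball w0 r")
    case True
    show ?thesis by (rule that[of s0]) (use hol0 in \<open>simp_all add: holomorphic_curve_on_def flip: True\<close>)
  next
    case False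
    then have B: "B = ball w0 r - {w0}" using Bcases by blast
    obtain M where M: "\<And>z. z \<in> K \<Longrightarrow> cmod z \<le> M" using compact_imp_bounded[OF K(1)] unfolding bounded_iff by blast
    have "\<exists>g. g holomorphic_on ball w0 r \<and> (\<forall>w\<in>ball w0 r - {w0}. g w = s0 w $ k)" for k
    proof (subst holomorphic_on_extend_bounded)
      show "(\<lambda>w. s0 w $ k) holomorphic_on ball w0 r - {w0}" using hol0[of k] unfolding B .
      show "w0 \<in> interior (ball w0 r)" using r by simp
      have bd: "cmod (s0 w $ k) \<le> (cmod (\<tau> k) + M) ^ CARD('n)" if w: "w \<in> B" for w
      proof -
        have "cmod (s0 w $ k) = (\<Prod>i\<in>UNIV. cmod (\<tau> k - \<zeta> (divisor_point (\<psi> w) i)))"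
          unfolding s0_def \<sigma>_def coords_def by (simp add: prod_norm)
        also have "\<dots> \<le> (\<Prod>i\<in>(UNIV :: 'n set). cmod (\<tau> k) + M)"
          by (intro prod_mono conjI norm_ge_zero order_trans[OF norm_triangle_ineq4] add_left_mono M ptK[OF w])
        finally show ?thesis by simp
      qed
      have ev: "\<forall>\<^sub>F w in at w0. w \<in> B"
        unfolding B using eventually_at_ball[OF r, of w0 UNIV] eventually_neq_at_within[of w0 w0 UNIV]
        by eventually_elim auto
      show "\<exists>M. \<forall>\<^sub>F w in at w0. cmod (s0 w $ k) \<le> M"
        by (rule exI[of _ "(cmod (\<tau> k) + M) ^ CARD('n)"], rule eventually_mono[OF ev]) (rule bd)
    qed
    then obtain g where g: "\<And>k. g k holomorphic_on ball w0 r" "\<And>k w. w \<in> ball w0 r - {w0} \<Longrightarrow> g k w = s0 w $ k" by metis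
    show ?thesis
      by (rule that[of "\<lambda>w. \<chi> k. g k w"]) (use g B in \<open>simp_all add: holomorphic_curve_on_def vec_eq_iff\<close>)
  qed
  have s_im: "s w \<in> chart_image c" if w: "w \<in> ball w0 r" for w
  proof -
    have "s w \<in> \<sigma> ` KK"
    proof (cases "w \<in> B")
      case True
      then show ?thesis using s(2) s0K by simp
    next
      case False
      then have ww: "w = w0" using w regp unfolding B_def by blast
      have "continuous_on (ball w0 r) s" by (rule holomorphic_curve_continuous[OF s(1)])
      then have "isCont s w0" using r by (simp add: continuous_on_eq_continuous_at)
      then have lim: "(s \<longlongrightarrow> s w0) (at w0)" unfolding isCont_def .
      have "\<forall>\<^sub>F w in at w0. w \<in> B"
        using eventually_at_ball[OF r, of w0 UNIV] eventually_neq_at_within[of w0 w0 UNIV]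
        by eventually_elim (use regp in \<open>auto simp: B_def\<close>)
      then have "\<forall>\<^sub>F w in at w0. s w \<in> \<sigma> ` KK" by eventually_elim (use s(2) s0K in simp)
      then show ?thesis unfolding ww using Lim_in_closed_set[OF cl _ _ lim] by simp
    qed
    then show ?thesis using im by blast
  qed
  show ?thesis unfolding fibre_curve_def
  proof (intro exI conjI ballI impI)
    show "r > 0" "c \<in> sym_atlas X A" "holomorphic_curve_on s (ball w0 r)" by (rule r, rule cA, rule s(1))
    show "s w \<in> chart_image c" if "w \<in> ball w0 r" for w by (rule s_im[OF that])
    show "regular_value (\<psi> w)" if "w \<in> ball w0 r" "w \<noteq> w0" for w by (rule regp[OF that])
    fix w assume "w \<in> ball w0 r" "regular_value (\<psi> w)"
    then have w: "w \<in> B" unfolding B_def by blast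
    show "sym_orbit (divisor_point (\<psi> w)) \<in> fst c" by (rule in_chart(1)[OF w])
    show "s w = snd c (sym_orbit (divisor_point (\<psi> w)))" using in_chart(2)[OF w] s(2)[OF w] by simp
  qed
qed

end

context meromorphic_cover
begin

lemma topspace_nonempty: "topspace X \<noteq> {}"
  using nonconst unfolding nonconstant_map_def by auto

lemma infinite_topspace: "infinite (topspace X)"
proof
  assume fin: "finite (topspace X)"
  obtain x c where x: "x \<in> topspace X" "c \<in> A" "x \<in> fst c" using topspace_nonempty chart_at[OF RS] by blast
  note cf = chart_facts[OF is_chart_A[OF RS x(2)]]
  have "open (snd c ` (fst c \<inter> fst c))" by (rule cf(4)[OF cf(1)])
  moreover have "finite (snd c ` (fst c \<inter> fst c))" using fin cf(2) by (auto intro: finite_subset)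
  ultimately have "snd c ` (fst c \<inter> fst c) = {}" using finite_imp_not_open by blast
  then show False using x(3) by blast
qed

text \<open>A nonconstant map has infinitely many values and only finitely many critical ones.\<close>

lemma degree_positive:
  assumes "has_degree X A CP1 CP1_atlas f d" shows "d > 0"
proof -
  have "infinite (f ` topspace X)"
  proof
    assume fin: "finite (f ` topspace X)"
    have "topspace X = (\<Union>y\<in>f ` topspace X. fibre y)" unfolding fibre_def by blast
    then have "finite (topspace X)" using fin finite_fibre by (metis finite_UN_I)
    then show False using infinite_topspace by blast
  qed
  moreover have "finite (f ` {x \<in> topspace X. \<not> locally_injective x})" using finite_critical by blast
  ultimately obtain y where y: "y \<in> f ` topspace X" "y \<notin> f ` {x \<in> topspace X. \<not> locally_injective x}"
    by (meson finite_subset subsetI)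
  then have "regular_value y" unfolding regular_value_def fibre_def by blast
  then have "card (fibre y) = d" by (rule card_regular_fibre[OF assms])
  moreover have "fibre y \<noteq> {}" using y(1) unfolding fibre_def by blast
  ultimately show ?thesis using finite_fibre[of y] by (metis card_gt_0_iff)
qed

end

context gonal_sphere
begin

text \<open>The local curves of \<open>local_holomorphic_curve\<close> are glued to \<open>\<phi>\<close>: the
  divisor of a regular value, and the limit at a critical value. The map is not locally constant,
  for the support of the divisor over a regular value \<open>w\<close> contains a point of the
  fibre over \<open>w\<close>, and such a point is neither in another fibre nor equal to
  \<open>x0\<close>, if \<open>w \<noteq> f x0\<close>.\<close>

theorem no_nonpositive_kaehler_form:
  fixes \<omega> :: "(('n \<Rightarrow> 'a) set, 'n) two_form"
  assumes K: "kaehler_form (sym_atlas X A) \<omega>" and H: "nonpositive_hsc (sym_atlas X A) \<omega>"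
  shows False
proof -
  have "\<forall>z. \<exists>q. fibre_curve Some z (fst q) (fst (snd q)) (snd (snd q))"
  proof
    fix z
    from local_holomorphic_curve[OF projective_parameter_Some, of z] obtain c s r where
      "fibre_curve Some z c s r" by (elim exE)
    then show "\<exists>q. fibre_curve Some z (fst q) (fst (snd q)) (snd (snd q))" by (intro exI[of _ "(c, s, r)"]) simp
  qed
  from choice[OF this] obtain q where q: "\<And>z. fibre_curve Some z (fst (q z)) (fst (snd (q z))) (snd (snd (q z)))" by blast
  define cc ss rr where "cc z = fst (q z)" and "ss z = fst (snd (q z))" and "rr z = snd (snd (q z))" for z
  have r: "rr z > 0" and cA: "cc z \<in> sym_atlas X A" and hol: "holomorphic_curve_on (ss z) (ball z (rr z))" for z
    using q[of z] unfolding fibre_curve_def cc_def ss_def rr_def by auto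
  have im: "ss z w \<in> chart_image (cc z)" if "w \<in> ball z (rr z)" for z w
    using q[of z] that unfolding fibre_curve_def cc_def ss_def rr_def by blast
  have reg: "regular_value (Some w)" if "w \<in> ball z (rr z)" "w \<noteq> z" for z w
    using q[of z] that unfolding fibre_curve_def rr_def by blast
  have orb: "sym_orbit (divisor_point (Some w)) \<in> fst (cc z)" "ss z w = snd (cc z) (sym_orbit (divisor_point (Some w)))"
    if "w \<in> ball z (rr z)" "regular_value (Some w)" for z w
    using q[of z] that unfolding fibre_curve_def cc_def ss_def rr_def by blast+
  define \<phi> where "\<phi> z = (if regular_value (Some z) then sym_orbit (divisor_point (Some z)) else chart_inv (cc z) (ss z z))" for z
  have curve: "curve_in_chart (cc z) (ss z) (ball z (rr z)) \<phi>" for z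
    unfolding curve_in_chart_def
  proof (intro conjI cA open_ball hol ballI)
    fix w assume w: "w \<in> ball z (rr z)"
    have "\<phi> w \<in> fst (cc z) \<and> ss z w = snd (cc z) (\<phi> w)"
    proof (cases "regular_value (Some w)")
      case True
      then show ?thesis using orb[OF w] by (simp add: \<phi>_def)
    next
      case False
      then have wz: "w = z" using reg[OF w] by blast
      have "\<phi> w = chart_inv (cc z) (ss z z)" using False by (simp add: \<phi>_def wz)
      then show ?thesis using im[OF w] unfolding wz by (simp add: inv_into_into f_inv_into_f)
    qed
    then show "\<phi> w \<in> fst (cc z)" "ss z w = snd (cc z) (\<phi> w)" by auto
  qed
  from local_holomorphic_curve[OF projective_parameter_infinity, of 0] obtain ci si ri where
    fi: "fibre_curve at_infinity_param 0 ci si ri" by (elim exE)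
  note i = fi[unfolded fibre_curve_def]
  have inf: "\<phi> (1 / w) \<in> fst ci \<and> si w = snd ci (\<phi> (1 / w))" if w: "w \<in> ball 0 ri" "w \<noteq> 0" for w
  proof -
    have eq: "at_infinity_param w = Some (1 / w)" using w(2) by (simp add: at_infinity_param_def)
    have "regular_value (Some (1 / w))" using i w unfolding eq[symmetric] by blast
    then show ?thesis using i w(1) unfolding \<phi>_def eq[symmetric] by simp
  qed
  have "\<exists>w\<in>ball 0 (rr 0). vderiv (ss 0) w \<noteq> 0"
  proof (rule ccontr)
    assume "\<not> ?thesis"
    then have "(ss 0 has_derivative (\<lambda>h. 0)) (at w within ball 0 (rr 0))" if "w \<in> ball 0 (rr 0)" for w
      using vderiv_has_derivative[OF hol open_ball that] that by (auto intro: has_derivative_at_withinI)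
    then obtain k where k: "\<And>w. w \<in> ball 0 (rr 0) \<Longrightarrow> ss 0 w = k"
      using has_derivative_zero_constant[OF convex_ball] by metis
    define S where "S = ball 0 (rr 0) - {0, the (f x0)}"
    have "infinite (ball (0 :: complex) (rr 0))" using r[of 0] finite_imp_not_open[of "ball (0 :: complex) (rr 0)"] by auto
    then have "infinite S" unfolding S_def by simp
    then obtain w where w: "w \<in> S" by (metis ex_in_conv finite.emptyI)
    have "infinite (S - {w})" using \<open>infinite S\<close> by simp
    then obtain w' where w': "w' \<in> S - {w}" by (metis ex_in_conv finite.emptyI)
    have S: "u \<in> ball 0 (rr 0)" "regular_value (Some u)" "f x0 \<noteq> Some u" if "u \<in> S" for u
      using that reg[of u 0] unfolding S_def by auto
    have wS: "w' \<in> S" "w' \<noteq> w" using w' by auto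
    have "snd (cc 0) (sym_orbit (divisor_point (Some w))) = snd (cc 0) (sym_orbit (divisor_point (Some w')))"
      using orb(2)[OF S(1,2)[OF w]] orb(2)[OF S(1,2)[OF wS(1)]] k[OF S(1)[OF w]] k[OF S(1)[OF wS(1)]] by simp
    then have "sym_orbit (divisor_point (Some w)) = sym_orbit (divisor_point (Some w'))"
      by (rule inj_onD[OF chart_facts(3)[OF is_chart_sym_atlas[OF cA]] _ orb(1)[OF S(1,2)[OF w]] orb(1)[OF S(1,2)[OF wS(1)]]])
    then obtain \<pi> where \<pi>: "\<pi> permutes UNIV" "divisor_point (Some w') = divisor_point (Some w) \<circ> \<pi>"
      unfolding sym_orbit_eq_iff by blast
    have "D \<noteq> {}" using degree_positive[OF degree] D by auto
    then obtain i where iD: "i \<in> D" by blast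
    obtain j where j: "i = \<pi> j" using permutes_surj[OF \<pi>(1)] by (meson surjD)
    define x where "x = divisor_point (Some w) i"
    have fx: "f x = Some w"
      using divisor_point(1)[OF S(2)[OF w]] iD unfolding x_def bij_betw_def fibre_def by blast
    have xj: "x = divisor_point (Some w') j" unfolding x_def \<pi>(2) j by simp
    show False
    proof (cases "j \<in> D")
      case True
      then have "f x = Some w'"
        using divisor_point(1)[OF S(2)[OF wS(1)]] unfolding xj bij_betw_def fibre_def by blast
      then show False using fx wS(2) by simp
    next
      case False
      then have "x = x0" using divisor_point(2)[OF S(2)[OF wS(1)]] unfolding xj by blast
      then show False using fx S(3)[OF w] by simp
    qed
  qed
  then obtain w where w: "w \<in> ball 0 (rr 0)" "vderiv (ss 0) w \<noteq> 0" by blast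
  show False
  proof (rule no_holomorphic_sphere[OF K H, where \<phi> = \<phi> and ci = ci and si = si and r = ri])
    show "\<exists>c s W. z \<in> W \<and> curve_in_chart c s W \<phi>" for z
      using curve[of z] r[of z] by (intro exI[of _ "cc z"] exI[of _ "ss z"] exI[of _ "ball z (rr z)"]) simp
    show "ci \<in> sym_atlas X A" "holomorphic_curve_on si (ball 0 ri)" "ri > 0" using i by auto
    show "si w \<in> chart_image ci" if "w \<in> ball 0 ri" for w using i that by blast
    show "\<phi> (1 / w) \<in> fst ci \<and> si w = snd ci (\<phi> (1 / w))" if "w \<in> ball 0 ri" "w \<noteq> 0" for w by (rule inf[OF that])
    show "curve_in_chart (cc 0) (ss 0) (ball 0 (rr 0)) \<phi>" by (rule curve)
  qed (rule w)+
qed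

end

theorem proposition1p2:
  fixes X :: "'a topology" and A :: "('a, complex) chart set" and d n :: nat
  assumes "riemann_surface X A" "compact_space X" "connected_space X"
    and "is_gonality X A d"
    and "n \<ge> d" and "CARD('n::finite) = n"
  shows "\<not> (\<exists>\<omega> :: (('n \<Rightarrow> 'a) set, 'n) two_form.
            kaehler_form (sym_atlas X A) \<omega> \<and> nonpositive_hsc (sym_atlas X A) \<omega>)"
proof
  assume "\<exists>\<omega> :: (('n \<Rightarrow> 'a) set, 'n) two_form.
            kaehler_form (sym_atlas X A) \<omega> \<and> nonpositive_hsc (sym_atlas X A) \<omega>"
  then obtain \<omega> :: "(('n \<Rightarrow> 'a) set, 'n) two_form" where
    \<omega>: "kaehler_form (sym_atlas X A) \<omega>" "nonpositive_hsc (sym_atlas X A) \<omega>" by blast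
  obtain f where f: "holomorphic_map X A CP1 CP1_atlas f" "nonconstant_map X f" "has_degree X A CP1 CP1_atlas f d"
    using assms(4) unfolding is_gonality_def by blast
  interpret meromorphic_cover X A f by unfold_locales (use assms f in auto)
  obtain x0 where x0: "x0 \<in> topspace X" using topspace_nonempty by blast
  obtain D :: "'n set" where D: "card D = d"
    using obtain_subset_with_card_n[of d "UNIV :: 'n set"] assms(5,6) by auto
  obtain b :: "'n \<Rightarrow> nat" where "inj b" using finite_imp_inj_to_nat_seg[of "UNIV :: 'n set"] by auto
  then have "inj (\<lambda>i. of_nat (b i) :: complex)" by (simp add: inj_def)
  then interpret gonal_sphere X A f "\<lambda>i. of_nat (b i) :: complex" d x0 D
    by unfold_locales (use f x0 D RS in auto)
  show False by (rule no_nonpositive_kaehler_form[OF \<omega>])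
qed

end
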